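(* Let $\xi\in\Xi_N$ and let $k\in\{1,\dots,N-1\}$ with $\gcd(k,N)=1$. (a) If $\xi\notin\{\xi(\mathfrak N_k^+),\xi(\mathfrak N_k^-)\}$, then $\mathcal A_k(\cdot\,;2\pi)$ attains its minimum on the set of loops in $\Lambda^{D_N}_\xi$ satisfying $[z_0]=0$. (b) If $\xi=\xi(\mathfrak N_k^{+})$ or $\xi=\xi(\mathfrak N_k^{-})$, then $\mathcal A_k(\cdot\,;2\pi)$ has no minimizer on the set of loops in $\Lambda^{D_N}_\xi$ satisfying $[z_0]=0$, and the infimum of $\mathcal A_k(\cdot\,;2\pi)$ over that set is $0$. (c) Suppose $\xi=\xi(\mathfrak N_k^{\pm})$ for one of the two signs, and let $q^n\in\Lambda^{D_N}_\xi$ with $[z^n_0]=0$ and $\mathcal A_k(q^n;2\pi)\to0$. Then $|q^n_i(t)|\to\infty$ uniformly in $t\in\mathbb R$ for every $i\in\mathbf N$. Moreover, after passing to a subsequence, $q^n(t)/|q^n(t)|$ converges uniformly on $\mathbb R$ to $e^{-\mathrm ikt}\mathfrak N_k^{\pm}/|\mathfrak N_k^{\pm}|$, with the same sign as in $\xi=\xi(\mathfrak N_k^{\pm})$.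
   Context: Fix an integer $N\ge2$ and let $\mathbf N=\{0,\dots,N-1\}$. Consider unit masses with positions $q_i=(x_i,y_i,z_i)=(\zeta_i,z_i)\in\mathbb C\times\mathbb R$, where $\zeta_i=x_i+\mathrm iy_i$. - Potential: $U(q)=\sum_{i<j}1/|q_i-q_j|$. - Loop space: $\Lambda=H^1(\mathbb R/2\pi\mathbb Z,\mathbb R^{3N})$. - Rotating-frame action: $\mathcal A_\omega(q;T)=\int_0^T\big(\tfrac12\sum_i(|\dot\zeta_i+\mathrm i\omega\zeta_i|^2+\dot z_i^2)+U(q)\big)dt$. - Rotation of configurations: for a configuration $c=(\zeta_i,z_i)_i$ and $\theta\in\mathbb R$, $e^{\mathrm i\theta}c=(e^{\mathrm i\theta}\zeta_i,z_i)_i$. $|\cdot|$ denotes the Euclidean norm on $\mathbb R^{3N}$ or $\mathbb R^3$. - Mean: $[z_0]=\frac1{2\pi}\int_0^{2\pi}z_0$. - Reflection: $\mathfrak R_{xz}(x,y,z)=(x,-y,z)$. - $D_N$-symmetric loops: $\Lambda^{D_N}=\{q\in\Lambda: q_i(t)=q_0(t+2\pi i/N),\ q_0(2\pi-t)=\mathfrak R_{xz}q_0(t)\}$. - Sign data: for collision-free $q\in\Lambda^{D_N}$, $y_0(j\pi/N)\ne0$ for $j=1,\dots,N-1$. Let $\Xi_N=\{\pm1\}^{N-1}$. - Topological classes: $\Lambda^{D_N}_\xi$ is the weak $H^1$-closure in $\Lambda^{D_N}$ of the collision-free $q\in\Lambda^{D_N}$ with $\operatorname{sign}y_0(j\pi/N)=\xi_j$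 for all $j$. - Regular $N$-gons $\mathfrak N_k^{\pm}$: for $k\in\{1,\dots,N-1\}$ with $\gcd(k,N)=1$, these are the two configurations forming a regular $N$-gon in the $xy$-plane centered at the origin with the following placement. Starting from the vertex occupied by $m_i$ (counted as the first), $m_{i+1}$ occupies the $(k+1)$-th vertex in the clockwise direction. The mass $m_0$ lies on the negative $x$-axis for $\mathfrak N_k^-$ and on the positive $x$-axis for $\mathfrak N_k^+$. The size is chosen so that $e^{\mathrm it}\mathfrak N_k^{\pm}$ solves Newton's equations. - Associated sign vectors: for every $\lambda>0$, the loop $\lambda e^{-\mathrm ikt}\mathfrak N_k^\pm$ lies in $\Lambda^{D_N}$, and $\xi(\mathfrak N_k^{\pm})\in\Xi_N$ denotes the unique element with $\lambda e^{-\mathrm ikt}\mathfrak N_k^{\pm}\in\Lambda^{D_N}_{\xi(\mathfrak N_k^\pm)}$. *)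

theory Defs
  imports "HOL-Analysis.Analysis"
begin

text \<open>A configuration of point masses: mass i sits at (zeta_i, z_i) in C x R
  (the product norm is the Euclidean norm on R^3). Only indices i < N matter.
  A loop assigns to every mass index i a function of time.\<close>

type_synonym config = "nat \<Rightarrow> complex \<times> real"
type_synonym loop = "nat \<Rightarrow> real \<Rightarrow> complex \<times> real"

definition cfg_norm :: "nat \<Rightarrow> config \<Rightarrow> real" where
  "cfg_norm N c = sqrt (\<Sum>i<N. (norm (c i))\<^sup>2)"

definition H1_loop :: "nat \<Rightarrow> loop \<Rightarrow> bool" where
  "H1_loop N q \<longleftrightarrow> (\<forall>i<N. (\<forall>t. q i (t + 2*pi) = q i t) \<and>
     (\<exists>v. v absolutely_integrable_on {0..2*pi} \<and>
          (\<lambda>t. (norm (v t))\<^sup>2) integrable_on {0..2*pi} \<and>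
          (\<forall>t\<in>{0..2*pi}. (v has_integral (q i t - q i 0)) {0..t})))"

text \<open>H^1 inner product (derivatives exist a.e. for H^1 loops).\<close>
definition H1_inner :: "nat \<Rightarrow> loop \<Rightarrow> loop \<Rightarrow> real" where
  "H1_inner N q p = integral {0..2*pi} (\<lambda>t. \<Sum>i<N. inner (q i t) (p i t)
       + inner (vector_derivative (q i) (at t)) (vector_derivative (p i) (at t)))"

definition Rxz :: "complex \<times> real \<Rightarrow> complex \<times> real" where
  "Rxz c = (cnj (fst c), snd c)"

definition Lambda_DN :: "nat \<Rightarrow> loop set" where
  "Lambda_DN N = {q. H1_loop N q \<and>
     (\<forall>i<N. \<forall>t. q i t = q 0 (t + 2*pi*real i / real N)) \<and>
     (\<forall>t. q 0 (2*pi - t) = Rxz (q 0 t))}"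

definition collision_free :: "nat \<Rightarrow> loop \<Rightarrow> bool" where
  "collision_free N q \<longleftrightarrow> (\<forall>t. \<forall>i<N. \<forall>j<N. i \<noteq> j \<longrightarrow> q i t \<noteq> q j t)"

definition Xi :: "nat \<Rightarrow> (nat \<Rightarrow> real) set" where
  "Xi N = {\<xi>. \<forall>j. (1 \<le> j \<and> j \<le> N - 1 \<longrightarrow> \<xi> j \<in> {-1, 1}) \<and>
                  (\<not> (1 \<le> j \<and> j \<le> N - 1) \<longrightarrow> \<xi> j = 0)}"

definition sign_vec :: "nat \<Rightarrow> loop \<Rightarrow> nat \<Rightarrow> real" where
  "sign_vec N q j = (if 1 \<le> j \<and> j \<le> N - 1
       then sgn (Im (fst (q 0 (real j * pi / real N)))) else 0)"

text \<open>Weak H^1 closure inside Lambda^{D_N}: basic weak neighbourhoods are given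
  by finitely many functionals x |-> <x, p>_{H^1} (Riesz).\<close>
definition weak_closure :: "nat \<Rightarrow> loop set \<Rightarrow> loop set" where
  "weak_closure N C = {q \<in> Lambda_DN N. \<forall>P. finite P \<longrightarrow> P \<subseteq> {p. H1_loop N p} \<longrightarrow>
      (\<forall>\<epsilon>>0. \<exists>c\<in>C. \<forall>p\<in>P. \<bar>H1_inner N (\<lambda>i t. c i t - q i t) p\<bar> < \<epsilon>)}"

definition Lambda_xi :: "nat \<Rightarrow> (nat \<Rightarrow> real) \<Rightarrow> loop set" where
  "Lambda_xi N \<xi> = weak_closure N
     {q \<in> Lambda_DN N. collision_free N q \<and> sign_vec N q = \<xi>}"

definition rot :: "real \<Rightarrow> config \<Rightarrow> config" where
  "rot \<theta> c = (\<lambda>i. (cis \<theta> * fst (c i), snd (c i)))"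

definition newton_sol :: "nat \<Rightarrow> loop \<Rightarrow> bool" where
  "newton_sol N x \<longleftrightarrow> (\<forall>i<N. \<exists>v. \<forall>t. (x i has_vector_derivative v t) (at t) \<and>
     (v has_vector_derivative
        (\<Sum>j\<in>{..<N} - {i}. (1 / (norm (x j t - x i t)) ^ 3) *\<^sub>R (x j t - x i t))) (at t))"

text \<open>Regular N-gon of circumradius r in the xy-plane: m_{i+1} is k vertices clockwise
  from m_i; m_0 at s*r on the x-axis (s = 1: positive, s = -1: negative x-axis).\<close>
definition polygon :: "nat \<Rightarrow> nat \<Rightarrow> real \<Rightarrow> real \<Rightarrow> config" where
  "polygon N k s r = (\<lambda>i. (complex_of_real (s * r) * cis (- 2 * pi * real k * real i / real N), 0))"

definition Ngon :: "nat \<Rightarrow> nat \<Rightarrow> real \<Rightarrow> config" where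
  "Ngon N k s = polygon N k s
     (THE r. r > 0 \<and> newton_sol N (\<lambda>i t. rot t (polygon N k s r) i))"

definition rot_loop :: "nat \<Rightarrow> real \<Rightarrow> config \<Rightarrow> loop" where
  "rot_loop k lam c = (\<lambda>i t. lam *\<^sub>R rot (- real k * t) c i)"

definition xi_Ngon :: "nat \<Rightarrow> nat \<Rightarrow> real \<Rightarrow> nat \<Rightarrow> real" where
  "xi_Ngon N k s = (THE \<xi>. \<xi> \<in> Xi N \<and> (\<forall>lam>0. rot_loop k lam (Ngon N k s) \<in> Lambda_xi N \<xi>))"

text \<open>Rotating-frame action A_omega(q;T) as a nonnegative extended integral;
  the potential is +infinity at collisions.\<close>
definition action :: "nat \<Rightarrow> real \<Rightarrow> loop \<Rightarrow> real \<Rightarrow> ennreal" where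
  "action N \<omega> q T = (\<integral>\<^sup>+ t \<in> {0..T}.
      ennreal ((1/2) * (\<Sum>i<N. (cmod (fst (vector_derivative (q i) (at t))
                                   + \<i> * complex_of_real \<omega> * fst (q i t)))\<^sup>2
                              + (snd (vector_derivative (q i) (at t)))\<^sup>2))
      + (if \<exists>i<N. \<exists>j<N. i \<noteq> j \<and> q i t = q j t then top
         else ennreal (\<Sum>i<N. \<Sum>j\<in>{i<..<N}. 1 / norm (q i t - q j t))) \<partial>lebesgue)"

definition mean_z0 :: "loop \<Rightarrow> real" where
  "mean_z0 q = (1 / (2*pi)) * integral {0..2*pi} (\<lambda>t. snd (q 0 t))"

end

theory Submission
  imports Defs "HOL-Complex_Analysis.Great_Picard"
begin

text \<open>In the frame rotating with angular velocity \<open>k\<close> the kinetic part of the action is the Dirichlet energy of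
  \<open>U = (cis (k * t) * \<zeta>\<^sub>0, z\<^sub>0)\<close>. By the symmetry \<open>U 0\<close> has a real first component \<open>a\<close>, and since \<open>z\<^sub>0\<close> has mean zero, a
  bound on the action confines \<open>q\<^sub>0\<close> to a bounded neighbourhood of \<open>a * cis (- k * t)\<close>. If \<open>\<bar>a\<bar>\<close> is large this forces
  the signs of the regular polygon with \<open>m\<^sub>0\<close> on the side of \<open>sgn a\<close>. Hence in every other class minimizing sequences
  are bounded in \<open>H\<^sup>1\<close> and the direct method applies. In the two polygon classes the dilated polygons have
  zero kinetic energy and vanishing potential, and conversely a small potential forces \<open>\<bar>a\<bar>\<close> to be large.
  Weak \<open>H\<^sup>1\<close> limits respect the sign conditions because point evaluation is the pairing with a Green function.\<close>

section \<open>Differentiation of indefinite integrals\<close>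

text \<open>The dilations of the rotating polygon are the only non-compact direction: zero kinetic
  energy means constant in the rotating frame, and an integer \<open>k\<close> makes such a motion
  \<open>2*pi\<close>-periodic again. Coprimality of \<open>k\<close> and \<open>N\<close> makes
  this direction visible in the sign data, since \<open>sin (k * j * pi / N)\<close> never vanishes
  for \<open>1 \<le> j \<le> N - 1\<close>. Classes are weak closures, so their members satisfy only
  the inequalities \<open>\<xi> j * y \<ge> 0\<close>; strictness has to come from the reference
  curve \<open>a * cis (- k * t)\<close>. Two gaps shape the analytic half. The action and the inner
  product contain pointwise derivatives, whereas an H1 loop is given as an indefinite integral, so
  the two must be identified almost everywhere. And weak compactness has to be produced for plain
  square integrable functions: pointwise convergence of the loops fixes all pairings of their
  derivatives with indicator functions, and these determine the weak limit.\<close>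

lemma indefinite_integral_has_vector_derivative_AE:
  fixes v F :: "real \<Rightarrow> 'b::euclidean_space"
  assumes v: "v integrable_on {a..b}"
    and F: "\<And>t. t \<in> {a..b} \<Longrightarrow> (v has_integral (F t - F a)) {a..t}"
  obtains S where "negligible S"
    "\<And>t. t \<in> {a<..<b} - S \<Longrightarrow> (F has_vector_derivative v t) (at t)"
proof -
  \<comment> \<open>Extension by zero, because the differentiation theorem used below asks for
    integrability on every interval.\<close>
  define w where "w = (\<lambda>x. if x \<in> {a..b} then v x else 0)"
  have wU: "w integrable_on UNIV"
    using v unfolding w_def integrable_restrict_UNIV .
  then have w1: "w integrable_on cbox c d" for c d
    by (rule integrable_on_subcbox) simp
  have w2: "(\<lambda>x. w (- x)) integrable_on cbox c d" for c d
    using w1[of "-d" "-c"] Henstock_Kurzweil_Integration.integrable_reflect_real[where f=w and a="-d" and b="-c"] by simp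
  obtain S1 where S1: "negligible S1"
    "\<And>x e. \<lbrakk>x \<notin> S1; 0 < e\<rbrakk> \<Longrightarrow> \<exists>d>0. \<forall>h. 0 < h \<and> h < d \<longrightarrow>
        norm (integral {x..x + h} w /\<^sub>R h - w x) < e"
    using integrable_ccontinuous_explicit[OF w1] by auto
  \<comment> \<open>\<open>S1\<close> controls forward averages only. The same theorem for the
    reflected function controls backward averages, which makes the derivative two-sided.\<close>
  obtain S2 where S2: "negligible S2"
    "\<And>x e. \<lbrakk>x \<notin> S2; 0 < e\<rbrakk> \<Longrightarrow> \<exists>d>0. \<forall>h. 0 < h \<and> h < d \<longrightarrow>
        norm (integral {x..x + h} (\<lambda>x. w (- x)) /\<^sub>R h - w (- x)) < e"
    using integrable_ccontinuous_explicit[OF w2] by auto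
  have incr: "integral {s..t} w = F t - F s" if "a \<le> s" "s \<le> t" "t \<le> b" for s t
  proof -
    have "(v has_integral (F t - F a)) {a..t}" "(v has_integral (F s - F a)) {a..s}"
      using F that by auto
    moreover have "v integrable_on {s..t}"
      using integrable_on_subinterval[OF v] that by simp
    ultimately have "integral {a..s} v + integral {s..t} v = F t - F a" "integral {a..s} v = F s - F a"
      using that Henstock_Kurzweil_Integration.integral_combine[of a s t v]
      by (auto simp: integral_unique dest: has_integral_integrable)
    moreover have "integral {s..t} w = integral {s..t} v"
      using that by (intro integral_cong) (auto simp: w_def)
    ultimately show ?thesis by (simp add: algebra_simps)
  qed
  show ?thesis
  proof (rule that)
    have "negligible (uminus ` S2)"
      by (rule negligible_locally_Lipschitz_image[OF _ S2(1)])
        (auto intro!: exI[of _ "UNIV :: real set"] exI[of _ "1 :: real"] simp: abs_minus_commute)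
    then show "negligible (S1 \<union> uminus ` S2)"
      using S1 by simp
    fix t assume t: "t \<in> {a<..<b} - (S1 \<union> uminus ` S2)"
    then have tS: "t \<notin> S1" "- t \<notin> S2" and tab: "a < t" "t < b" and wt: "w t = v t"
      by (auto simp: w_def image_iff)
    show "(F has_vector_derivative v t) (at t)"
      unfolding has_vector_derivative_def has_derivative_at_alt
    proof (intro conjI allI impI)
      show "bounded_linear (\<lambda>x. x *\<^sub>R v t)" by (rule bounded_linear_scaleR_left)
      fix e :: real assume e: "e > 0"
      obtain d1 where d1: "d1 > 0" "\<And>h. 0 < h \<Longrightarrow> h < d1 \<Longrightarrow> norm (integral {t..t + h} w /\<^sub>R h - w t) < e"
        using S1(2)[OF tS(1) e] by blast
      obtain d2 where d2: "d2 > 0" "\<And>h. 0 < h \<Longrightarrow> h < d2 \<Longrightarrow>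
          norm (integral {-t..-t + h} (\<lambda>x. w (-x)) /\<^sub>R h - w t) < e"
        using S2(2)[OF tS(2) e] by auto
      define d where "d = Min {d1, d2, t - a, b - t}"
      have d: "d > 0" "d \<le> d1" "d \<le> d2" "d \<le> t - a" "d \<le> b - t"
        using d1 d2 tab by (auto simp: d_def)
      have "norm (F y - F t - (y - t) *\<^sub>R v t) \<le> e * norm (y - t)" if y: "norm (y - t) < d" for y
      proof (cases y t rule: linorder_cases)
        case equal then show ?thesis by simp
      next
        case greater
        have "integral {t..t + (y - t)} w = F y - F t"
          using incr[of t y] greater y d tab by simp
        then have "norm ((F y - F t) /\<^sub>R (y - t) - v t) < e"
          using d1(2)[of "y - t"] greater y d wt by simp
        moreover have "F y - F t - (y - t) *\<^sub>R v t = (y - t) *\<^sub>R ((F y - F t) /\<^sub>R (y - t) - v t)"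
          using greater by (simp add: scaleR_right_diff_distrib)
        ultimately show ?thesis using greater by (simp add: mult.commute)
      next
        case less
        have "integral {-t..-y} (\<lambda>x. w (-x)) = integral {y..t} w"
          using integral_reflect_real[of t y w] by simp
        also have "\<dots> = F t - F y"
          using incr[of y t] less y d tab by simp
        finally have "norm ((F t - F y) /\<^sub>R (t - y) - v t) < e"
          using d2(2)[of "t - y"] less y d wt by simp
        moreover have "F y - F t - (y - t) *\<^sub>R v t = - ((t - y) *\<^sub>R ((F t - F y) /\<^sub>R (t - y) - v t))"
        proof -
          have "(t - y) *\<^sub>R ((F t - F y) /\<^sub>R (t - y) - v t) = F t - F y - (t - y) *\<^sub>R v t"
            using less by (simp add: scaleR_right_diff_distrib)
          then show ?thesis by (simp add: algebra_simps)
        qed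
        ultimately show ?thesis using less by (simp add: mult.commute)
      qed
      then show "\<exists>d>0. \<forall>y. norm (y - t) < d \<longrightarrow> norm (F y - F t - (y - t) *\<^sub>R v t) \<le> e * norm (y - t)"
        using d(1) by blast
    qed
  qed
qed

section \<open>Square integrable functions\<close>

text \<open>Functions rather than classes modulo null sets, because the derivatives met later are
  concrete functions. Measurability is a separate clause since integrability of the squared norm
  does not imply it.\<close>

definition sq_integrable :: "'a measure \<Rightarrow> ('a \<Rightarrow> 'b::euclidean_space) \<Rightarrow> bool" where
  "sq_integrable M f \<longleftrightarrow> f \<in> borel_measurable M \<and> integrable M (\<lambda>x. (norm (f x))\<^sup>2)"

lemma sq_integrable_measurable [measurable_dest]: "sq_integrable M f \<Longrightarrow> f \<in> borel_measurable M"
  by (simp add: sq_integrable_def)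

lemma sq_integrable_norm2: "sq_integrable M f \<Longrightarrow> integrable M (\<lambda>x. (norm (f x))\<^sup>2)"
  by (simp add: sq_integrable_def)

lemma sq_integrable_inner:
  assumes f: "sq_integrable M f" and g: "sq_integrable M g"
  shows "integrable M (\<lambda>x. f x \<bullet> g x)"
proof (rule Bochner_Integration.integrable_bound)
  show "integrable M (\<lambda>x. (norm (f x))\<^sup>2 + (norm (g x))\<^sup>2)"
    using f g by (auto simp: sq_integrable_def)
  show "(\<lambda>x. f x \<bullet> g x) \<in> borel_measurable M"
    using f g by (auto simp: sq_integrable_def)
  show "AE x in M. norm (f x \<bullet> g x) \<le> norm ((norm (f x))\<^sup>2 + (norm (g x))\<^sup>2)"
  proof (rule AE_I2)
    fix x
    have "\<bar>f x \<bullet> g x\<bar> \<le> norm (f x) * norm (g x)" by (rule Cauchy_Schwarz_ineq2)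
    also have "\<dots> \<le> (norm (f x))\<^sup>2 + (norm (g x))\<^sup>2"
      using sum_squares_bound[of "norm (f x)" "norm (g x)"]
        mult_nonneg_nonneg[OF norm_ge_zero[of "f x"] norm_ge_zero[of "g x"]]
      unfolding mult.assoc by linarith
    finally show "norm (f x \<bullet> g x) \<le> norm ((norm (f x))\<^sup>2 + (norm (g x))\<^sup>2)" by simp
  qed
qed

lemma norm_add_squared: "(norm (x + y :: 'a::real_inner))\<^sup>2 = (norm x)\<^sup>2 + 2 * (x \<bullet> y) + (norm y)\<^sup>2"
  by (simp add: power2_norm_eq_inner algebra_simps inner_commute)

lemma sq_integrable_add:
  assumes f: "sq_integrable M f" and g: "sq_integrable M g"
  shows "sq_integrable M (\<lambda>x. f x + g x)"
  using assms sq_integrable_inner[OF f g]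
  unfolding sq_integrable_def norm_add_squared by auto

lemma sq_integrable_scaleR: "sq_integrable M f \<Longrightarrow> sq_integrable M (\<lambda>x. c *\<^sub>R f x)"
  by (auto simp: sq_integrable_def power_mult_distrib)

lemma sq_integrable_diff:
  "sq_integrable M f \<Longrightarrow> sq_integrable M g \<Longrightarrow> sq_integrable M (\<lambda>x. f x - g x)"
  using sq_integrable_add[of M f "\<lambda>x. (-1) *\<^sub>R g x"] sq_integrable_scaleR[of M g "-1"] by simp

lemma integral_norm_add_squared:
  assumes f: "sq_integrable M f" and g: "sq_integrable M g"
  shows "(\<integral>x. (norm (f x + g x))\<^sup>2 \<partial>M) =
    (\<integral>x. (norm (f x))\<^sup>2 \<partial>M) + 2 * (\<integral>x. f x \<bullet> g x \<partial>M) + (\<integral>x. (norm (g x))\<^sup>2 \<partial>M)"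
  using sq_integrable_inner[OF f g] sq_integrable_norm2[OF f] sq_integrable_norm2[OF g]
  by (simp add: norm_add_squared)

text \<open>The integral of \<open>(norm (f x + c *\<^sub>R g x))\<^sup>2\<close> is a nonnegative
  quadratic polynomial in \<open>c\<close>; it is evaluated at its minimum. If \<open>g\<close>
  vanishes almost everywhere the polynomial is affine and bounded below, hence constant.\<close>

lemma integral_inner_squared_le:
  assumes f: "sq_integrable M f" and g: "sq_integrable M g"
  shows "(\<integral>x. f x \<bullet> g x \<partial>M)\<^sup>2 \<le> (\<integral>x. (norm (f x))\<^sup>2 \<partial>M) * (\<integral>x. (norm (g x))\<^sup>2 \<partial>M)"
proof -
  define A B C where "A = (\<integral>x. (norm (f x))\<^sup>2 \<partial>M)" and "B = (\<integral>x. f x \<bullet> g x \<partial>M)"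
    and "C = (\<integral>x. (norm (g x))\<^sup>2 \<partial>M)"
  have C0: "C \<ge> 0" unfolding C_def by (rule integral_nonneg_AE) simp
  have quad: "0 \<le> A + 2 * (c * B) + c\<^sup>2 * C" for c
  proof -
    have "0 \<le> (\<integral>x. (norm (f x + c *\<^sub>R g x))\<^sup>2 \<partial>M)" by (rule integral_nonneg_AE) simp
    also have "\<dots> = A + 2 * (c * B) + c\<^sup>2 * C"
      by (simp add: integral_norm_add_squared[OF f sq_integrable_scaleR[OF g]] A_def B_def C_def power_mult_distrib)
    finally show ?thesis .
  qed
  have "B\<^sup>2 \<le> A * C"
  proof (cases "C = 0")
    case True
    have "B = 0"
    proof (rule ccontr)
      assume "B \<noteq> 0"
      \<comment> \<open>At this \<open>c\<close> the affine expression
        \<open>A + 2 * (c * B)\<close> equals -1.\<close>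
      then show False using quad[of "- (A + 1) / (2 * B)"] True by (simp add: field_simps)
    qed
    then show ?thesis using True by simp
  next
    case False
    then have "0 \<le> (A + 2 * ((- B / C) * B) + (- B / C)\<^sup>2 * C) * C"
      using quad[of "- B / C"] C0 by simp
    also have "\<dots> = A * C - B\<^sup>2" using False by (simp add: field_simps power2_eq_square)
    finally show ?thesis by simp
  qed
  then show ?thesis by (simp add: A_def B_def C_def)
qed

section \<open>Completeness and weak limits over a finite measure\<close>

lemma sq_integrable_const:
  assumes "finite_measure M" shows "sq_integrable M (\<lambda>_. c)"
  using assms by (simp add: sq_integrable_def finite_measure.integrable_const)

lemma sq_integrable_norm: "sq_integrable M f \<Longrightarrow> sq_integrable M (\<lambda>x. norm (f x))"
  by (auto simp: sq_integrable_def)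

lemma integral_norm_squared_le:
  assumes M: "finite_measure M" and f: "sq_integrable M f"
  shows "(\<integral>x. norm (f x) \<partial>M)\<^sup>2 \<le> measure M (space M) * (\<integral>x. (norm (f x))\<^sup>2 \<partial>M)"
  using integral_inner_squared_le[OF sq_integrable_norm[OF f] sq_integrable_const[OF M, of "1::real"]]
  by (simp add: mult.commute)

lemma sq_integrable_imp_integrable:
  assumes M: "finite_measure M" and f: "sq_integrable M f"
  shows "integrable M f"
proof -
  have "integrable M (\<lambda>x. norm (f x))"
    using sq_integrable_inner[OF sq_integrable_norm[OF f] sq_integrable_const[OF M, of "1::real"]] by simp
  then show ?thesis by (rule integrable_norm_cancel) (use f in \<open>simp add: sq_integrable_def\<close>)
qed

text \<open>Riesz-Fischer. On a finite measure space an L2-Cauchy sequence is L1-Cauchy, so a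
  subsequence converges almost everywhere; Fatou's lemma turns this limit into an L2 limit of the
  whole sequence.\<close>

lemma sq_integrable_complete:
  fixes f :: "nat \<Rightarrow> 'a \<Rightarrow> 'b::euclidean_space"
  assumes M: "finite_measure M" and f: "\<And>n. sq_integrable M (f n)"
    and cau: "\<And>e. e > 0 \<Longrightarrow> \<exists>n0. \<forall>i\<ge>n0. \<forall>j\<ge>n0. (\<integral>x. (norm (f i x - f j x))\<^sup>2 \<partial>M) < e"
  obtains g where "sq_integrable M g" "(\<lambda>n. \<integral>x. (norm (f n x - g x))\<^sup>2 \<partial>M) \<longlonglongrightarrow> 0"
proof -
  define \<mu> where "\<mu> = measure M (space M)"
  have \<mu>: "\<mu> \<ge> 0" by (simp add: \<mu>_def)
  note d = sq_integrable_diff[OF f f]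
  have L1: "\<exists>n0. \<forall>i\<ge>n0. \<forall>j\<ge>n0. (\<integral>x. norm (f i x - f j x) \<partial>M) < e" if e: "e > 0" for e
  proof -
    obtain n0 where n0: "\<And>i j. i \<ge> n0 \<Longrightarrow> j \<ge> n0 \<Longrightarrow> (\<integral>x. (norm (f i x - f j x))\<^sup>2 \<partial>M) < e\<^sup>2 / (\<mu> + 1)"
      using cau[of "e\<^sup>2 / (\<mu> + 1)"] e \<mu> by auto
    have "(\<integral>x. norm (f i x - f j x) \<partial>M) < e" if "i \<ge> n0" "j \<ge> n0" for i j
    proof -
      have "(\<integral>x. norm (f i x - f j x) \<partial>M)\<^sup>2 \<le> \<mu> * (\<integral>x. (norm (f i x - f j x))\<^sup>2 \<partial>M)"
        unfolding \<mu>_def by (rule integral_norm_squared_le[OF M d])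
      also have "\<dots> \<le> \<mu> * (e\<^sup>2 / (\<mu> + 1))"
        using n0[OF that] \<mu> by (intro mult_left_mono) auto
      also have "\<dots> < e\<^sup>2" using e \<mu> by (simp add: field_simps)
      finally show ?thesis using e by (simp add: power_less_imp_less_base)
    qed
    then show ?thesis by blast
  qed
  obtain r where r: "strict_mono r" "AE x in M. Cauchy (\<lambda>i. f (r i) x)"
    using cauchy_L1_AE_cauchy_subseq[OF sq_integrable_imp_integrable[OF M f] L1] by blast
  define g where "g = (\<lambda>x. lim (\<lambda>i. f (r i) x))"
  have [measurable]: "f n \<in> borel_measurable M" for n using f by (simp add: sq_integrable_def)
  have g_meas [measurable]: "g \<in> borel_measurable M"
    unfolding g_def by measurable
  have conv: "AE x in M. (\<lambda>i. f (r i) x) \<longlonglongrightarrow> g x"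
    using r(2) by eventually_elim (simp add: g_def Cauchy_convergent_iff convergent_LIMSEQ_iff)
  \<comment> \<open>Fatou along the subsequence with \<open>n\<close> fixed: the distance from
    \<open>f n\<close> to \<open>g\<close> is at most the Cauchy bound between \<open>f n\<close>
    and later terms.\<close>
  have bnd: "integrable M (\<lambda>x. (norm (f n x - g x))\<^sup>2) \<and> (\<integral>x. (norm (f n x - g x))\<^sup>2 \<partial>M) \<le> e"
    if e: "e > 0" and n0: "\<And>i. i \<ge> n0 \<Longrightarrow> (\<integral>x. (norm (f n x - f i x))\<^sup>2 \<partial>M) \<le> e" for n n0 e
  proof -
    have "(\<integral>\<^sup>+x. ennreal ((norm (f n x - g x))\<^sup>2) \<partial>M)
        = (\<integral>\<^sup>+x. liminf (\<lambda>i. ennreal ((norm (f n x - f (r i) x))\<^sup>2)) \<partial>M)"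
    proof (rule nn_integral_cong_AE, use conv in eventually_elim)
      case (elim x)
      have "(\<lambda>i. ennreal ((norm (f n x - f (r i) x))\<^sup>2)) \<longlonglongrightarrow> ennreal ((norm (f n x - g x))\<^sup>2)"
        by (intro tendsto_ennrealI tendsto_intros elim)
      then show ?case by (rule lim_imp_Liminf[OF trivial_limit_sequentially, symmetric])
    qed
    also have "\<dots> \<le> liminf (\<lambda>i. \<integral>\<^sup>+x. ennreal ((norm (f n x - f (r i) x))\<^sup>2) \<partial>M)"
      by (rule nn_integral_liminf) measurable
    also have "\<dots> \<le> limsup (\<lambda>i. \<integral>\<^sup>+x. ennreal ((norm (f n x - f (r i) x))\<^sup>2) \<partial>M)"
      by (rule Liminf_le_Limsup) simp
    also have "\<dots> \<le> ennreal e"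
    proof (rule Limsup_bounded, rule eventually_sequentiallyI[of n0])
      fix i assume "i \<ge> n0"
      then have "r i \<ge> n0" using seq_suble[OF r(1), of i] by simp
      then show "(\<integral>\<^sup>+x. ennreal ((norm (f n x - f (r i) x))\<^sup>2) \<partial>M) \<le> ennreal e"
        using n0[of "r i"] e by (subst nn_integral_eq_integral[OF sq_integrable_norm2[OF d]]) (auto intro: ennreal_leI)
    qed
    finally have le: "(\<integral>\<^sup>+x. ennreal ((norm (f n x - g x))\<^sup>2) \<partial>M) \<le> ennreal e" .
    have i: "integrable M (\<lambda>x. (norm (f n x - g x))\<^sup>2)"
      using le by (intro integrableI_bounded) (auto intro: le_less_trans)
    moreover have "(\<integral>x. (norm (f n x - g x))\<^sup>2 \<partial>M) \<le> e"
      using le e by (subst (asm) nn_integral_eq_integral[OF i]) (auto simp: ennreal_le_iff)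
    ultimately show ?thesis by simp
  qed
  have bnd2: "\<exists>n0. \<forall>n\<ge>n0. integrable M (\<lambda>x. (norm (f n x - g x))\<^sup>2) \<and> (\<integral>x. (norm (f n x - g x))\<^sup>2 \<partial>M) \<le> e"
    if e: "e > 0" for e
    using cau[OF e] bnd[OF e] by (meson less_imp_le)
  obtain n where n: "integrable M (\<lambda>x. (norm (f n x - g x))\<^sup>2)"
    using bnd2[of 1] by auto
  then have "sq_integrable M (\<lambda>x. f n x - g x)" by (simp add: sq_integrable_def)
  from sq_integrable_diff[OF f this, of n] have "sq_integrable M g" by simp
  moreover have "(\<lambda>n. \<integral>x. (norm (f n x - g x))\<^sup>2 \<partial>M) \<longlonglongrightarrow> 0"
  proof (rule LIMSEQ_I)
    fix e :: real assume "e > 0"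
    then obtain n0 where "\<forall>n\<ge>n0. (\<integral>x. (norm (f n x - g x))\<^sup>2 \<partial>M) \<le> e / 2"
      using bnd2[of "e/2"] by auto
    then show "\<exists>n0. \<forall>n\<ge>n0. norm ((\<integral>x. (norm (f n x - g x))\<^sup>2 \<partial>M) - 0) < e"
      using \<open>e > 0\<close> by (intro exI[of _ n0]) (auto simp: abs_of_nonneg integral_nonneg_AE intro: le_less_trans)
  qed
  ultimately show ?thesis using that by blast
qed

text \<open>A bounded sequence whose pairings with all \<open>p\<close> in \<open>D\<close> converge
  has a representing function. It is the strong limit of almost norm-minimal elements
  \<open>w m\<close> of shrinking convex sets \<open>C m\<close>, so neither a basis nor a diagonal
  sequence is involved.\<close>

lemma sq_integrable_weak_limit:
  fixes v :: "nat \<Rightarrow> 'a \<Rightarrow> 'b::euclidean_space"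
  assumes M: "finite_measure M" and v: "\<And>n. sq_integrable M (v n)"
    and K: "\<And>n. (\<integral>x. (norm (v n x))\<^sup>2 \<partial>M) \<le> K"
    and D: "\<And>p. p \<in> D \<Longrightarrow> sq_integrable M p"
    and L: "\<And>p. p \<in> D \<Longrightarrow> (\<lambda>n. \<integral>x. v n x \<bullet> p x \<partial>M) \<longlonglongrightarrow> L p"
  obtains w where "sq_integrable M w" "\<And>p. p \<in> D \<Longrightarrow> (\<integral>x. w x \<bullet> p x \<partial>M) = L p"
proof -
  define ip where "ip = (\<lambda>f g. \<integral>x. f x \<bullet> (g x :: 'b) \<partial>M)"
  define nn where "nn = (\<lambda>f. \<integral>x. (norm (f x :: 'b))\<^sup>2 \<partial>M)"
  have nn0: "nn f \<ge> 0" for f unfolding nn_def by (rule integral_nonneg_AE) simp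
  \<comment> \<open>A convex substitute for the closed convex hull of the tail: any \<open>d\<close>
    bounding the error of every \<open>v n\<close> with \<open>n \<ge> m\<close> against
    \<open>p\<close> must also bound the error of \<open>w\<close>. The sets decrease in
    \<open>m\<close>, so the infima \<open>I m\<close> increase, and they stay below
    \<open>K\<close>.\<close>
  define C where "C = (\<lambda>m. {w. sq_integrable M w \<and> (\<forall>p\<in>D. \<forall>d. (\<forall>n\<ge>m. \<bar>ip (v n) p - L p\<bar> \<le> d) \<longrightarrow> \<bar>ip w p - L p\<bar> \<le> d)})"
  define I where "I = (\<lambda>m. INF w\<in>C m. nn w)"
  have vC: "v m \<in> C m" for m unfolding C_def using v by auto
  have bdd: "bdd_below (nn ` C m)" for m by (rule bdd_belowI2[of _ 0]) (rule nn0)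
  have Cmono: "C m' \<subseteq> C m" if "m \<le> m'" for m m'
    unfolding C_def using that by (blast intro: order_trans)
  have Ile: "I m \<le> nn w" if "w \<in> C m" for m w
    unfolding I_def by (rule cINF_lower[OF bdd that])
  have Imono: "incseq I"
    unfolding incseq_def I_def
    by (intro allI impI cINF_superset_mono bdd Cmono order_refl) (use vC in auto)
  have IK: "I m \<le> K" for m using Ile[OF vC] K[of m] unfolding nn_def by (rule order_trans)
  obtain J where J: "I \<longlonglongrightarrow> J"
    using incseq_convergent[OF Imono, of K] IK by blast
  have "\<exists>w. w \<in> C m \<and> nn w < I m + 1 / real (Suc m)" for m
  proof -
    have "(INF w\<in>C m. nn w) < I m + 1 / real (Suc m)" by (simp add: I_def add_pos_nonneg)
    then show ?thesis using cINF_less_iff[OF _ bdd, of m] vC by blast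
  qed
  then obtain w where w: "\<And>m. w m \<in> C m" "\<And>m. nn (w m) < I m + 1 / real (Suc m)" by metis
  have wS: "sq_integrable M (w m)" for m using w(1)[of m] by (simp add: C_def)
  have mid: "(\<lambda>x. (1/2) *\<^sub>R (f x + g x)) \<in> C m" if "f \<in> C m" "g \<in> C m" for f g m
  proof -
    have f: "sq_integrable M f" and g: "sq_integrable M g" using that by (auto simp: C_def)
    have half: "ip (\<lambda>x. (1/2) *\<^sub>R (f x + g x)) p = (ip f p + ip g p) / 2" if "sq_integrable M p" for p
      unfolding ip_def using sq_integrable_inner[OF f that] sq_integrable_inner[OF g that]
      by (simp add: inner_add_left)
    have avg: "\<bar>(a + b) / 2 - l\<bar> \<le> d" if "\<bar>a - l\<bar> \<le> d" "\<bar>b - l\<bar> \<le> d" for a b l d :: real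
      using that by (simp add: abs_le_iff field_simps)
    show ?thesis
      unfolding C_def mem_Collect_eq
    proof (intro conjI ballI allI impI)
      show "sq_integrable M (\<lambda>x. (1/2) *\<^sub>R (f x + g x))"
        by (intro sq_integrable_scaleR sq_integrable_add f g)
      fix p d assume p: "p \<in> D" and d: "\<forall>n\<ge>m. \<bar>ip (v n) p - L p\<bar> \<le> d"
      have "\<bar>ip f p - L p\<bar> \<le> d" "\<bar>ip g p - L p\<bar> \<le> d"
        using that p d by (auto simp: C_def)
      then show "\<bar>ip (\<lambda>x. (1/2) *\<^sub>R (f x + g x)) p - L p\<bar> \<le> d"
        unfolding half[OF D[OF p]] by (rule avg)
    qed
  qed
  have par: "nn (\<lambda>x. f x - g x) = 2 * nn f + 2 * nn g - 4 * nn (\<lambda>x. (1/2) *\<^sub>R (f x + g x))"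
    if f: "sq_integrable M f" and g: "sq_integrable M g" for f g
  proof -
    have "nn (\<lambda>x. f x - g x) = nn f - 2 * ip f g + nn g"
      using integral_norm_add_squared[OF f sq_integrable_scaleR[OF g, of "-1"]] by (simp add: nn_def ip_def)
    moreover have "4 * nn (\<lambda>x. (1/2) *\<^sub>R (f x + g x)) = nn f + 2 * ip f g + nn g"
      using integral_norm_add_squared[OF f g] by (simp add: nn_def ip_def power_mult_distrib power2_eq_square)
    ultimately show ?thesis by simp
  qed
  \<comment> \<open>The midpoint of \<open>w m\<close> and \<open>w m'\<close> lies in
    \<open>C m\<close>, so its squared norm is at least \<open>I m\<close>; the parallelogram law
    then converts near-minimality into closeness.\<close>
  have close: "nn (\<lambda>x. w m x - w m' x) \<le> 2 * (I m' - I m) + 4 / real (Suc m)" if "m \<le> m'" for m m'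
  proof -
    have "w m' \<in> C m" using w(1)[of m'] Cmono[OF that] by blast
    then have "I m \<le> nn (\<lambda>x. (1/2) *\<^sub>R (w m x + w m' x))" by (intro Ile mid w)
    moreover have "1 / real (Suc m') \<le> 1 / real (Suc m)" using that by (simp add: field_simps)
    ultimately show ?thesis using par[OF wS wS, of m m'] w(2)[of m] w(2)[of m'] by simp
  qed
  have cau: "\<exists>n0. \<forall>i\<ge>n0. \<forall>j\<ge>n0. nn (\<lambda>x. w i x - w j x) < e" if e: "e > 0" for e
  proof -
    have "(\<lambda>m. 2 * (J - I m) + 4 / real (Suc m)) \<longlonglongrightarrow> 2 * (J - J) + 4 * 0"
      using tendsto_mult[OF tendsto_const[of 4] LIMSEQ_inverse_real_of_nat]
      by (intro tendsto_intros J) (simp add: divide_inverse)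
    then have "\<forall>\<^sub>F m in sequentially. 2 * (J - I m) + 4 / real (Suc m) < e"
      using e by (intro order_tendstoD) auto
    then obtain n0 where n0: "\<And>m. m \<ge> n0 \<Longrightarrow> 2 * (J - I m) + 4 / real (Suc m) < e"
      by (auto simp: eventually_sequentially)
    have IJ: "I m \<le> J" for m by (rule incseq_le[OF Imono J])
    have 1: "nn (\<lambda>x. w i x - w j x) < e" if "n0 \<le> i" "i \<le> j" for i j
      using close[OF that(2)] n0[OF that(1)] IJ[of j] by simp
    have "nn (\<lambda>x. w i x - w j x) = nn (\<lambda>x. w j x - w i x)" for i j
      by (simp add: nn_def norm_minus_commute)
    then have "nn (\<lambda>x. w i x - w j x) < e" if "n0 \<le> i" "n0 \<le> j" for i j
      using 1[of i j] 1[of j i] that by (metis linear)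
    then show ?thesis by blast
  qed
  obtain g where g: "sq_integrable M g" "(\<lambda>n. nn (\<lambda>x. w n x - g x)) \<longlonglongrightarrow> 0"
    using sq_integrable_complete[OF M wS, OF cau[unfolded nn_def]] unfolding nn_def by blast
  have "ip g p = L p" if p: "p \<in> D" for p
  proof -
    note ps = D[OF p]
    have sub: "ip (w n) p - ip g p = ip (\<lambda>x. w n x - g x) p" for n
      unfolding ip_def using sq_integrable_inner[OF wS ps] sq_integrable_inner[OF g(1) ps]
      by (simp add: inner_diff_left)
    have "(\<lambda>n. ip (w n) p - ip g p) \<longlonglongrightarrow> 0"
    proof (rule Lim_null_comparison)
      have "(\<lambda>n. sqrt (nn (\<lambda>x. w n x - g x) * nn p)) \<longlonglongrightarrow> sqrt (0 * nn p)"
        by (intro tendsto_intros g)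
      then show "(\<lambda>n. sqrt (nn (\<lambda>x. w n x - g x) * nn p)) \<longlonglongrightarrow> 0" by simp
      show "\<forall>\<^sub>F n in sequentially. norm (ip (w n) p - ip g p) \<le> sqrt (nn (\<lambda>x. w n x - g x) * nn p)"
        unfolding sub unfolding ip_def nn_def
        using integral_inner_squared_le[OF sq_integrable_diff[OF wS g(1)] ps]
        by (auto intro!: always_eventually real_le_rsqrt)
    qed
    then have 1: "(\<lambda>n. ip (w n) p) \<longlonglongrightarrow> ip g p" by (simp add: LIM_zero_iff)
    have 2: "(\<lambda>n. ip (w n) p) \<longlonglongrightarrow> L p"
    proof (rule LIMSEQ_I)
      fix e :: real assume e: "e > 0"
      obtain m0 where m0: "\<And>n. n \<ge> m0 \<Longrightarrow> \<bar>ip (v n) p - L p\<bar> < e / 2"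
        using LIMSEQ_D[OF L[OF p], of "e/2"] e by (auto simp: ip_def)
      have "\<bar>ip (w m) p - L p\<bar> \<le> e / 2" if "m \<ge> m0" for m
      proof -
        have "\<forall>n\<ge>m. \<bar>ip (v n) p - L p\<bar> \<le> e / 2"
          using m0 that by (meson less_imp_le order_trans)
        then show ?thesis using w(1)[of m] p unfolding C_def by blast
      qed
      then show "\<exists>m0. \<forall>n\<ge>m0. norm (ip (w n) p - L p) < e"
        using e by (intro exI[of _ m0]) (auto intro: le_less_trans[of _ "e/2"])
    qed
    show ?thesis by (rule LIMSEQ_unique[OF 1 2])
  qed
  then show ?thesis using that[OF g(1)] by (simp add: ip_def)
qed

section \<open>Functions with a square integrable derivative\<close>

lemma integrable_lebesgue_on_iff:
  "S \<in> sets lebesgue \<Longrightarrow> integrable (lebesgue_on S) f \<longleftrightarrow> f absolutely_integrable_on S"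
  by (simp add: set_integrable_def integrable_restrict_space)

lemma finite_measure_lebesgue_on_Icc: "finite_measure (lebesgue_on {a..b::real})"
  by (rule finite_measure_lebesgue_on) simp

lemma measure_lebesgue_on_Icc: "a \<le> b \<Longrightarrow> measure (lebesgue_on {a..b::real}) (space (lebesgue_on {a..b})) = b - a"
  by (simp add: measure_restrict_space space_restrict_space)

lemma sq_integrable_subinterval:
  fixes v :: "real \<Rightarrow> 'b::euclidean_space"
  assumes v: "sq_integrable (lebesgue_on {a..b}) v" and "{s..t} \<subseteq> {a..b}"
  shows "sq_integrable (lebesgue_on {s..t}) v"
    and "(\<integral>x. (norm (v x))\<^sup>2 \<partial>lebesgue_on {s..t}) \<le> (\<integral>x. (norm (v x))\<^sup>2 \<partial>lebesgue_on {a..b})"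
proof -
  have ai: "(\<lambda>x. (norm (v x))\<^sup>2) absolutely_integrable_on {a..b}"
    using sq_integrable_norm2[OF v] by (simp add: integrable_lebesgue_on_iff)
  then have ai': "(\<lambda>x. (norm (v x))\<^sup>2) absolutely_integrable_on {s..t}"
    using assms(2) by (rule absolutely_integrable_on_subinterval)
  moreover have "v \<in> borel_measurable (lebesgue_on {s..t})"
    using sq_integrable_measurable[OF v] assms(2) by (rule measurable_restrict_mono)
  ultimately show "sq_integrable (lebesgue_on {s..t}) v"
    by (simp add: sq_integrable_def integrable_lebesgue_on_iff)
  show "(\<integral>x. (norm (v x))\<^sup>2 \<partial>lebesgue_on {s..t}) \<le> (\<integral>x. (norm (v x))\<^sup>2 \<partial>lebesgue_on {a..b})"
    using ai ai' assms(2)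
    by (simp add: lebesgue_integral_eq_integral integrable_lebesgue_on_iff integral_subset_le
        set_lebesgue_integral_eq_integral)
qed

lemma sq_integrable_continuous:
  fixes F :: "real \<Rightarrow> 'b::euclidean_space"
  assumes "continuous_on {a..b} F"
  shows "sq_integrable (lebesgue_on {a..b}) F"
  using assms by (auto simp: sq_integrable_def integrable_lebesgue_on_iff
      intro!: continuous_imp_measurable_on_sets_lebesgue absolutely_integrable_continuous_real continuous_intros)

text \<open>\<open>F\<close> is the absolutely continuous representative itself on the interval. A
  relation rather than an operator, since \<open>v\<close> is determined only almost
  everywhere.\<close>

definition L2_deriv :: "real \<Rightarrow> real \<Rightarrow> (real \<Rightarrow> 'b::euclidean_space) \<Rightarrow> (real \<Rightarrow> 'b) \<Rightarrow> bool" where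
  "L2_deriv a b F v \<longleftrightarrow> sq_integrable (lebesgue_on {a..b}) v \<and>
     (\<forall>t\<in>{a..b}. (v has_integral (F t - F a)) {a..t})"

lemma L2_deriv_sq_integrable: "L2_deriv a b F v \<Longrightarrow> sq_integrable (lebesgue_on {a..b}) v"
  by (simp add: L2_deriv_def)

text \<open>On a bounded interval square integrable functions are absolutely integrable, so the two
  integrability clauses of \<open>H1_loop\<close> amount to \<open>sq_integrable\<close>.\<close>

lemma H1_loop_iff:
  "H1_loop N q \<longleftrightarrow> (\<forall>i<N. (\<forall>t. q i (t + 2*pi) = q i t) \<and> (\<exists>v. L2_deriv 0 (2*pi) (q i) v))"
proof -
  have "(v absolutely_integrable_on {0..2*pi} \<and> (\<lambda>t. (norm (v t))\<^sup>2) integrable_on {0..2*pi})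
      \<longleftrightarrow> sq_integrable (lebesgue_on {0..2*pi}) v" for v :: "real \<Rightarrow> complex \<times> real"
  proof
    assume *: "v absolutely_integrable_on {0..2*pi} \<and> (\<lambda>t. (norm (v t))\<^sup>2) integrable_on {0..2*pi}"
    then have "(\<lambda>t. (norm (v t))\<^sup>2) absolutely_integrable_on {0..2*pi}"
      by (intro nonnegative_absolutely_integrable_1) auto
    moreover have "v \<in> borel_measurable (lebesgue_on {0..2*pi})"
      using * by (intro absolutely_integrable_imp_borel_measurable) auto
    ultimately show "sq_integrable (lebesgue_on {0..2*pi}) v"
      by (simp add: sq_integrable_def integrable_lebesgue_on_iff)
  next
    assume *: "sq_integrable (lebesgue_on {0..2*pi}) v"
    show "v absolutely_integrable_on {0..2*pi} \<and> (\<lambda>t. (norm (v t))\<^sup>2) integrable_on {0..2*pi}"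
      using sq_integrable_imp_integrable[OF finite_measure_lebesgue_on_Icc *] sq_integrable_norm2[OF *]
      by (auto simp: integrable_lebesgue_on_iff set_lebesgue_integral_eq_integral)
  qed
  then show ?thesis unfolding H1_loop_def L2_deriv_def by blast
qed

lemma L2_deriv_has_integral:
  assumes "L2_deriv a b F v" "a \<le> s" "s \<le> t" "t \<le> b"
  shows "(v has_integral (F t - F s)) {s..t}"
proof -
  have "(v has_integral (F t - F a)) {a..t}" "(v has_integral (F s - F a)) {a..s}"
    using assms by (auto simp: L2_deriv_def)
  moreover from this(1) have "v integrable_on {s..t}"
    using assms by (meson has_integral_integrable integrable_on_subinterval atLeastatMost_subset_iff order_refl)
  ultimately have "(v has_integral (F s - F a + integral {s..t} v)) {a..t}"
    using assms by (intro has_integral_combine[of a s t]) (auto simp: has_integral_integral)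
  with \<open>(v has_integral (F t - F a)) {a..t}\<close> have "F t - F a = F s - F a + integral {s..t} v"
    by (rule has_integral_unique)
  then have "integral {s..t} v = F t - F s" by (simp add: algebra_simps)
  then show ?thesis using \<open>v integrable_on {s..t}\<close> by (metis integrable_integral)
qed

lemma L2_deriv_subinterval:
  assumes "L2_deriv a b F v" "{s..t} \<subseteq> {a..b}" "s \<le> t"
  shows "L2_deriv s t F v"
  unfolding L2_deriv_def
  using sq_integrable_subinterval(1)[OF L2_deriv_sq_integrable[OF assms(1)] assms(2)] L2_deriv_has_integral[OF assms(1)] assms
  by auto

text \<open>This links the weak derivative to the \<open>vector_derivative\<close> occurring in
  \<open>action\<close> and \<open>H1_inner\<close>. Two-sided derivatives exist at almost all
  interior points; the two end points join the null set.\<close>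

lemma L2_deriv_has_vector_derivative_AE:
  assumes "L2_deriv a b F v"
  shows "AE t in lebesgue_on {a..b}. (F has_vector_derivative v t) (at t)"
proof (cases "a \<le> b")
  case True
  have "v integrable_on {a..b}"
    using L2_deriv_has_integral[OF assms, of a b] True by (auto dest: has_integral_integrable)
  moreover have "(v has_integral (F t - F a)) {a..t}" if "t \<in> {a..b}" for t
    using assms that by (simp add: L2_deriv_def)
  ultimately obtain S where S: "negligible S"
      "\<And>t. t \<in> {a<..<b} - S \<Longrightarrow> (F has_vector_derivative v t) (at t)"
    by (rule indefinite_integral_has_vector_derivative_AE[of v a b F]) blast+
  have "S \<union> {a, b} \<in> null_sets lebesgue"
    using S(1) by (simp flip: negligible_iff_null_sets add: negligible_Un)
  then have "AE t in lebesgue. t \<notin> S \<union> {a, b}" by (rule AE_not_in)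
  then have "AE t in lebesgue. t \<in> {a..b} \<longrightarrow> (F has_vector_derivative v t) (at t)"
    by (rule eventually_mono) (use S(2) in force)
  then show ?thesis
    by (subst AE_restrict_space_iff) auto
qed (simp add: AE_restrict_space_iff)

lemma L2_deriv_vector_derivative_AE:
  assumes "L2_deriv a b F v"
  shows "AE t in lebesgue_on {a..b}. vector_derivative F (at t) = v t"
  using L2_deriv_has_vector_derivative_AE[OF assms] by eventually_elim (rule vector_derivative_at)

lemma L2_deriv_unique_AE:
  assumes "L2_deriv a b F v" "L2_deriv a b F w"
  shows "AE t in lebesgue_on {a..b}. v t = w t"
  using L2_deriv_vector_derivative_AE[OF assms(1)] L2_deriv_vector_derivative_AE[OF assms(2)]
  by eventually_elim simp

lemma integral_norm_le_sqrt:
  fixes v :: "real \<Rightarrow> 'b::euclidean_space"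
  assumes v: "sq_integrable (lebesgue_on {a..b}) v" and st: "a \<le> s" "s \<le> t" "t \<le> b"
  shows "integral {s..t} (\<lambda>x. norm (v x)) \<le> sqrt ((t - s) * (\<integral>x. (norm (v x))\<^sup>2 \<partial>lebesgue_on {a..b}))"
proof -
  have sub: "{s..t} \<subseteq> {a..b}" using st by auto
  note v' = sq_integrable_subinterval[OF v sub]
  have "integrable (lebesgue_on {s..t}) (\<lambda>x. norm (v x))"
    by (rule sq_integrable_imp_integrable[OF finite_measure_lebesgue_on_Icc sq_integrable_norm[OF v'(1)]])
  then have "integral {s..t} (\<lambda>x. norm (v x)) = (\<integral>x. norm (v x) \<partial>lebesgue_on {s..t})"
    by (simp add: lebesgue_integral_eq_integral)
  also have "\<dots> \<le> sqrt ((t - s) * (\<integral>x. (norm (v x))\<^sup>2 \<partial>lebesgue_on {s..t}))"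
    using integral_norm_squared_le[OF finite_measure_lebesgue_on_Icc v'(1)] measure_lebesgue_on_Icc[OF st(2)]
    by (intro real_le_rsqrt) simp
  also have "\<dots> \<le> sqrt ((t - s) * (\<integral>x. (norm (v x))\<^sup>2 \<partial>lebesgue_on {a..b}))"
    using v'(2) st by (intro real_sqrt_le_mono mult_left_mono) auto
  finally show ?thesis .
qed

lemma sq_integrable_integrable_on:
  fixes v :: "real \<Rightarrow> 'b::euclidean_space"
  assumes v: "sq_integrable (lebesgue_on {a..b}) v" and st: "a \<le> s" "t \<le> b"
  shows "v integrable_on {s..t}" "(\<lambda>x. norm (v x)) integrable_on {s..t}"
proof -
  have sub: "{s..t} \<subseteq> {a..b}" using st by auto
  note v' = sq_integrable_subinterval(1)[OF v sub]
  have "integrable (lebesgue_on {s..t}) v"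
    by (rule sq_integrable_imp_integrable[OF finite_measure_lebesgue_on_Icc v'])
  then show "v integrable_on {s..t}" "(\<lambda>x. norm (v x)) integrable_on {s..t}"
    by (auto simp: integrable_lebesgue_on_iff absolutely_integrable_on_def)
qed

text \<open>Cauchy-Schwarz on the interval between \<open>s\<close> and \<open>t\<close>. The
  constant is the energy of the whole interval, hence uniform in \<open>s\<close> and
  \<open>t\<close>; this gives both the deviation bound for loops and the equicontinuity of
  minimizing sequences.\<close>

lemma L2_deriv_Holder:
  assumes F: "L2_deriv a b F v" and "s \<in> {a..b}" "t \<in> {a..b}"
  shows "norm (F t - F s) \<le> sqrt (\<bar>t - s\<bar> * (\<integral>x. (norm (v x))\<^sup>2 \<partial>lebesgue_on {a..b}))"
proof -
  have *: "norm (F t - F s) \<le> sqrt ((t - s) * (\<integral>x. (norm (v x))\<^sup>2 \<partial>lebesgue_on {a..b}))"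
    if st: "a \<le> s" "s \<le> t" "t \<le> b" for s t
  proof -
    note v = L2_deriv_sq_integrable[OF F]
    have "norm (F t - F s) = norm (integral {s..t} v)"
      using L2_deriv_has_integral[OF F st] by (simp add: integral_unique)
    also have "\<dots> \<le> integral {s..t} (\<lambda>x. norm (v x))"
      using sq_integrable_integrable_on[OF v st(1,3)]
      by (intro Henstock_Kurzweil_Integration.integral_norm_bound_integral) auto
    also note integral_norm_le_sqrt[OF v st]
    finally show ?thesis .
  qed
  show ?thesis
    using *[of s t] *[of t s] assms(2,3) by (cases "s \<le> t") (auto simp: norm_minus_commute)
qed

lemma L2_deriv_continuous_on:
  assumes F: "L2_deriv a b F v"
  shows "continuous_on {a..b} F"
  unfolding continuous_on_def
proof
  fix s assume s: "s \<in> {a..b}"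
  define V where "V = (\<integral>x. (norm (v x))\<^sup>2 \<partial>lebesgue_on {a..b})"
  have "((\<lambda>t. F t - F s) \<longlongrightarrow> 0) (at s within {a..b})"
  proof (rule Lim_null_comparison)
    show "\<forall>\<^sub>F t in at s within {a..b}. norm (F t - F s) \<le> sqrt (\<bar>t - s\<bar> * V)"
      using L2_deriv_Holder[OF F s] unfolding V_def by (auto simp: eventually_at_filter)
    have "((\<lambda>t. sqrt (\<bar>t - s\<bar> * V)) \<longlongrightarrow> sqrt (\<bar>s - s\<bar> * V)) (at s within {a..b})"
      by (intro tendsto_intros)
    then show "((\<lambda>t. sqrt (\<bar>t - s\<bar> * V)) \<longlongrightarrow> 0) (at s within {a..b})" by simp
  qed
  then show "(F \<longlongrightarrow> F s) (at s within {a..b})" by (rule LIM_zero_cancel)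
qed

text \<open>The finite exceptional set \<open>S\<close> admits kinks, such as the one of the Green
  function below.\<close>

lemma L2_deriv_C1:
  fixes g :: "real \<Rightarrow> 'b::euclidean_space"
  assumes S: "finite S" and ab: "a \<le> b" and g: "continuous_on {a..b} g"
    and g': "\<And>t. t \<in> {a<..<b} - S \<Longrightarrow> (g has_vector_derivative g' t) (at t)"
    and m: "g' \<in> borel_measurable (lebesgue_on {a..b})" and B: "\<And>t. t \<in> {a..b} \<Longrightarrow> norm (g' t) \<le> B"
  shows "L2_deriv a b g g'"
  unfolding L2_deriv_def sq_integrable_def
proof (intro conjI ballI)
  show "g' \<in> borel_measurable (lebesgue_on {a..b})" by (rule m)
  show "integrable (lebesgue_on {a..b}) (\<lambda>x. (norm (g' x))\<^sup>2)"
  proof (rule Bochner_Integration.integrable_bound[where f = "\<lambda>_. B\<^sup>2"])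
    show "AE x in lebesgue_on {a..b}. norm ((norm (g' x))\<^sup>2) \<le> norm (B\<^sup>2)"
      using B by (intro AE_I2) (auto simp: space_restrict_space intro!: power_mono)
  qed (use m in auto)
  fix t assume "t \<in> {a..b}"
  then show "(g' has_integral (g t - g a)) {a..t}"
    using g' by (intro fundamental_theorem_of_calculus_interior_strong[OF S] continuous_on_subset[OF g]) auto
qed

section \<open>The product rule\<close>

text \<open>Increments of order 3/2, an exponent above 1, force the derivative to vanish at every
  point.\<close>

lemma constant_of_Holder:
  fixes \<Phi> :: "real \<Rightarrow> 'b::real_normed_vector"
  assumes "\<And>x y. a \<le> x \<Longrightarrow> x \<le> y \<Longrightarrow> y \<le> b \<Longrightarrow> norm (\<Phi> y - \<Phi> x) \<le> C * (y - x) * sqrt (y - x)"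
    and t: "t \<in> {a..b}"
  shows "\<Phi> t = \<Phi> a"
proof -
  have *: "norm (\<Phi> y - \<Phi> x) \<le> C * sqrt \<bar>y - x\<bar> * \<bar>y - x\<bar>" if "x \<in> {a..b}" "y \<in> {a..b}" for x y
    using assms(1)[of x y] assms(1)[of y x] that
    by (cases "x \<le> y") (auto simp: norm_minus_commute mult_ac)
  have "\<exists>c. \<forall>x\<in>{a..b}. \<Phi> x = c"
  proof (rule has_derivative_zero_constant)
    fix x assume x: "x \<in> {a..b}"
    show "(\<Phi> has_derivative (\<lambda>h. 0)) (at x within {a..b})"
      unfolding has_derivative_within
    proof (intro conjI)
      show "((\<lambda>y. (1 / norm (y - x)) *\<^sub>R (\<Phi> y - (\<Phi> x + 0))) \<longlongrightarrow> 0) (at x within {a..b})"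
      proof (rule Lim_null_comparison)
        show "\<forall>\<^sub>F y in at x within {a..b}. norm ((1 / norm (y - x)) *\<^sub>R (\<Phi> y - (\<Phi> x + 0))) \<le> C * sqrt \<bar>y - x\<bar>"
          unfolding eventually_at_filter
          by (rule always_eventually) (use *[OF x] in \<open>auto simp: divide_simps mult_ac\<close>)
        have "((\<lambda>y. C * sqrt \<bar>y - x\<bar>) \<longlongrightarrow> C * sqrt \<bar>x - x\<bar>) (at x within {a..b})"
          by (intro tendsto_intros)
        then show "((\<lambda>y. C * sqrt \<bar>y - x\<bar>) \<longlongrightarrow> 0) (at x within {a..b})" by simp
      qed
    qed simp
  qed simp
  then obtain c where "\<And>x. x \<in> {a..b} \<Longrightarrow> \<Phi> x = c" by blast
  then show ?thesis using t by force
qed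

lemma sq_integrable_bilinear:
  fixes g :: "real \<Rightarrow> 'c::euclidean_space" and v :: "real \<Rightarrow> 'b::euclidean_space" and prd :: "'c \<Rightarrow> 'b \<Rightarrow> 'd::euclidean_space"
  assumes prd: "bounded_bilinear prd" and g: "continuous_on {a..b} g"
    and v: "sq_integrable (lebesgue_on {a..b}) v"
  shows "sq_integrable (lebesgue_on {a..b}) (\<lambda>t. prd (g t) (v t))"
proof -
  interpret bounded_bilinear prd by (rule prd)
  have gm: "g \<in> borel_measurable (lebesgue_on {a..b})"
    by (rule continuous_imp_measurable_on_sets_lebesgue[OF g]) simp
  have vm: "v \<in> borel_measurable (lebesgue_on {a..b})" using v by (simp add: sq_integrable_def)
  have m: "(\<lambda>t. prd (g t) (v t)) \<in> borel_measurable (lebesgue_on {a..b})"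
  proof -
    have "(\<lambda>t. case (g t, v t) of (x, y) \<Rightarrow> prd x y) \<in> borel_measurable (lebesgue_on {a..b})"
      by (rule borel_measurable_continuous_Pair[OF gm vm])
        (auto intro!: continuous_intros continuous_on simp: split_def)
    then show ?thesis by simp
  qed
  have "bounded (g ` {a..b})" by (intro compact_imp_bounded compact_continuous_image g) simp
  then obtain G where G: "\<And>t. t \<in> {a..b} \<Longrightarrow> norm (g t) \<le> G" by (metis bounded_iff image_eqI)
  obtain C where C: "C > 0" "\<And>x y. norm (prd x y) \<le> norm x * norm y * C" using pos_bounded by blast
  have "integrable (lebesgue_on {a..b}) (\<lambda>t. (norm (prd (g t) (v t)))\<^sup>2)"
  proof (rule Bochner_Integration.integrable_bound)
    show "integrable (lebesgue_on {a..b}) (\<lambda>t. (G * C)\<^sup>2 * (norm (v t))\<^sup>2)"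
      using sq_integrable_norm2[OF v] by simp
    show "(\<lambda>t. (norm (prd (g t) (v t)))\<^sup>2) \<in> borel_measurable (lebesgue_on {a..b})" using m by simp
    have "(norm (prd (g t) (v t)))\<^sup>2 \<le> (G * C)\<^sup>2 * (norm (v t))\<^sup>2" if "t \<in> {a..b}" for t
    proof -
      have "norm (prd (g t) (v t)) \<le> norm (g t) * norm (v t) * C" by (rule C)
      also have "\<dots> \<le> G * norm (v t) * C" using G[OF that] C by (intro mult_right_mono) auto
      finally have "(norm (prd (g t) (v t)))\<^sup>2 \<le> (G * norm (v t) * C)\<^sup>2" by (intro power_mono) auto
      then show ?thesis by (simp add: power_mult_distrib mult_ac)
    qed
    then show "AE t in lebesgue_on {a..b}. norm ((norm (prd (g t) (v t)))\<^sup>2) \<le> norm ((G * C)\<^sup>2 * (norm (v t))\<^sup>2)"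
      by (intro AE_I2) (auto simp: space_restrict_space)
  qed
  then show ?thesis using m by (simp add: sq_integrable_def)
qed

text \<open>The difference of the two sides changes by \<open>O(\<bar>y - x\<bar> powr (3/2))\<close> between \<open>x\<close> and \<open>y\<close>,
  hence has derivative zero everywhere and not just almost everywhere.\<close>

lemma L2_deriv_bilinear:
  fixes g :: "real \<Rightarrow> 'c::euclidean_space" and F :: "real \<Rightarrow> 'b::euclidean_space" and prd :: "'c \<Rightarrow> 'b \<Rightarrow> 'd::euclidean_space"
  assumes prd: "bounded_bilinear prd"
    and g: "\<And>t. (g has_vector_derivative g' t) (at t)" and g'c: "continuous_on UNIV g'"
    and F: "L2_deriv a b F v"
  shows "L2_deriv a b (\<lambda>t. prd (g t) (F t)) (\<lambda>t. prd (g' t) (F t) + prd (g t) (v t))"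
proof -
  interpret bounded_bilinear prd by (rule prd)
  define w where "w = (\<lambda>t. prd (g' t) (F t) + prd (g t) (v t))"
  define V where "V = (\<integral>x. (norm (v x))\<^sup>2 \<partial>lebesgue_on {a..b})"
  have V0: "V \<ge> 0" unfolding V_def by (rule integral_nonneg_AE) simp
  note vS = L2_deriv_sq_integrable[OF F]
  have gc: "continuous_on A g" for A
    using g by (meson continuous_on_vector_derivative has_vector_derivative_at_within)
  have Fc: "continuous_on {a..b} F" by (rule L2_deriv_continuous_on[OF F])
  have g'A: "continuous_on A g'" for A by (rule continuous_on_subset[OF g'c]) simp
  have "continuous_on {a..b} (\<lambda>t. prd (g' t) (F t))" by (rule continuous_on[OF g'A Fc])
  then have 1: "sq_integrable (lebesgue_on {a..b}) (\<lambda>t. prd (g' t) (F t))"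
    by (rule sq_integrable_continuous)
  have wS: "sq_integrable (lebesgue_on {a..b}) w"
    unfolding w_def by (intro sq_integrable_add 1 sq_integrable_bilinear[OF prd gc vS])
  define \<Phi> where "\<Phi> = (\<lambda>t. prd (g t) (F t) - integral {a..t} w)"
  obtain C where C: "C > 0" "\<And>x y. norm (prd x y) \<le> norm x * norm y * C" using pos_bounded by blast
  have "bounded (g' ` {a..b})" by (intro compact_imp_bounded compact_continuous_image g'A) simp
  then obtain L where L: "\<And>t. t \<in> {a..b} \<Longrightarrow> norm (g' t) \<le> L" by (metis bounded_iff image_eqI)
  have gint: "(g' has_integral (g y - g x)) {x..y}" if "x \<le> y" for x y
    using g that by (intro fundamental_theorem_of_calculus) (auto intro: has_vector_derivative_at_within)
  \<comment> \<open>Freezing \<open>g\<close> at \<open>x\<close> and \<open>F\<close> at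
    \<open>y\<close> splits the increment of the product exactly into
    \<open>prd (g y - g x) (F y)\<close> and \<open>prd (g x) (F y - F x)\<close>. Against
    \<open>w\<close> the first has a 1/2-Hoelder error of \<open>F\<close> integrated over length
    \<open>y - x\<close>; the second has a Lipschitz error of \<open>g\<close> times the integral of
    \<open>norm (v s)\<close>, which is at most \<open>sqrt ((y - x) * V)\<close>.\<close>
  have est: "norm (\<Phi> y - \<Phi> x) \<le> (2 * C * L * sqrt V) * (y - x) * sqrt (y - x)"
    if xy: "a \<le> x" "x \<le> y" "y \<le> b" for x y
  proof -
    have L0: "L \<ge> 0" using L[of x] xy norm_ge_zero[of "g' x"] by (meson atLeastAtMost_iff order_trans)
    have "integral {a..y} w = integral {a..x} w + integral {x..y} w"
      using xy sq_integrable_integrable_on(1)[OF wS, of a y]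
      by (simp add: Henstock_Kurzweil_Integration.integral_combine)
    moreover have "(w has_integral integral {x..y} w) {x..y}"
      using sq_integrable_integrable_on(1)[OF wS, of x y] xy by (simp add: has_integral_integral)
    moreover have "((\<lambda>s. prd (g' s) (F y)) has_integral prd (g y - g x) (F y)) {x..y}"
      using has_integral_linear[OF gint[OF xy(2)] bounded_linear_left[of "F y"]] by (simp add: o_def)
    moreover have "((\<lambda>s. prd (g x) (v s)) has_integral prd (g x) (F y - F x)) {x..y}"
      using has_integral_linear[OF L2_deriv_has_integral[OF F xy] bounded_linear_right[of "g x"]] by (simp add: o_def)
    ultimately have hi: "((\<lambda>s. prd (g' s) (F y) + prd (g x) (v s) - w s) has_integral (\<Phi> y - \<Phi> x)) {x..y}"
      unfolding \<Phi>_def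
      by (intro has_integral_eq_rhs[OF has_integral_diff[OF has_integral_add]])
        (auto simp: diff_left diff_right)
    define bd where "bd = (\<lambda>s. L * sqrt ((y - x) * V) * C + (L * (y - x) * C) * norm (v s))"
    have nv: "(\<lambda>s. norm (v s)) integrable_on {x..y}" by (rule sq_integrable_integrable_on(2)[OF vS xy(1,3)])
    have bd: "bd integrable_on {x..y}" unfolding bd_def
      by (intro integrable_add integrable_const_ivl integrable_on_mult_right nv)
    have "norm (integral {x..y} (\<lambda>s. prd (g' s) (F y) + prd (g x) (v s) - w s)) \<le> integral {x..y} bd"
    proof (rule Henstock_Kurzweil_Integration.integral_norm_bound_integral)
      fix s assume s: "s \<in> {x..y}"
      have "norm (F y - F s) \<le> sqrt (\<bar>y - s\<bar> * V)"
        unfolding V_def by (rule L2_deriv_Holder[OF F]) (use s xy in auto)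
      also have "\<dots> \<le> sqrt ((y - x) * V)"
        using s V0 by (intro real_sqrt_le_mono mult_right_mono) auto
      finally have F': "norm (F y - F s) \<le> sqrt ((y - x) * V)" .
      have "norm (g s - g x) \<le> L * \<bar>s - x\<bar>"
      proof -
        have "norm (g s - g x) \<le> L * norm (s - x)"
        proof (rule differentiable_bound[where S="{a..b}" and f'="\<lambda>t h. h *\<^sub>R g' t"])
          show "(g has_derivative (\<lambda>h. h *\<^sub>R g' t)) (at t within {a..b})" for t
            using g[of t] unfolding has_vector_derivative_def by (rule has_derivative_at_withinI)
          show "onorm (\<lambda>h. h *\<^sub>R g' t) \<le> L" if "t \<in> {a..b}" for t
            using L[OF that] by (intro onorm_bound L0) (simp add: mult.commute[of L] mult_left_mono)
        qed (use xy s in auto)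
        then show ?thesis by simp
      qed
      also have "\<dots> \<le> L * (y - x)" using s L0 by (intro mult_left_mono) auto
      finally have G: "norm (g x - g s) \<le> L * (y - x)" by (simp add: norm_minus_commute)
      have "prd (g' s) (F y) + prd (g x) (v s) - w s = prd (g' s) (F y - F s) + prd (g x - g s) (v s)"
        unfolding w_def by (simp add: diff_left diff_right)
      also have "norm \<dots> \<le> norm (g' s) * norm (F y - F s) * C + norm (g x - g s) * norm (v s) * C"
        by (rule order_trans[OF norm_triangle_ineq add_mono[OF C(2) C(2)]])
      also have "\<dots> \<le> L * sqrt ((y - x) * V) * C + L * (y - x) * norm (v s) * C"
        using F' G L[of s] L0 s xy C(1) by (intro add_mono mult_right_mono mult_mono) auto
      finally show "norm (prd (g' s) (F y) + prd (g x) (v s) - w s) \<le> bd s"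
        by (simp add: bd_def mult_ac)
    qed (use hi bd in \<open>auto dest: has_integral_integrable\<close>)
    also have "integral {x..y} bd = (y - x) * (L * sqrt ((y - x) * V) * C) + (L * (y - x) * C) * integral {x..y} (\<lambda>s. norm (v s))"
      unfolding bd_def using xy nv
      by (subst Henstock_Kurzweil_Integration.integral_add) (auto intro!: integrable_on_mult_right)
    also have "\<dots> \<le> (y - x) * (L * sqrt ((y - x) * V) * C) + (L * (y - x) * C) * sqrt ((y - x) * V)"
      using integral_norm_le_sqrt[OF vS xy] L0 C(1) xy unfolding V_def[symmetric]
      by (intro add_left_mono mult_left_mono) auto
    also have "\<dots> = (2 * C * L * sqrt V) * (y - x) * sqrt (y - x)"
      unfolding real_sqrt_mult by algebra
    finally show ?thesis using hi by (simp add: integral_unique)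
  qed
  have const: "\<Phi> t = \<Phi> a" if "t \<in> {a..b}" for t
    by (rule constant_of_Holder[OF est that])
  have "(w has_integral (prd (g t) (F t) - prd (g a) (F a))) {a..t}" if t: "t \<in> {a..b}" for t
  proof -
    have "(w has_integral integral {a..t} w) {a..t}"
      using sq_integrable_integrable_on(1)[OF wS, of a t] t by (simp add: has_integral_integral)
    moreover have "integral {a..t} w = prd (g t) (F t) - prd (g a) (F a)"
      using const[OF t] by (simp add: \<Phi>_def algebra_simps)
    ultimately show ?thesis by simp
  qed
  then show ?thesis using wS by (simp add: L2_deriv_def w_def)
qed

text \<open>Increments of the primitive are L2 pairings of the derivative with indicator functions.
  These are the test functions through which pointwise convergence of primitives reaches the
  derivatives.\<close>

lemma L2_deriv_integral_indicator:
  fixes v :: "real \<Rightarrow> 'b::euclidean_space"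
  assumes v: "sq_integrable (lebesgue_on {a..b}) v" and t: "t \<in> {a..b}"
  shows "sq_integrable (lebesgue_on {a..b}) (\<lambda>x. indicator {a..t} x *\<^sub>R e)"
    and "(\<integral>x. v x \<bullet> (indicator {a..t} x *\<^sub>R e) \<partial>lebesgue_on {a..b}) = integral {a..t} v \<bullet> e"
proof -
  have m: "indicat_real {a..t} \<in> borel_measurable (lebesgue_on {a..b})"
    by (intro measurable_restrict_space1 borel_measurable_indicator) simp
  show i: "sq_integrable (lebesgue_on {a..b}) (\<lambda>x. indicator {a..t} x *\<^sub>R e)"
    unfolding sq_integrable_def
  proof
    show "(\<lambda>x. indicator {a..t} x *\<^sub>R e) \<in> borel_measurable (lebesgue_on {a..b})" using m by measurable
    show "integrable (lebesgue_on {a..b}) (\<lambda>x. (norm (indicator {a..t} x *\<^sub>R e))\<^sup>2)"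
    proof (rule Bochner_Integration.integrable_bound[where f = "\<lambda>_. (norm e)\<^sup>2"])
      show "(\<lambda>x. (norm (indicat_real {a..t} x *\<^sub>R e))\<^sup>2) \<in> borel_measurable (lebesgue_on {a..b})"
        using m by measurable
    qed (auto simp: indicator_def)
  qed
  have "(\<integral>x. v x \<bullet> (indicator {a..t} x *\<^sub>R e) \<partial>lebesgue_on {a..b})
      = integral {a..b} (\<lambda>x. v x \<bullet> (indicator {a..t} x *\<^sub>R e))"
    by (rule lebesgue_integral_eq_integral[OF sq_integrable_inner[OF v i]]) simp
  also have "\<dots> = integral {a..b} (\<lambda>x. if x \<in> {a..t} then v x \<bullet> e else 0)"
    by (rule integral_cong) (auto simp: indicator_def)
  also have "\<dots> = integral ({a..t} \<inter> {a..b}) (\<lambda>x. v x \<bullet> e)" by (rule integral_restrict_Int)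
  also have "{a..t} \<inter> {a..b} = {a..t}" using t by auto
  also have "integral {a..t} (\<lambda>x. v x \<bullet> e) = integral {a..t} v \<bullet> e"
    using sq_integrable_integrable_on(1)[OF v, of a t] t
    by (simp add: integral_component_eq)
  finally show "(\<integral>x. v x \<bullet> (indicator {a..t} x *\<^sub>R e) \<partial>lebesgue_on {a..b}) = integral {a..t} v \<bullet> e" .
qed

text \<open>Pointwise convergence fixes the limits of all pairings with indicators, so every weak
  limit of a subsequence is a derivative of \<open>G\<close> and all of them agree almost
  everywhere. Hence the whole sequence of derivatives converges weakly.\<close>

lemma L2_deriv_weak_limit:
  fixes F :: "nat \<Rightarrow> real \<Rightarrow> 'b::euclidean_space"
  assumes F: "\<And>n. L2_deriv a b (F n) (v n)"
    and K: "\<And>n. (\<integral>x. (norm (v n x))\<^sup>2 \<partial>lebesgue_on {a..b}) \<le> K"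
    and lim: "\<And>t. t \<in> {a..b} \<Longrightarrow> (\<lambda>n. F n t) \<longlonglongrightarrow> G t"
  obtains w where "L2_deriv a b G w"
    "\<And>p. sq_integrable (lebesgue_on {a..b}) p \<Longrightarrow>
       (\<lambda>n. \<integral>x. v n x \<bullet> p x \<partial>lebesgue_on {a..b}) \<longlonglongrightarrow> (\<integral>x. w x \<bullet> p x \<partial>lebesgue_on {a..b})"
proof (cases "a \<le> b")
  case False
  have "L2_deriv a b G (\<lambda>_. 0)" using False by (simp add: L2_deriv_def sq_integrable_def)
  moreover have "(\<integral>x. f x \<partial>lebesgue_on {a..b}) = 0" for f :: "real \<Rightarrow> real"
    using False by (simp add: integral_restrict_space)
  ultimately show ?thesis using that by simp
next
  case ab: True
  define M where "M = lebesgue_on {a..b}"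
  have M: "finite_measure M" unfolding M_def by (rule finite_measure_lebesgue_on_Icc)
  have vS: "sq_integrable M (v n)" for n unfolding M_def by (rule L2_deriv_sq_integrable[OF F])
  define D where "D = (\<lambda>(t, e::'b). (\<lambda>x. indicator {a..t} x *\<^sub>R e)) ` ({a..b} \<times> UNIV)"
  have DS: "sq_integrable M p" if "p \<in> D" for p
    using that L2_deriv_integral_indicator(1)[OF L2_deriv_sq_integrable[OF F]] unfolding M_def D_def by auto
  have intv: "(\<lambda>n. integral {a..t} (v n)) \<longlonglongrightarrow> G t - G a" if t: "t \<in> {a..b}" for t
  proof -
    have "integral {a..t} (v n) = F n t - F n a" for n
      using F[of n] t unfolding L2_deriv_def by (auto intro: integral_unique)
    then show ?thesis using lim[OF t] lim[of a] ab by (auto intro: tendsto_diff)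
  qed
  text \<open>Every weak limit of a subsequence is a derivative of \<open>G\<close>.\<close>
  have sub: "\<exists>w. L2_deriv a b G w \<and> (\<integral>x. w x \<bullet> p x \<partial>M) = l"
    if r: "strict_mono r" and p: "sq_integrable M p" and l: "(\<lambda>n. \<integral>x. v (r n) x \<bullet> p x \<partial>M) \<longlonglongrightarrow> l" for r p l
  proof -
    define L where "L = (\<lambda>p. lim (\<lambda>n. \<integral>x. v (r n) x \<bullet> p x \<partial>M))"
    have conv: "(\<lambda>n. \<integral>x. v (r n) x \<bullet> (indicator {a..t} x *\<^sub>R e) \<partial>M) \<longlonglongrightarrow> (G t - G a) \<bullet> e"
      if t: "t \<in> {a..b}" for t e
    proof -
      have "(\<lambda>n. integral {a..t} (v (r n)) \<bullet> e) \<longlonglongrightarrow> (G t - G a) \<bullet> e"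
        using LIMSEQ_subseq_LIMSEQ[OF intv[OF t] r] by (intro tendsto_intros) (simp add: o_def)
      then show ?thesis
        using L2_deriv_integral_indicator(2)[OF L2_deriv_sq_integrable[OF F] t] by (simp add: M_def)
    qed
    obtain w where w: "sq_integrable M w" "\<And>q. q \<in> insert p D \<Longrightarrow> (\<integral>x. w x \<bullet> q x \<partial>M) = L q"
    proof (rule sq_integrable_weak_limit[OF M, of "\<lambda>n. v (r n)" K "insert p D" L])
      show "(\<lambda>n. \<integral>x. v (r n) x \<bullet> q x \<partial>M) \<longlonglongrightarrow> L q" if q: "q \<in> insert p D" for q
      proof (cases "q = p")
        case True then show ?thesis using l by (simp add: L_def limI)
      next
        case False
        then obtain t e where "t \<in> {a..b}" "q = (\<lambda>x. indicator {a..t} x *\<^sub>R e)"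
          using q by (auto simp: D_def)
        then show ?thesis using conv[of t e] by (auto simp: L_def limI)
      qed
    qed (use vS K DS p in \<open>auto simp: M_def\<close>)
    have ie: "integral {a..t} w \<bullet> e = (G t - G a) \<bullet> e" if t: "t \<in> {a..b}" for t e
    proof -
      have "integral {a..t} w \<bullet> e = L (\<lambda>x. indicator {a..t} x *\<^sub>R e)"
      proof -
        have "(\<lambda>x. indicator {a..t} x *\<^sub>R e) \<in> insert p D"
          unfolding D_def by (rule insertI2, rule image_eqI[of _ _ "(t, e)"]) (use t in auto)
        from w(2)[OF this] show ?thesis
          using L2_deriv_integral_indicator(2)[OF w(1)[unfolded M_def] t, of e] by (simp add: M_def)
      qed
      also have "\<dots> = (G t - G a) \<bullet> e" using conv[OF t] by (simp add: L_def limI)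
      finally show ?thesis .
    qed
    have "integral {a..t} w = G t - G a" if "t \<in> {a..b}" for t
      by (rule euclidean_eqI) (rule ie[OF that])
    then have "L2_deriv a b G w"
      using w(1) sq_integrable_integrable_on(1)[OF w(1)[unfolded M_def]] unfolding L2_deriv_def M_def
      by (auto simp: has_integral_iff)
    moreover have "(\<integral>x. w x \<bullet> p x \<partial>M) = l" using w(2)[of p] l by (simp add: L_def limI)
    ultimately show ?thesis by blast
  qed
  \<comment> \<open>The trivial test function 0 yields some derivative of \<open>G\<close>; the
    contradiction below compares all other weak limits with it.\<close>
  obtain w where w: "L2_deriv a b G w"
    using sub[of id "\<lambda>_. 0" 0] by (auto simp: strict_mono_def sq_integrable_def)
  have "(\<lambda>n. \<integral>x. v n x \<bullet> p x \<partial>M) \<longlonglongrightarrow> (\<integral>x. w x \<bullet> p x \<partial>M)" if p: "sq_integrable M p" for p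
  proof (rule ccontr)
    define s where "s = (\<lambda>n. \<integral>x. v n x \<bullet> p x \<partial>M)"
    define l where "l = (\<integral>x. w x \<bullet> p x \<partial>M)"
    assume "\<not> (\<lambda>n. \<integral>x. v n x \<bullet> p x \<partial>M) \<longlonglongrightarrow> (\<integral>x. w x \<bullet> p x \<partial>M)"
    then have "\<not> s \<longlonglongrightarrow> l" by (simp add: s_def l_def)
    then obtain e where e: "e > 0" "\<And>n0. \<exists>n\<ge>n0. dist (s n) l \<ge> e"
      unfolding LIMSEQ_def by (auto simp: not_less)
    have "infinite {n. dist (s n) l \<ge> e}"
      unfolding infinite_nat_iff_unbounded_le using e(2) by auto
    then obtain r0 :: "nat \<Rightarrow> nat" where r0: "strict_mono r0" "\<And>n. dist (s (r0 n)) l \<ge> e"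
      using infinite_enumerate[of "{n. dist (s n) l \<ge> e}"] by auto
    have "\<bar>s n\<bar> \<le> sqrt (K * (\<integral>x. (norm (p x))\<^sup>2 \<partial>M))" for n
    proof -
      have "(s n)\<^sup>2 \<le> (\<integral>x. (norm (v n x))\<^sup>2 \<partial>M) * (\<integral>x. (norm (p x))\<^sup>2 \<partial>M)"
        unfolding s_def by (rule integral_inner_squared_le[OF vS p])
      also have "\<dots> \<le> K * (\<integral>x. (norm (p x))\<^sup>2 \<partial>M)"
        using K[of n] by (intro mult_right_mono) (auto simp: M_def integral_nonneg_AE)
      finally show ?thesis by (rule real_le_rsqrt[of "\<bar>s n\<bar>", simplified])
    qed
    \<comment> \<open>Bolzano-Weierstrass among the pairings that stay \<open>e\<close> away from
      \<open>l\<close>: their limit \<open>l'\<close> is again a pairing of \<open>p\<close> with a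
      derivative of \<open>G\<close>, hence equal to \<open>l\<close>.\<close>
    then have "bounded (range (s \<circ> r0))" by (auto simp: bounded_iff)
    then obtain l' r1 where r1: "strict_mono (r1 :: nat \<Rightarrow> nat)" "((s \<circ> r0) \<circ> r1) \<longlonglongrightarrow> l'"
      using bounded_imp_convergent_subsequence by blast
    have "strict_mono (r0 \<circ> r1)" using r0(1) r1(1) by (rule strict_mono_o)
    moreover have lim': "(\<lambda>n. s ((r0 \<circ> r1) n)) \<longlonglongrightarrow> l'" using r1(2) by (simp add: o_def)
    ultimately obtain w' where w': "L2_deriv a b G w'" "(\<integral>x. w' x \<bullet> p x \<partial>M) = l'"
      using sub[OF _ p] unfolding s_def by blast
    have "l' = l"
      unfolding w'(2)[symmetric] l_def
    proof (rule integral_cong_AE)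
      show "AE x in M. w' x \<bullet> p x = w x \<bullet> p x"
        using L2_deriv_unique_AE[OF w'(1) w] unfolding M_def by eventually_elim simp
      show "(\<lambda>x. w' x \<bullet> p x) \<in> borel_measurable M" "(\<lambda>x. w x \<bullet> p x) \<in> borel_measurable M"
        using sq_integrable_inner[OF _ p] L2_deriv_sq_integrable[OF w'(1)] L2_deriv_sq_integrable[OF w]
        unfolding M_def by auto
    qed
    moreover have "dist l' l \<ge> e"
      by (rule tendsto_lowerbound[OF tendsto_dist[OF lim' tendsto_const]]) (use r0(2) in auto)
    ultimately show False using e(1) by simp
  qed
  then show ?thesis using that[OF w] by (simp add: M_def)
qed

section \<open>The weak closure\<close>

lemma AE_lebesgue_on_negligible:
  assumes "AE t in lebesgue_on S. P t" "S \<in> sets lebesgue"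
  obtains Z where "negligible Z" "\<And>t. t \<in> S - Z \<Longrightarrow> P t"
proof -
  have "AE t in lebesgue. t \<in> S \<longrightarrow> P t"
    using assms by (subst (asm) AE_restrict_space_iff) auto
  then obtain Z where "\<And>t. t \<in> space lebesgue - Z \<Longrightarrow> t \<in> S \<longrightarrow> P t" "Z \<in> null_sets lebesgue"
    by (rule AE_E3) blast
  then show ?thesis using that[of Z] by (auto simp: negligible_iff_null_sets)
qed

lemma L2_deriv_cong:
  assumes "L2_deriv a b F v" "\<And>t. t \<in> {a..b} \<Longrightarrow> F t = G t"
  shows "L2_deriv a b G v"
proof (cases "a \<le> b")
  case True
  then have "F a = G a" using assms(2) by simp
  then show ?thesis using assms unfolding L2_deriv_def by simp
qed (use assms in \<open>simp add: L2_deriv_def\<close>)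

lemma L2_deriv_diff:
  "L2_deriv a b F v \<Longrightarrow> L2_deriv a b G w \<Longrightarrow> L2_deriv a b (\<lambda>t. F t - G t) (\<lambda>t. v t - w t)"
proof -
  assume *: "L2_deriv a b F v" "L2_deriv a b G w"
  have "((\<lambda>t. v t - w t) has_integral ((F t - G t) - (F a - G a))) {a..t}" if "t \<in> {a..b}" for t
    using has_integral_diff[of v "F t - F a" "{a..t}" w "G t - G a"] * that
    by (simp add: L2_deriv_def algebra_simps)
  then show ?thesis using * by (simp add: L2_deriv_def sq_integrable_diff)
qed

lemma L2_deriv_scaleR_vector:
  assumes "L2_deriv a b (G :: real \<Rightarrow> real) w"
  shows "L2_deriv a b (\<lambda>t. G t *\<^sub>R e) (\<lambda>t. w t *\<^sub>R (e :: 'b::euclidean_space))"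
proof -
  have "L2_deriv a b (\<lambda>t. G t *\<^sub>R e) (\<lambda>t. G t *\<^sub>R 0 + w t *\<^sub>R e)"
    using L2_deriv_bilinear[OF bounded_bilinear.flip[OF bounded_bilinear_scaleR], of "\<lambda>_. e" "\<lambda>_. 0", OF _ _ assms]
    by (simp add: has_vector_derivative_const)
  then show ?thesis by simp
qed

lemma L2_deriv_zero: "L2_deriv a b (\<lambda>_. 0) (\<lambda>_. 0)"
  by (simp add: L2_deriv_def sq_integrable_def)

abbreviation per_measure :: "real measure" where
  "per_measure \<equiv> lebesgue_on {0..2*pi}"

abbreviation energy :: "(real \<Rightarrow> 'b::euclidean_space) \<Rightarrow> real" where
  "energy v \<equiv> (\<integral>t. (norm (v t))\<^sup>2 \<partial>per_measure)"

abbreviation L2_inner :: "(real \<Rightarrow> 'b::euclidean_space) \<Rightarrow> (real \<Rightarrow> 'b) \<Rightarrow> real" where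
  "L2_inner v w \<equiv> (\<integral>t. v t \<bullet> w t \<partial>per_measure)"

text \<open>Frees the inner product from \<open>vector_derivative\<close>: any representatives of
  the weak derivatives may be used.\<close>

lemma H1_inner_eq:
  assumes q: "\<And>i. i < N \<Longrightarrow> L2_deriv 0 (2*pi) (q i) (v i)"
    and p: "\<And>i. i < N \<Longrightarrow> L2_deriv 0 (2*pi) (p i) (w i)"
  shows "H1_inner N q p = (\<Sum>i<N. L2_inner (q i) (p i) + L2_inner (v i) (w i))"
proof -
  have "AE t in per_measure. \<forall>i\<in>{..<N}. vector_derivative (q i) (at t) = v i t \<and> vector_derivative (p i) (at t) = w i t"
    using L2_deriv_vector_derivative_AE[OF q] L2_deriv_vector_derivative_AE[OF p] by (simp add: AE_ball_countable)
  then obtain Z where Z: "negligible Z" "\<And>t. t \<in> {0..2*pi} - Z \<Longrightarrow>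
      \<forall>i\<in>{..<N}. vector_derivative (q i) (at t) = v i t \<and> vector_derivative (p i) (at t) = w i t"
    by (rule AE_lebesgue_on_negligible) auto
  have i1: "integrable per_measure (\<lambda>t. q i t \<bullet> p i t)" if "i < N" for i
    by (intro sq_integrable_inner sq_integrable_continuous L2_deriv_continuous_on[OF q[OF that]] L2_deriv_continuous_on[OF p[OF that]])
  have i2: "integrable per_measure (\<lambda>t. v i t \<bullet> w i t)" if "i < N" for i
    by (intro sq_integrable_inner L2_deriv_sq_integrable[OF q[OF that]] L2_deriv_sq_integrable[OF p[OF that]])
  have "H1_inner N q p = integral {0..2*pi} (\<lambda>t. \<Sum>i<N. q i t \<bullet> p i t + v i t \<bullet> w i t)"
    unfolding H1_inner_def by (rule integral_spike[OF Z(1)]) (use Z(2) in \<open>auto intro!: sum.cong\<close>)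
  also have "\<dots> = (\<integral>t. (\<Sum>i<N. q i t \<bullet> p i t + v i t \<bullet> w i t) \<partial>per_measure)"
    using i1 i2 by (intro lebesgue_integral_eq_integral[symmetric]) auto
  also have "\<dots> = (\<Sum>i<N. L2_inner (q i) (p i) + L2_inner (v i) (w i))"
    using i1 i2 by (subst Bochner_Integration.integral_sum) auto
  finally show ?thesis .
qed

lemma H1_loop_obtain_deriv:
  assumes "H1_loop N q"
  obtains v where "\<And>i. i < N \<Longrightarrow> L2_deriv 0 (2*pi) (q i) (v i)"
  using assms unfolding H1_loop_iff by metis

text \<open>Additivity in the first argument. It is not formal, because
  \<open>vector_derivative\<close> of a difference splits only at times where the loops are
  differentiable, and that is almost every time for H1 loops.\<close>

lemma H1_inner_diff_triangle:
  assumes "H1_loop N c" "H1_loop N r" "H1_loop N q" "H1_loop N p"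
  shows "H1_inner N (\<lambda>i t. c i t - q i t) p = H1_inner N (\<lambda>i t. c i t - r i t) p + H1_inner N (\<lambda>i t. r i t - q i t) p"
proof -
  obtain vc where c: "\<And>i. i < N \<Longrightarrow> L2_deriv 0 (2*pi) (c i) (vc i)" using assms(1) by (rule H1_loop_obtain_deriv) blast
  obtain vr where r: "\<And>i. i < N \<Longrightarrow> L2_deriv 0 (2*pi) (r i) (vr i)" using assms(2) by (rule H1_loop_obtain_deriv) blast
  obtain vq where q: "\<And>i. i < N \<Longrightarrow> L2_deriv 0 (2*pi) (q i) (vq i)" using assms(3) by (rule H1_loop_obtain_deriv) blast
  obtain w where p: "\<And>i. i < N \<Longrightarrow> L2_deriv 0 (2*pi) (p i) (w i)" using assms(4) by (rule H1_loop_obtain_deriv) blast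
  have add: "(\<integral>t. (f t - h t) \<bullet> e t \<partial>M) = (\<integral>t. (f t - g t) \<bullet> e t \<partial>M) + (\<integral>t. (g t - h t) \<bullet> e t \<partial>M)"
    if "sq_integrable M f" "sq_integrable M g" "sq_integrable M h" "sq_integrable M e"
    for f g h e :: "real \<Rightarrow> complex \<times> real" and M
    using sq_integrable_inner[OF that(1,4)] sq_integrable_inner[OF that(2,4)] sq_integrable_inner[OF that(3,4)]
    by (simp add: inner_diff_left)
  have cq: "L2_deriv 0 (2*pi) (\<lambda>t. c i t - q i t) (\<lambda>t. vc i t - vq i t)"
    and cr: "L2_deriv 0 (2*pi) (\<lambda>t. c i t - r i t) (\<lambda>t. vc i t - vr i t)"
    and rq: "L2_deriv 0 (2*pi) (\<lambda>t. r i t - q i t) (\<lambda>t. vr i t - vq i t)" if "i < N" for i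
    by (intro L2_deriv_diff c r q that)+
  have eqs: "H1_inner N (\<lambda>i t. c i t - q i t) p =
      (\<Sum>i<N. L2_inner (\<lambda>t. c i t - q i t) (p i) + L2_inner (\<lambda>t. vc i t - vq i t) (w i))"
    "H1_inner N (\<lambda>i t. c i t - r i t) p =
      (\<Sum>i<N. L2_inner (\<lambda>t. c i t - r i t) (p i) + L2_inner (\<lambda>t. vc i t - vr i t) (w i))"
    "H1_inner N (\<lambda>i t. r i t - q i t) p =
      (\<Sum>i<N. L2_inner (\<lambda>t. r i t - q i t) (p i) + L2_inner (\<lambda>t. vr i t - vq i t) (w i))"
    by (rule H1_inner_eq; intro cq cr rq p; assumption)+
  show ?thesis
    unfolding eqs sum.distrib[symmetric]
  proof (rule sum.cong[OF refl])
    fix i assume "i \<in> {..<N}"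
    then have i: "i < N" by simp
    note s = sq_integrable_continuous[OF L2_deriv_continuous_on]
    show "L2_inner (\<lambda>t. c i t - q i t) (p i) + L2_inner (\<lambda>t. vc i t - vq i t) (w i) =
        L2_inner (\<lambda>t. c i t - r i t) (p i) + L2_inner (\<lambda>t. vc i t - vr i t) (w i) +
        (L2_inner (\<lambda>t. r i t - q i t) (p i) + L2_inner (\<lambda>t. vr i t - vq i t) (w i))"
      using add[OF s[OF c[OF i]] s[OF r[OF i]] s[OF q[OF i]] s[OF p[OF i]]]
        add[OF c[OF i, THEN L2_deriv_sq_integrable] r[OF i, THEN L2_deriv_sq_integrable]
          q[OF i, THEN L2_deriv_sq_integrable] p[OF i, THEN L2_deriv_sq_integrable]] by simp
  qed
qed

lemma Lambda_xi_subset: "q \<in> Lambda_xi N \<xi> \<Longrightarrow> q \<in> Lambda_DN N"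
  by (simp add: Lambda_xi_def weak_closure_def)

lemma Lambda_DN_H1_loop: "q \<in> Lambda_DN N \<Longrightarrow> H1_loop N q"
  by (simp add: Lambda_DN_def)

lemma H1_inner_zero: "H1_inner N (\<lambda>i t. 0) p = 0"
  by (simp add: H1_inner_def)

lemma Lambda_xiI:
  assumes "q \<in> Lambda_DN N" "collision_free N q" "sign_vec N q = \<xi>"
  shows "q \<in> Lambda_xi N \<xi>"
  unfolding Lambda_xi_def weak_closure_def mem_Collect_eq
proof (intro conjI assms allI impI)
  fix P :: "loop set" and \<epsilon> :: real assume "\<epsilon> > 0"
  then show "\<exists>c\<in>{q \<in> Lambda_DN N. collision_free N q \<and> sign_vec N q = \<xi>}. \<forall>p\<in>P. \<bar>H1_inner N (\<lambda>i t. c i t - q i t) p\<bar> < \<epsilon>"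
    using assms by (intro bexI[of _ q]) (simp_all add: H1_inner_zero)
qed

text \<open>A basic neighbourhood involves finitely many functionals, so one index brings the
  sequence within \<open>\<epsilon> / 2\<close> for all of them; an admissible collision-free loop
  near that member supplies the other half.\<close>

lemma Lambda_xi_weak_limit:
  assumes qn: "\<And>n. qn n \<in> Lambda_xi N \<xi>" and q: "q \<in> Lambda_DN N"
    and weak: "\<And>p. H1_loop N p \<Longrightarrow> (\<lambda>n. H1_inner N (\<lambda>i t. qn n i t - q i t) p) \<longlonglongrightarrow> 0"
  shows "q \<in> Lambda_xi N \<xi>"
  unfolding Lambda_xi_def weak_closure_def mem_Collect_eq
proof (intro conjI q allI impI)
  fix P :: "loop set" and \<epsilon> :: real
  assume P: "finite P" "P \<subseteq> {p. H1_loop N p}" and \<epsilon>: "\<epsilon> > 0"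
  have "\<forall>\<^sub>F n in sequentially. \<bar>H1_inner N (\<lambda>i t. qn n i t - q i t) p\<bar> < \<epsilon> / 2" if "p \<in> P" for p
    using tendstoD[OF weak, of p "\<epsilon>/2"] that P(2) \<epsilon> by auto
  then have "\<forall>\<^sub>F n in sequentially. \<forall>p\<in>P. \<bar>H1_inner N (\<lambda>i t. qn n i t - q i t) p\<bar> < \<epsilon> / 2"
    using P(1) by (simp add: eventually_ball_finite)
  then obtain n where n: "\<And>p. p \<in> P \<Longrightarrow> \<bar>H1_inner N (\<lambda>i t. qn n i t - q i t) p\<bar> < \<epsilon> / 2"
    by (auto simp: eventually_sequentially)
  obtain c where c: "c \<in> {q \<in> Lambda_DN N. collision_free N q \<and> sign_vec N q = \<xi>}"
    "\<And>p. p \<in> P \<Longrightarrow> \<bar>H1_inner N (\<lambda>i t. c i t - qn n i t) p\<bar> < \<epsilon> / 2"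
  proof -
    have "\<forall>\<epsilon>>0. \<exists>c\<in>{q \<in> Lambda_DN N. collision_free N q \<and> sign_vec N q = \<xi>}. \<forall>p\<in>P. \<bar>H1_inner N (\<lambda>i t. c i t - qn n i t) p\<bar> < \<epsilon>"
      using qn[of n] P unfolding Lambda_xi_def weak_closure_def mem_Collect_eq by blast
    then show ?thesis using that half_gt_zero[OF \<epsilon>] by meson
  qed
  have "\<bar>H1_inner N (\<lambda>i t. c i t - q i t) p\<bar> < \<epsilon>" if p: "p \<in> P" for p
  proof -
    have "H1_inner N (\<lambda>i t. c i t - q i t) p = H1_inner N (\<lambda>i t. c i t - qn n i t) p + H1_inner N (\<lambda>i t. qn n i t - q i t) p"
      using c(1) q qn[of n] P(2) p by (intro H1_inner_diff_triangle) (auto dest: Lambda_xi_subset Lambda_DN_H1_loop)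
    then show ?thesis using c(2)[OF p] n[OF p] by linarith
  qed
  then show "\<exists>c\<in>{q \<in> Lambda_DN N. collision_free N q \<and> sign_vec N q = \<xi>}. \<forall>p\<in>P. \<bar>H1_inner N (\<lambda>i t. c i t - q i t) p\<bar> < \<epsilon>"
    using c(1) by blast
qed

text \<open>The part of order zero tends to 0 by dominated convergence, with dominating function
  \<open>B * norm (p i t)\<close>; the derivative part does so by weak convergence.\<close>

lemma H1_inner_tendsto_0:
  assumes qn: "\<And>n i. i < N \<Longrightarrow> L2_deriv 0 (2*pi) (qn n i) (v n i)"
    and q: "\<And>i. i < N \<Longrightarrow> L2_deriv 0 (2*pi) (q i) (w i)"
    and lim: "\<And>i t. i < N \<Longrightarrow> t \<in> {0..2*pi} \<Longrightarrow> (\<lambda>n. qn n i t) \<longlonglongrightarrow> q i t"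
    and B: "\<And>n i t. i < N \<Longrightarrow> t \<in> {0..2*pi} \<Longrightarrow> norm (qn n i t - q i t) \<le> B"
    and weak: "\<And>i p. i < N \<Longrightarrow> sq_integrable per_measure p \<Longrightarrow>
      (\<lambda>n. L2_inner (v n i) p) \<longlonglongrightarrow> L2_inner (w i) p"
    and p: "H1_loop N p"
  shows "(\<lambda>n. H1_inner N (\<lambda>i t. qn n i t - q i t) p) \<longlonglongrightarrow> 0"
proof -
  obtain wp where p: "\<And>i. i < N \<Longrightarrow> L2_deriv 0 (2*pi) (p i) (wp i)" using p by (rule H1_loop_obtain_deriv) blast
  have 1: "(\<lambda>n. \<integral>t. (qn n i t - q i t) \<bullet> p i t \<partial>per_measure) \<longlonglongrightarrow> 0" if i: "i < N" for i
  proof -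
    note s = sq_integrable_continuous[OF L2_deriv_continuous_on]
    have "(\<lambda>n. \<integral>t. (qn n i t - q i t) \<bullet> p i t \<partial>per_measure) \<longlonglongrightarrow> (\<integral>t. 0 \<partial>per_measure)"
    proof (rule integral_dominated_convergence)
      show "integrable per_measure (\<lambda>t. B * norm (p i t))"
        using sq_integrable_imp_integrable[OF finite_measure_lebesgue_on_Icc s[OF p[OF i]]] by simp
      show "AE t in per_measure. (\<lambda>n. (qn n i t - q i t) \<bullet> p i t) \<longlonglongrightarrow> 0"
      proof (rule AE_I2)
        fix t assume "t \<in> space per_measure"
        then have "(\<lambda>n. (qn n i t - q i t) \<bullet> p i t) \<longlonglongrightarrow> (q i t - q i t) \<bullet> p i t"
          using lim[OF i, of t] by (intro tendsto_intros) (simp add: space_restrict_space)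
        then show "(\<lambda>n. (qn n i t - q i t) \<bullet> p i t) \<longlonglongrightarrow> 0" by simp
      qed
      show "AE t in per_measure. norm ((qn n i t - q i t) \<bullet> p i t) \<le> B * norm (p i t)" for n
      proof (rule AE_I2)
        fix t assume "t \<in> space per_measure"
        then have "norm (qn n i t - q i t) \<le> B" using B[OF i, of t] by (simp add: space_restrict_space)
        then show "norm ((qn n i t - q i t) \<bullet> p i t) \<le> B * norm (p i t)"
          unfolding real_norm_def
          by (intro order_trans[OF Cauchy_Schwarz_ineq2] mult_right_mono norm_ge_zero)
      qed
      show "(\<lambda>t. (qn n i t - q i t) \<bullet> p i t) \<in> borel_measurable per_measure" for n
        using sq_integrable_inner[OF s[OF L2_deriv_diff[OF qn[OF i, of n] q[OF i]]] s[OF p[OF i]]] by simp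
    qed simp
    then show ?thesis by simp
  qed
  have 2: "(\<lambda>n. \<integral>t. (v n i t - w i t) \<bullet> wp i t \<partial>per_measure) \<longlonglongrightarrow> 0" if i: "i < N" for i
  proof -
    note s = L2_deriv_sq_integrable
    have "L2_inner (\<lambda>t. v n i t - w i t) (wp i)
        = L2_inner (v n i) (wp i) - L2_inner (w i) (wp i)" for n
      using sq_integrable_inner[OF s[OF qn[OF i, of n]] s[OF p[OF i]]] sq_integrable_inner[OF s[OF q[OF i]] s[OF p[OF i]]]
      by (simp add: inner_diff_left)
    then show ?thesis using LIM_zero[OF weak[OF i s[OF p[OF i]]]] by simp
  qed
  have "(\<lambda>n. \<Sum>i<N. L2_inner (\<lambda>t. qn n i t - q i t) (p i) + L2_inner (\<lambda>t. v n i t - w i t) (wp i)) \<longlonglongrightarrow> (\<Sum>i<N. 0 + 0)"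
    by (intro tendsto_intros 1 2) auto
  then show ?thesis
    by (subst H1_inner_eq[OF L2_deriv_diff[OF qn q] p]) auto
qed

text \<open>Up to the factor \<open>2 * sinh pi\<close>, \<open>G\<close> is the Green function of \<open>1 - d\<^sup>2/dt\<^sup>2\<close> on the circle, so that
  pairing with it in \<open>H\<^sup>1\<close> is evaluation at \<open>\<tau>\<close>.\<close>

lemma Green_function:
  fixes \<tau> :: real and F v :: "real \<Rightarrow> 'b::euclidean_space"
  defines "G \<equiv> \<lambda>t. if t \<le> \<tau> then cosh (t - \<tau> + pi) else cosh (t - \<tau> - pi)"
    and "G' \<equiv> \<lambda>t. if t \<le> \<tau> then sinh (t - \<tau> + pi) else sinh (t - \<tau> - pi)"
  assumes \<tau>: "0 < \<tau>" "\<tau> < 2*pi"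
  shows "L2_deriv 0 (2*pi) G G'"
    and "L2_deriv 0 (2*pi) F v \<Longrightarrow> F (2*pi) = F 0 \<Longrightarrow>
      (\<integral>t. F t \<bullet> (G t *\<^sub>R e) \<partial>per_measure) + (\<integral>t. v t \<bullet> (G' t *\<^sub>R e) \<partial>per_measure) = 2 * sinh pi * (F \<tau> \<bullet> e)"
proof -
  \<comment> \<open>In this form \<open>G\<close> is visibly continuous across the kink at
    \<tau>.\<close>
  have Gabs: "G t = cosh (pi - \<bar>t - \<tau>\<bar>)" for t
  proof -
    have "cosh (t - \<tau> - pi) = cosh (pi - (t - \<tau>))" by (metis cosh_minus minus_diff_eq)
    then show ?thesis by (auto simp: G_def algebra_simps)
  qed
  have Gm: "G' \<in> borel_measurable per_measure"
  proof -
    have "G' \<in> borel_measurable borel"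
      unfolding G'_def by (intro measurable_If borel_measurable_continuous_onI continuous_intros) measurable
    then show ?thesis by (intro measurable_restrict_space1 measurable_completion) simp
  qed
  show G: "L2_deriv 0 (2*pi) G G'"
  proof (rule L2_deriv_C1[where S="{\<tau>}" and B="sinh (3 * pi)"])
    show "continuous_on {0..2*pi} G" unfolding Gabs by (intro continuous_intros)
    show "G' \<in> borel_measurable per_measure" by (rule Gm)
    show "norm (G' t) \<le> sinh (3 * pi)" if "t \<in> {0..2*pi}" for t
    proof -
      have "\<bar>sinh x\<bar> \<le> sinh (3 * pi)" if "\<bar>x\<bar> \<le> 3 * pi" for x
      proof -
        have "sinh x \<le> sinh (3 * pi)" "sinh (- x) \<le> sinh (3 * pi)"
          using that by (auto simp only: sinh_real_le_iff)
        then show ?thesis by (simp add: abs_le_iff)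
      qed
      then show ?thesis using that \<tau> by (auto simp: G'_def)
    qed
    fix t assume t: "t \<in> {0<..<2*pi} - {\<tau>}"
    show "(G has_vector_derivative G' t) (at t)"
    proof (cases "t < \<tau>")
      case True
      have "((\<lambda>t. cosh (t - \<tau> + pi)) has_vector_derivative sinh (t - \<tau> + pi)) (at t)"
        by (auto intro!: derivative_eq_intros simp flip: has_real_derivative_iff_has_vector_derivative)
      then have "(G has_vector_derivative sinh (t - \<tau> + pi)) (at t)"
        by (rule has_vector_derivative_transform_within_open[where S="{..<\<tau>}"]) (use True in \<open>auto simp: G_def\<close>)
      then show ?thesis using True by (simp add: G'_def)
    next
      case False
      have "((\<lambda>t. cosh (t - \<tau> - pi)) has_vector_derivative sinh (t - \<tau> - pi)) (at t)"
        by (auto intro!: derivative_eq_intros simp flip: has_real_derivative_iff_has_vector_derivative)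
      then have "(G has_vector_derivative sinh (t - \<tau> - pi)) (at t)"
        by (rule has_vector_derivative_transform_within_open[where S="{\<tau><..}"]) (use False t in \<open>auto simp: G_def\<close>)
      then show ?thesis using False t by (simp add: G'_def)
    qed
  qed auto
  assume F: "L2_deriv 0 (2*pi) F v" and per: "F (2*pi) = F 0"
  have sinh_deriv: "((\<lambda>t. sinh (t + c)) has_vector_derivative cosh (t + c)) (at t)" for t c :: real
    by (auto intro!: derivative_eq_intros simp flip: has_real_derivative_iff_has_vector_derivative)
  have cc: "continuous_on UNIV (\<lambda>t::real. cosh (t + c))" for c by (intro continuous_intros)
  \<comment> \<open>On either side of \<tau> the integrand \<open>H\<close> is the derivative of a
    hyperbolic sine times \<open>F\<close>. By periodicity the contributions of the two end points
    cancel, and the jump of the sine at \<tau> leaves \<open>2 * sinh pi\<close> times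
    \<open>F \<tau>\<close>.\<close>
  define H where "H = (\<lambda>t. G t *\<^sub>R F t + G' t *\<^sub>R v t)"
  have "L2_deriv 0 \<tau> F v" by (rule L2_deriv_subinterval[OF F]) (use \<tau> in auto)
  from L2_deriv_has_integral[OF L2_deriv_bilinear[OF bounded_bilinear_scaleR sinh_deriv[of "pi - \<tau>"] cc this], of 0 \<tau>]
  have "((\<lambda>t. cosh (t + (pi - \<tau>)) *\<^sub>R F t + sinh (t + (pi - \<tau>)) *\<^sub>R v t) has_integral
      (sinh pi *\<^sub>R F \<tau> - sinh (pi - \<tau>) *\<^sub>R F 0)) {0..\<tau>}" using \<tau> by simp
  then have 1: "(H has_integral (sinh pi *\<^sub>R F \<tau> - sinh (pi - \<tau>) *\<^sub>R F 0)) {0..\<tau>}"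
    by (rule has_integral_eq[rotated]) (auto simp: H_def G_def G'_def algebra_simps)
  have "L2_deriv \<tau> (2*pi) F v" by (rule L2_deriv_subinterval[OF F]) (use \<tau> in auto)
  from L2_deriv_has_integral[OF L2_deriv_bilinear[OF bounded_bilinear_scaleR sinh_deriv[of "- \<tau> - pi"] cc this], of \<tau> "2*pi"]
  have "((\<lambda>t. cosh (t + (- \<tau> - pi)) *\<^sub>R F t + sinh (t + (- \<tau> - pi)) *\<^sub>R v t) has_integral
      (sinh (pi - \<tau>) *\<^sub>R F 0 + sinh pi *\<^sub>R F \<tau>)) {\<tau>..2*pi}"
    using \<tau> per by (simp add: algebra_simps)
  then have 2: "(H has_integral (sinh (pi - \<tau>) *\<^sub>R F 0 + sinh pi *\<^sub>R F \<tau>)) {\<tau>..2*pi}"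
    by (rule has_integral_spike_finite[of "{\<tau>}", rotated 2]) (auto simp: H_def G_def G'_def algebra_simps)
  have "(H has_integral ((sinh pi *\<^sub>R F \<tau> - sinh (pi - \<tau>) *\<^sub>R F 0) + (sinh (pi - \<tau>) *\<^sub>R F 0 + sinh pi *\<^sub>R F \<tau>))) {0..2*pi}"
    by (rule has_integral_combine[OF _ _ 1 2]) (use \<tau> in auto)
  moreover have "(2 * sinh pi) *\<^sub>R F \<tau> = sinh pi *\<^sub>R F \<tau> + sinh pi *\<^sub>R F \<tau>"
    by (simp only: mult_2 scaleR_left_distrib)
  ultimately have "(H has_integral ((2 * sinh pi) *\<^sub>R F \<tau>)) {0..2*pi}" by simp
  from has_integral_linear[OF this bounded_linear_inner_left[of e]]
  have H: "((\<lambda>t. H t \<bullet> e) has_integral (2 * sinh pi * (F \<tau> \<bullet> e))) {0..2*pi}" by (simp add: o_def)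
  note Ge = L2_deriv_scaleR_vector[OF G, of e]
  have i1: "integrable per_measure (\<lambda>t. F t \<bullet> (G t *\<^sub>R e))"
    by (intro sq_integrable_inner sq_integrable_continuous L2_deriv_continuous_on[OF F] L2_deriv_continuous_on[OF Ge])
  have i2: "integrable per_measure (\<lambda>t. v t \<bullet> (G' t *\<^sub>R e))"
    by (intro sq_integrable_inner L2_deriv_sq_integrable[OF F] L2_deriv_sq_integrable[OF Ge])
  have "(\<integral>t. F t \<bullet> (G t *\<^sub>R e) \<partial>per_measure) + (\<integral>t. v t \<bullet> (G' t *\<^sub>R e) \<partial>per_measure)
      = (\<integral>t. F t \<bullet> (G t *\<^sub>R e) + v t \<bullet> (G' t *\<^sub>R e) \<partial>per_measure)"
    by (rule Bochner_Integration.integral_add[OF i1 i2, symmetric])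
  also have "\<dots> = integral {0..2*pi} (\<lambda>t. F t \<bullet> (G t *\<^sub>R e) + v t \<bullet> (G' t *\<^sub>R e))"
    using i1 i2 by (intro lebesgue_integral_eq_integral) auto
  also have "\<dots> = integral {0..2*pi} (\<lambda>t. H t \<bullet> e)" by (simp add: H_def inner_add_left)
  also have "\<dots> = 2 * sinh pi * (F \<tau> \<bullet> e)" using H by (rule integral_unique)
  finally show "(\<integral>t. F t \<bullet> (G t *\<^sub>R e) \<partial>per_measure) + (\<integral>t. v t \<bullet> (G' t *\<^sub>R e) \<partial>per_measure) = 2 * sinh pi * (F \<tau> \<bullet> e)" .
qed

text \<open>The Green function, extended periodically, pointing in direction \<open>e\<close> and
  carried by mass 0 alone, is an admissible test loop. Hence components of \<open>q 0 \<tau>\<close>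
  are weakly continuous in the loop.\<close>

lemma H1_point_evaluation:
  assumes N: "N > 0" and \<tau>: "0 < \<tau>" "\<tau> < 2*pi"
  obtains p where "H1_loop N p"
    "\<And>c q. H1_loop N c \<Longrightarrow> H1_loop N q \<Longrightarrow>
       H1_inner N (\<lambda>i t. c i t - q i t) p = 2 * sinh pi * ((c 0 \<tau> - q 0 \<tau>) \<bullet> e)"
proof -
  define G where "G = (\<lambda>t. if t \<le> \<tau> then cosh (t - \<tau> + pi) else cosh (t - \<tau> - pi))"
  define G' where "G' = (\<lambda>t. if t \<le> \<tau> then sinh (t - \<tau> + pi) else sinh (t - \<tau> - pi))"
  have Gr: "L2_deriv 0 (2*pi) G G'"
    unfolding G_def G'_def by (rule Green_function(1)[OF \<tau>])
  have Gr2: "(\<integral>t. F t \<bullet> (G t *\<^sub>R e) \<partial>per_measure) + (\<integral>t. v t \<bullet> (G' t *\<^sub>R e) \<partial>per_measure) = 2 * sinh pi * (F \<tau> \<bullet> e)"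
    if "L2_deriv 0 (2*pi) F v" "F (2*pi) = F 0" for F v
    unfolding G_def G'_def using that by (rule Green_function(2)[OF \<tau>])
  \<comment> \<open>\<open>frac\<close> produces the \<open>2*pi\<close>-periodic extension of
    \<open>G\<close>, with the kink at \<tau> and its translates.\<close>
  define P where "P = (\<lambda>t. cosh (2*pi * frac ((t - \<tau>) / (2*pi)) - pi))"
  have PG: "P t = G t" if t: "t \<in> {0..2*pi}" for t
  proof (cases "t < \<tau>")
    case True
    then have "frac ((t - \<tau>) / (2*pi)) = (t - \<tau>) / (2*pi) + 1"
      using t \<tau> by (subst frac_unique_iff) (auto simp: field_simps)
    then have "2*pi * frac ((t - \<tau>) / (2*pi)) = t - \<tau> + 2 * pi" by (simp add: field_simps)
    then have "P t = cosh (t - \<tau> + pi)" unfolding P_def by (simp add: algebra_simps)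
    then show ?thesis using True by (simp add: G_def)
  next
    case False
    then have "frac ((t - \<tau>) / (2*pi)) = (t - \<tau>) / (2*pi)"
      using t \<tau> by (subst frac_eq) (auto simp: field_simps)
    then have "P t = cosh (t - \<tau> - pi)" unfolding P_def by simp
    then show ?thesis using False by (auto simp: G_def)
  qed
  have Pper: "P (t + 2*pi) = P t" for t
  proof -
    have "(t + 2*pi - \<tau>) / (2*pi) = (t - \<tau>) / (2*pi) + 1" by (simp add: field_simps)
    then show ?thesis unfolding P_def by (simp add: frac_1_eq)
  qed
  define p where "p = (\<lambda>i t. if i = (0::nat) then P t *\<^sub>R e else 0)"
  define w where "w = (\<lambda>i t. if i = (0::nat) then G' t *\<^sub>R e else 0)"
  have L: "L2_deriv 0 (2*pi) (p i) (w i)" for i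
  proof (cases "i = 0")
    case True
    have "L2_deriv 0 (2*pi) (\<lambda>t. P t *\<^sub>R e) (\<lambda>t. G' t *\<^sub>R e)"
      using L2_deriv_scaleR_vector[OF Gr] by (rule L2_deriv_cong) (simp add: PG)
    then show ?thesis using True by (simp add: p_def w_def)
  qed (simp add: p_def w_def L2_deriv_zero)
  show ?thesis
  proof (rule that)
    show "H1_loop N p" unfolding H1_loop_iff using L Pper by (auto simp: p_def)
    fix c q assume cq: "H1_loop N c" "H1_loop N q"
    obtain vc where c: "\<And>i. i < N \<Longrightarrow> L2_deriv 0 (2*pi) (c i) (vc i)" using cq(1) by (rule H1_loop_obtain_deriv) blast
    obtain vq where q: "\<And>i. i < N \<Longrightarrow> L2_deriv 0 (2*pi) (q i) (vq i)" using cq(2) by (rule H1_loop_obtain_deriv) blast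
    have per: "c 0 (2*pi) - q 0 (2*pi) = c 0 0 - q 0 0"
      using cq N unfolding H1_loop_iff by (metis add_0)
    have "H1_inner N (\<lambda>i t. c i t - q i t) p =
       (\<Sum>i<N. L2_inner (\<lambda>t. c i t - q i t) (p i) + L2_inner (\<lambda>t. vc i t - vq i t) (w i))"
      by (rule H1_inner_eq[OF L2_deriv_diff[OF c q] L])
    also have "\<dots> = (\<Sum>i<N. if i = 0 then (\<integral>t. (c 0 t - q 0 t) \<bullet> (P t *\<^sub>R e) \<partial>per_measure)
        + (\<integral>t. (vc 0 t - vq 0 t) \<bullet> (G' t *\<^sub>R e) \<partial>per_measure) else 0)"
      by (rule sum.cong) (auto simp: p_def w_def)
    also have "\<dots> = (\<integral>t. (c 0 t - q 0 t) \<bullet> (P t *\<^sub>R e) \<partial>per_measure) + (\<integral>t. (vc 0 t - vq 0 t) \<bullet> (G' t *\<^sub>R e) \<partial>per_measure)"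
      using N by simp
    also have "(\<integral>t. (c 0 t - q 0 t) \<bullet> (P t *\<^sub>R e) \<partial>per_measure) = (\<integral>t. (c 0 t - q 0 t) \<bullet> (G t *\<^sub>R e) \<partial>per_measure)"
      by (rule Bochner_Integration.integral_cong) (auto simp: PG space_restrict_space)
    also have "\<dots> + (\<integral>t. (vc 0 t - vq 0 t) \<bullet> (G' t *\<^sub>R e) \<partial>per_measure) = 2 * sinh pi * ((c 0 \<tau> - q 0 \<tau>) \<bullet> e)"
      by (rule Gr2[OF L2_deriv_diff[OF c q]]) (use N per in auto)
    finally show "H1_inner N (\<lambda>i t. c i t - q i t) p = 2 * sinh pi * ((c 0 \<tau> - q 0 \<tau>) \<bullet> e)" .
  qed
qed

text \<open>Closed inequalities survive weak closure: the functional evaluating the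
  \<open>y\<close>-component of \<open>q 0\<close> at the sign time is one admissible test. Zero
  values, such as those caused by collisions, may appear in the limit.\<close>

lemma Lambda_xi_sign:
  assumes q: "q \<in> Lambda_xi N \<xi>" and j: "1 \<le> j" "j \<le> N - 1"
  shows "\<xi> j * Im (fst (q 0 (real j * pi / real N))) \<ge> 0"
proof (rule ccontr)
  define \<tau> where "\<tau> = real j * pi / real N"
  assume "\<not> 0 \<le> \<xi> j * Im (fst (q 0 (real j * pi / real N)))"
  then have neg: "\<xi> j * Im (fst (q 0 \<tau>)) < 0" by (simp add: \<tau>_def)
  have N: "N > 0" using j by simp
  have "real j / real N < 1" using j by simp
  then have "\<tau> < 1 * pi" unfolding \<tau>_def using mult_strict_right_mono[of "real j / real N" 1 pi] by simp
  then have "\<tau> < 2 * pi" using pi_gt_zero by linarith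
  then have \<tau>: "0 < \<tau>" "\<tau> < 2*pi" using j by (auto simp: \<tau>_def)
  obtain p where p: "H1_loop N p"
    "\<And>c q. H1_loop N c \<Longrightarrow> H1_loop N q \<Longrightarrow>
       H1_inner N (\<lambda>i t. c i t - q i t) p = 2 * sinh pi * ((c 0 \<tau> - q 0 \<tau>) \<bullet> (\<i>, 0))"
    using H1_point_evaluation[OF N \<tau>] by blast
  \<comment> \<open>This radius keeps the imaginary part of an approximating loop within less than
    \<open>\<bar>Im (fst (q 0 \<tau>))\<bar>\<close> of that of \<open>q\<close>, so the two have
    the same sign.\<close>
  define \<epsilon> where "\<epsilon> = 2 * sinh pi * \<bar>Im (fst (q 0 \<tau>))\<bar>"
  have "Im (fst (q 0 \<tau>)) \<noteq> 0" using neg by auto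
  then have "\<epsilon> > 0" by (simp add: \<epsilon>_def)
  then obtain c where c: "c \<in> Lambda_DN N" "sign_vec N c = \<xi>" "\<bar>H1_inner N (\<lambda>i t. c i t - q i t) p\<bar> < \<epsilon>"
    using q p(1) unfolding Lambda_xi_def weak_closure_def
    by (auto dest!: spec[of _ "{p}"])
  have "2 * sinh pi * \<bar>Im (fst (c 0 \<tau>)) - Im (fst (q 0 \<tau>))\<bar> < 2 * sinh pi * \<bar>Im (fst (q 0 \<tau>))\<bar>"
    using c(3) p(2)[OF Lambda_DN_H1_loop[OF c(1)] Lambda_DN_H1_loop[OF Lambda_xi_subset[OF q]]]
    by (simp add: inner_prod_def inner_complex_def \<epsilon>_def abs_mult)
  then have lt: "\<bar>Im (fst (c 0 \<tau>)) - Im (fst (q 0 \<tau>))\<bar> < \<bar>Im (fst (q 0 \<tau>))\<bar>" by simp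
  have "\<xi> j = sgn (Im (fst (c 0 \<tau>)))"
    using fun_cong[OF c(2), of j] j by (simp add: sign_vec_def \<tau>_def)
  then show False using neg lt by (auto simp: sgn_if mult_less_0_iff split: if_splits)
qed

section \<open>Smooth loops and polygons\<close>

lemma int_dvd_diff_imp_eq:
  assumes "int N dvd int i - int j" "i < N" "j < N"
  shows "i = j"
  using assms by (metis mod_eq_dvd_iff mod_pos_pos_trivial of_nat_0_le_iff of_nat_eq_iff of_nat_less_iff)

lemma sin_multiple_pi_div_ne_0:
  assumes "\<not> int N dvd l" "N > 0"
  shows "sin (of_int l * pi / real N) \<noteq> 0"
proof
  assume "sin (of_int l * pi / real N) = 0"
  then obtain m where "of_int l * pi / real N = of_int m * pi" by (auto simp: sin_zero_iff_int2)
  then have "real_of_int l = real_of_int (m * int N)" using assms(2) by (simp add: field_simps)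
  then have "l = m * int N" by (simp only: of_int_eq_iff)
  then show False using assms(1) by simp
qed

text \<open>Coprimality prevents \<open>N\<close> from dividing \<open>k * j\<close>; so a rotating
  polygon has \<open>y\<close>-component different from 0 at every sign time.\<close>

lemma sin_coprime_ne_0:
  assumes "coprime k N" "1 \<le> j" "j \<le> N - 1"
  shows "sin (real k * (real j * pi / real N)) \<noteq> 0"
proof -
  have "\<not> int N dvd int (k * j)"
  proof
    assume "int N dvd int (k * j)"
    then have "N dvd k * j" by (simp only: int_dvd_int_iff)
    then have "N dvd j" using assms(1) by (simp add: coprime_commute coprime_dvd_mult_right_iff)
    then show False using assms(2,3) by (auto dest: dvd_imp_le)
  qed
  then show ?thesis using sin_multiple_pi_div_ne_0[of N "int (k * j)"] assms by (simp add: mult.assoc)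
qed

lemma cis_coprime_inj_on:
  assumes k: "coprime k N"
  shows "inj_on (\<lambda>i. cis (- 2 * pi * real k * real i / real N)) {..<N}"
proof (rule inj_onI)
  fix i j assume ij: "i \<in> {..<N}" "j \<in> {..<N}"
    and eq: "cis (- 2 * pi * real k * real i / real N) = cis (- 2 * pi * real k * real j / real N)"
  have N: "N > 0" using ij by auto
  define x where "x = 2 * pi * real k * (real j - real i) / real N"
  have "cis x = cis (- 2 * pi * real k * real i / real N) / cis (- 2 * pi * real k * real j / real N)"
    unfolding cis_divide by (rule arg_cong[of _ _ cis]) (simp add: x_def diff_divide_distrib algebra_simps)
  then have "cis x = 1" using eq by simp
  then have "cos x = 1" by (metis Re_complex_of_real cis.sel(1) of_real_1)
  then obtain n :: int where "x = of_int n * 2 * pi" unfolding cos_one_2pi_int by blast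
  then have "2 * pi * (real k * (real j - real i)) = 2 * pi * (of_int n * real N)" using N by (simp add: x_def field_simps)
  then have "real k * (real j - real i) = of_int n * real N" by simp
  then have "real_of_int (int k * (int j - int i)) = real_of_int (n * int N)" by simp
  then have "int k * (int j - int i) = n * int N" by (simp only: of_int_eq_iff)
  then have "int N dvd int k * (int j - int i)" by simp
  then have "int N dvd int j - int i"
    using k by (simp add: coprime_commute coprime_dvd_mult_right_iff)
  then show "i = j" using int_dvd_diff_imp_eq[of N j i] ij by auto
qed

text \<open>One curve generates the whole choreography: all masses are its time shifts, so
  periodicity and reflection are checked for \<open>f\<close> alone.\<close>

lemma C1_loop_in_Lambda_DN:
  fixes f :: "real \<Rightarrow> complex \<times> real"
  assumes f: "\<And>t. (f has_vector_derivative f' t) (at t)" and f': "continuous_on UNIV f'"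
    and per: "\<And>t. f (t + 2*pi) = f t" and refl: "\<And>t. f (2*pi - t) = Rxz (f t)"
  shows "(\<lambda>i t. f (t + 2*pi * real i / real N)) \<in> Lambda_DN N"
proof -
  have "L2_deriv 0 (2*pi) (\<lambda>t. f (t + c)) (\<lambda>t. f' (t + c))" for c
  proof -
    have c: "continuous_on {0..2*pi} (\<lambda>t. f' (t + c))"
      by (intro continuous_on_compose2[OF f'] continuous_intros) auto
    then have "bounded ((\<lambda>t. f' (t + c)) ` {0..2*pi})"
      by (intro compact_imp_bounded compact_continuous_image) auto
    then obtain B where B: "\<And>t. t \<in> {0..2*pi} \<Longrightarrow> norm (f' (t + c)) \<le> B" by (metis bounded_iff image_eqI)
    have d: "((\<lambda>t. f (t + c)) has_vector_derivative f' (t + c)) (at t)" for t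
    proof -
      have "((\<lambda>t. t + c) has_vector_derivative 1 + 0) (at t)"
        by (intro has_vector_derivative_add has_vector_derivative_id has_vector_derivative_const)
      from vector_diff_chain_at[OF this f] show ?thesis by (simp add: o_def)
    qed
    show ?thesis
    proof (rule L2_deriv_C1[of "{}", OF _ _ _ _ _ B])
      show "continuous_on {0..2*pi} (\<lambda>t. f (t + c))"
        using d by (meson continuous_on_vector_derivative has_vector_derivative_at_within)
      show "(\<lambda>t. f' (t + c)) \<in> borel_measurable per_measure"
        using c by (rule continuous_imp_measurable_on_sets_lebesgue) simp
    qed (use d in auto)
  qed
  moreover have "f (t + 2*pi + c) = f (t + c)" for t c using per[of "t + c"] by (simp add: algebra_simps)
  ultimately show ?thesis
    using refl by (auto simp: Lambda_DN_def H1_loop_iff)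
qed

section \<open>Sign vectors and radius of the rotating polygons\<close>

text \<open>Closed form of \<open>xi_Ngon\<close>, justified in \<open>xi_Ngon_eq\<close>. Under the
  clockwise rotation mass 0 has \<open>y\<close>-component a positive multiple of
  \<open>- s * sin (k * t)\<close>.\<close>

definition pol_sign :: "nat \<Rightarrow> nat \<Rightarrow> real \<Rightarrow> nat \<Rightarrow> real" where
  "pol_sign N k s j = (if 1 \<le> j \<and> j \<le> N - 1 then - s * sgn (sin (real k * (real j * pi / real N))) else 0)"

lemma rot_loop_polygon:
  "rot_loop k lam (polygon N k s r) = (\<lambda>i t. (complex_of_real (lam * s * r) * cis (- real k * (t + 2*pi * real i / real N)), 0))"
proof (intro ext)
  fix i t
  have "cis (- real k * t) * cis (- 2 * pi * real k * real i / real N) = cis (- real k * (t + 2*pi * real i / real N))"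
    unfolding cis_mult by (rule arg_cong[of _ _ cis]) (simp add: field_simps)
  then show "rot_loop k lam (polygon N k s r) i t = (complex_of_real (lam * s * r) * cis (- real k * (t + 2*pi * real i / real N)), 0)"
    by (simp add: rot_loop_def rot_def polygon_def scaleR_conv_of_real mult_ac)
qed

lemma polygon_collision_free:
  assumes k: "coprime k N" and c: "c \<noteq> 0"
  shows "collision_free N (\<lambda>i t. (complex_of_real c * cis (- real k * (t + 2*pi * real i / real N)), 0))"
  unfolding collision_free_def
proof (intro allI impI)
  fix t i j assume ij: "i < N" "j < N" "i \<noteq> j"
  have *: "cis (- real k * (t + 2*pi * real i / real N)) = cis (- real k * t) * cis (- 2 * pi * real k * real i / real N)" for i
    unfolding cis_mult by (rule arg_cong[of _ _ cis]) (simp add: field_simps)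
  have "cis (- 2 * pi * real k * real i / real N) \<noteq> cis (- 2 * pi * real k * real j / real N)"
    using cis_coprime_inj_on[OF k] ij by (auto simp: inj_on_def)
  then show "(complex_of_real c * cis (- real k * (t + 2*pi * real i / real N)), 0::real)
      \<noteq> (complex_of_real c * cis (- real k * (t + 2*pi * real j / real N)), 0)"
    unfolding * using c by simp
qed

lemma rot_loop_polygon_in_Lambda_xi:
  assumes N: "N \<ge> 2" and k: "coprime k N" and s: "s \<in> {1, -1}" and lam: "lam > 0" and r: "r > 0"
  shows "rot_loop k lam (polygon N k s r) \<in> Lambda_xi N (pol_sign N k s)"
proof (rule Lambda_xiI)
  define f where "f = (\<lambda>t. (complex_of_real (lam * s * r) * cis (- real k * t), 0::real))"
  have e: "rot_loop k lam (polygon N k s r) = (\<lambda>i t. f (t + 2*pi * real i / real N))"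
    unfolding rot_loop_polygon f_def ..
  have c2: "cis (2 * pi * real k) = 1" using cis_multiple_2pi[of "real k"] by simp
  show "rot_loop k lam (polygon N k s r) \<in> Lambda_DN N"
    unfolding e
  proof (rule C1_loop_in_Lambda_DN[where f' = "\<lambda>t. (complex_of_real (lam * s * r) * ((- real k) *\<^sub>R (\<i> * cis (- real k * t))), 0::real)"])
    fix t
    have "((\<lambda>t. cis (- real k * t)) has_vector_derivative ((- real k) *\<^sub>R (\<i> * cis (- real k * t)))) (at t)"
      by (auto intro!: derivative_eq_intros simp: has_vector_derivative_def)
    then show "(f has_vector_derivative (complex_of_real (lam * s * r) * ((- real k) *\<^sub>R (\<i> * cis (- real k * t))), 0)) (at t)"
      unfolding f_def by (intro has_vector_derivative_Pair has_vector_derivative_mult_right has_vector_derivative_const)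
    have "cis (- real k * (t + 2*pi)) = cis (- real k * t) / cis (2 * pi * real k)"
      unfolding cis_divide by (simp add: algebra_simps)
    then show "f (t + 2*pi) = f t" by (simp add: f_def c2)
    have "cis (- real k * (2*pi - t)) = cis (real k * t) / cis (2 * pi * real k)"
      unfolding cis_divide by (simp add: algebra_simps)
    then show "f (2*pi - t) = Rxz (f t)" by (simp add: f_def Rxz_def c2 cis_cnj)
  qed (intro continuous_intros)
  show "collision_free N (rot_loop k lam (polygon N k s r))"
    unfolding rot_loop_polygon by (rule polygon_collision_free[OF k]) (use s lam r in auto)
  show "sign_vec N (rot_loop k lam (polygon N k s r)) = pol_sign N k s"
  proof
    fix j
    have "lam * r > 0" using lam r by simp
    then have "sgn (lam * s * r * x) = s * sgn x" for x
      using s lam r by (auto simp: sgn_mult)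
    then show "sign_vec N (rot_loop k lam (polygon N k s r)) j = pol_sign N k s j"
      unfolding rot_loop_polygon by (simp add: sign_vec_def pol_sign_def sgn_minus)
  qed
qed

lemma pol_sign_in_Xi:
  assumes k: "coprime k N" and s: "s \<in> {1, -1}"
  shows "pol_sign N k s \<in> Xi N"
  using s sin_coprime_ne_0[OF k] by (auto simp: Xi_def pol_sign_def sgn_if)

text \<open>By coprimality the vertices run through all \<open>N\<close>-th roots of unity, and
  dividing by one root permutes them. So the force on each mass is the same multiple of its
  position, and conjugation makes this multiple real, equal to \<open>- \<sigma> / r ^ 3\<close>.
  Rotation at unit speed has acceleration minus the position, which leaves
  \<open>r ^ 3 = \<sigma>\<close>.\<close>

lemma polygon_newton_sol_iff:
  assumes N: "N \<ge> 2" and k: "coprime k N" and s: "s \<in> {1, -1}"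
  obtains \<sigma> where "\<sigma> > 0"
    "\<And>r. r > 0 \<Longrightarrow> newton_sol N (\<lambda>i t. rot t (polygon N k s r) i) \<longleftrightarrow> r ^ 3 = \<sigma>"
proof -
  define z where "z = (\<lambda>i. cis (- 2 * pi * real k * real i / real N))"
  define R where "R = {w::complex. w ^ N = 1}"
  have N0: "N > 0" using N by simp
  have inj: "inj_on z {..<N}" unfolding z_def by (rule cis_coprime_inj_on[OF k])
  have zR: "z i \<in> R" for i
  proof -
    have "z i ^ N = cis (real N * (- 2 * pi * real k * real i / real N))" unfolding z_def by (rule Complex.DeMoivre)
    also have "real N * (- 2 * pi * real k * real i / real N) = 2 * pi * real_of_int (- int (k * i))" using N0 by simp
    also have "cis \<dots> = 1" by (rule cis_multiple_2pi) simp
    finally show ?thesis by (simp add: R_def)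
  qed
  have finR: "finite R" unfolding R_def using N0 by (intro finite_roots_unity) auto
  have "card (z ` {..<N}) = card R" using card_image[OF inj] card_roots_unity_eq[OF N0] by (simp add: R_def)
  then have img: "z ` {..<N} = R" using finR zR by (intro card_subset_eq) auto
  have bij: "bij_betw z {..<N} R" using inj img by (simp add: bij_betw_def)
  \<comment> \<open>At \<open>w = 1\<close> this is 0, so the term of a mass with itself can be
    included and sums run over all roots.\<close>
  define g where "g = (\<lambda>w. (w - 1) / complex_of_real (cmod (w - 1) ^ 3))"
  define \<gamma> where "\<gamma> = (\<Sum>w\<in>R. g w)"
  have normz: "cmod (z i) = 1" for i by (simp add: z_def)
  then have z0: "z i \<noteq> 0" for i by (metis norm_zero zero_neq_one)
  have Rn: "cmod w = 1" if "w \<in> R" for w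
  proof -
    have "w \<in> z ` {..<N}" using that img by simp
    then show ?thesis using normz by auto
  qed
  have shift: "(\<Sum>j<N. g (z j / z i)) = \<gamma>" for i
  proof -
    have "(\<Sum>j<N. g (z j / z i)) = (\<Sum>w\<in>R. g (w / z i))" by (rule sum.reindex_bij_betw[OF bij])
    also have "\<dots> = (\<Sum>w\<in>R. g w)"
    proof (rule sum.reindex_bij_betw)
      show "bij_betw (\<lambda>w. w / z i) R R"
        by (rule bij_betw_byWitness[where f' = "\<lambda>w. w * z i"])
          (use zR[of i] z0 in \<open>auto simp: R_def power_divide power_mult_distrib\<close>)
    qed
    finally show ?thesis by (simp add: \<gamma>_def)
  qed
  have gc: "g (cnj w) = cnj (g w)" for w
  proof -
    have "cmod (cnj w - 1) = cmod (w - 1)" by (metis complex_cnj_diff complex_cnj_one complex_mod_cnj)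
    then show ?thesis by (simp add: g_def)
  qed
  have "(\<Sum>w\<in>R. g (cnj w)) = (\<Sum>w\<in>R. g w)"
    by (rule sum.reindex_bij_betw, rule bij_betw_byWitness[where f' = cnj])
      (auto simp: R_def simp flip: complex_cnj_power)
  then have "cnj \<gamma> = \<gamma>" by (simp add: \<gamma>_def gc)
  then have "Im \<gamma> = 0" by (metis complex_cnj_cancel_iff Reals_cnj_iff complex_is_Real_iff)
  \<comment> \<open>Every summand is nonnegative because roots of unity have real part at most 1,
    and the summand of \<open>z 1\<close>, which differs from 1 as \<open>N \<ge> 2\<close>, is
    positive.\<close>
  define \<sigma> where "\<sigma> = (\<Sum>w\<in>R. (1 - Re w) / cmod (w - 1) ^ 3)"
  have "Re (g w) = - ((1 - Re w) / cmod (w - 1) ^ 3)" for w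
    unfolding g_def by (simp add: Re_divide_of_real diff_divide_distrib)
  then have "Re \<gamma> = - \<sigma>" by (simp add: \<gamma>_def \<sigma>_def sum_negf)
  then have \<gamma>: "\<gamma> = - complex_of_real \<sigma>" using \<open>Im \<gamma> = 0\<close> by (simp add: complex_eq_iff)
  have Re1: "Re w \<le> 1" if "w \<in> R" for w using complex_Re_le_cmod[of w] Rn[OF that] by simp
  have "z 0 \<noteq> z 1" using inj_onD[OF inj, of 0 1] N by auto
  moreover have "z 0 = 1" by (simp add: z_def)
  ultimately have z1: "z 1 \<noteq> 1" by auto
  have "Re (z 1) \<noteq> 1"
  proof
    assume "Re (z 1) = 1"
    moreover from this have "Im (z 1) = 0" using normz[of 1] cmod_power2[of "z 1"] by simp
    ultimately show False using z1 by (simp add: complex_eq_iff)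
  qed
  then have "(1 - Re (z 1)) / cmod (z 1 - 1) ^ 3 > 0" using Re1[OF zR[of 1]] z1 by simp
  moreover have "(1 - Re (z 1)) / cmod (z 1 - 1) ^ 3 \<le> \<sigma>"
    unfolding \<sigma>_def using Re1 zR[of 1] finR by (intro member_le_sum) auto
  ultimately have \<sigma>: "\<sigma> > 0" by linarith
  have force: "(\<Sum>j\<in>{..<N} - {i}. (1 / (norm (rot t (polygon N k s r) j - rot t (polygon N k s r) i)) ^ 3) *\<^sub>R
      (rot t (polygon N k s r) j - rot t (polygon N k s r) i))
      = (- (\<sigma> / r ^ 3)) *\<^sub>R rot t (polygon N k s r) i" (is "?S = ?T") if r: "r > 0" and i: "i < N" for r t i
  proof -
    have x: "rot t (polygon N k s r) j = (cis t * (complex_of_real (s * r) * z j), 0)" for j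
      by (simp add: rot_def polygon_def z_def)
    have trm: "(1 / (norm (rot t (polygon N k s r) j - rot t (polygon N k s r) i)) ^ 3) *\<^sub>R
      (rot t (polygon N k s r) j - rot t (polygon N k s r) i)
      = (cis t * complex_of_real (s * r) * complex_of_real (1 / r ^ 3) * z i * g (z j / z i), 0)" for j
    proof -
      have d: "rot t (polygon N k s r) j - rot t (polygon N k s r) i = (cis t * complex_of_real (s * r) * z i * (z j / z i - 1), 0)"
        unfolding x using z0[of i] by (simp add: algebra_simps)
      have n: "norm (rot t (polygon N k s r) j - rot t (polygon N k s r) i) = r * cmod (z j / z i - 1)"
        unfolding d using s r by (auto simp: norm_Pair norm_mult normz)
      show ?thesis
        unfolding n unfolding d
        by (simp add: g_def power_mult_distrib scaleR_conv_of_real divide_inverse mult_ac)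
    qed
    have "?S = (\<Sum>j\<in>{..<N} - {i}. (cis t * complex_of_real (s * r) * complex_of_real (1 / r ^ 3) * z i * g (z j / z i), 0))"
      unfolding trm ..
    also have "\<dots> = (\<Sum>j<N. (cis t * complex_of_real (s * r) * complex_of_real (1 / r ^ 3) * z i * g (z j / z i), 0))"
      by (rule sum.mono_neutral_left) (use z0 in \<open>auto simp: g_def zero_prod_def\<close>)
    also have "\<dots> = (cis t * complex_of_real (s * r) * complex_of_real (1 / r ^ 3) * z i * (\<Sum>j<N. g (z j / z i)), 0)"
      by (simp add: prod_eq_iff fst_sum snd_sum sum_distrib_left)
    also have "\<dots> = ?T" unfolding shift \<gamma> x by (simp add: scaleR_conv_of_real mult_ac)
    finally show ?thesis .
  qed
  show ?thesis
  proof (rule that[OF \<sigma>])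
    fix r :: real assume r: "r > 0"
    define x where "x = (\<lambda>i t. rot t (polygon N k s r) i)"
    define v where "v = (\<lambda>i t. (\<i> * cis t * (complex_of_real (s * r) * z i), 0::real))"
    have x_eq: "x i = (\<lambda>t. (cis t * (complex_of_real (s * r) * z i), 0))" for i
      by (simp add: x_def rot_def polygon_def z_def)
    have cd: "(cis has_vector_derivative (\<i> * cis t)) (at t)" for t
      by (auto intro!: derivative_eq_intros simp: has_vector_derivative_def)
    have xv: "(x i has_vector_derivative v i t) (at t)" for i t
      unfolding x_eq v_def by (intro has_vector_derivative_Pair has_vector_derivative_mult_left has_vector_derivative_const cd)
    have vx: "(v i has_vector_derivative - x i t) (at t)" for i t
    proof -
      have "(v i has_vector_derivative (\<i> * (\<i> * cis t) * (complex_of_real (s * r) * z i), 0)) (at t)"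
        unfolding v_def
        by (intro has_vector_derivative_Pair has_vector_derivative_mult_left has_vector_derivative_mult_right has_vector_derivative_const cd)
      moreover have "(\<i> * (\<i> * cis t) * (complex_of_real (s * r) * z i), 0) = - x i t"
        by (simp add: x_eq flip: mult.assoc)
      ultimately show ?thesis by simp
    qed
    have x0: "x i t \<noteq> 0" for i t using s r z0 by (auto simp: x_eq zero_prod_def)
    show "newton_sol N (\<lambda>i t. rot t (polygon N k s r) i) \<longleftrightarrow> r ^ 3 = \<sigma>"
    proof
      assume "newton_sol N (\<lambda>i t. rot t (polygon N k s r) i)"
      from this[unfolded newton_sol_def, rule_format, OF N0]
      obtain v' where "\<And>t. ((\<lambda>t. rot t (polygon N k s r) 0) has_vector_derivative v' t) (at t) \<and>
        (v' has_vector_derivative ((- (\<sigma> / r ^ 3)) *\<^sub>R rot t (polygon N k s r) 0)) (at t)"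
        unfolding force[OF r N0] by blast
      then have v': "\<And>t. (x 0 has_vector_derivative v' t) (at t)"
        "\<And>t. (v' has_vector_derivative ((- (\<sigma> / r ^ 3)) *\<^sub>R x 0 t)) (at t)"
        unfolding x_def by blast+
      have "v' = v 0" using vector_derivative_unique_at[OF v'(1) xv] by blast
      then have "(- (\<sigma> / r ^ 3)) *\<^sub>R x 0 0 = - x 0 0"
        using vector_derivative_unique_at[OF v'(2) vx[of 0, folded \<open>v' = v 0\<close>], of 0] by simp
      then have "(\<sigma> / r ^ 3) *\<^sub>R x 0 0 = 1 *\<^sub>R x 0 0" by simp
      then have "\<sigma> / r ^ 3 = 1" using x0[of 0 0] by (simp only: scaleR_right_imp_eq)
      then show "r ^ 3 = \<sigma>" using r by (simp add: field_simps)
    next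
      assume "r ^ 3 = \<sigma>"
      then have one: "\<sigma> / r ^ 3 = 1" using \<sigma> by simp
      show "newton_sol N (\<lambda>i t. rot t (polygon N k s r) i)"
        unfolding newton_sol_def
      proof (intro allI impI)
        fix i assume "i < N"
        then show "\<exists>v. \<forall>t. ((\<lambda>t. rot t (polygon N k s r) i) has_vector_derivative v t) (at t) \<and>
           (v has_vector_derivative (\<Sum>j\<in>{..<N} - {i}. (1 / (norm (rot t (polygon N k s r) j - rot t (polygon N k s r) i)) ^ 3) *\<^sub>R
             (rot t (polygon N k s r) j - rot t (polygon N k s r) i))) (at t)"
          using xv[of i] vx[of i] force[OF r, of i] one by (intro exI[of _ "v i"]) (simp add: x_def)
      qed
    qed
  qed
qed

text \<open>The cube is injective on positive reals, so the description in \<open>Ngon\<close> has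
  exactly one solution, the cube root of \<sigma>.\<close>

lemma Ngon_eq_polygon:
  assumes "N \<ge> 2" "coprime k N" "s \<in> {1, -1}"
  obtains r where "r > 0" "Ngon N k s = polygon N k s r"
proof -
  obtain \<sigma> where \<sigma>: "\<sigma> > 0" "\<And>r. r > 0 \<Longrightarrow> newton_sol N (\<lambda>i t. rot t (polygon N k s r) i) \<longleftrightarrow> r ^ 3 = \<sigma>"
    using polygon_newton_sol_iff[OF assms] by blast
  have "(THE r. r > 0 \<and> newton_sol N (\<lambda>i t. rot t (polygon N k s r) i)) = root 3 \<sigma>"
    using \<sigma> by (intro the_equality) (auto simp: real_root_pos_pos_le real_root_power_cancel)
  then show ?thesis using that[of "root 3 \<sigma>"] \<sigma>(1) by (simp add: Ngon_def)
qed

text \<open>Uniqueness rests on \<open>Lambda_xi_sign\<close>: the \<open>y\<close>-components of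
  the polygon loop are not 0 at the sign times, so the closed inequalities already determine every
  entry of \<xi>.\<close>

lemma xi_Ngon_eq:
  assumes N: "N \<ge> 2" and k: "coprime k N" and s: "s \<in> {1, -1}"
  shows "xi_Ngon N k s = pol_sign N k s"
proof -
  obtain r where r: "r > 0" "Ngon N k s = polygon N k s r" using Ngon_eq_polygon[OF assms] .
  show ?thesis
    unfolding xi_Ngon_def r(2)
  proof (rule the_equality)
    show "pol_sign N k s \<in> Xi N \<and> (\<forall>lam>0. rot_loop k lam (polygon N k s r) \<in> Lambda_xi N (pol_sign N k s))"
      using pol_sign_in_Xi[OF k s] rot_loop_polygon_in_Lambda_xi[OF N k s _ r(1)] by blast
    fix \<xi> assume \<xi>: "\<xi> \<in> Xi N \<and> (\<forall>lam>0. rot_loop k lam (polygon N k s r) \<in> Lambda_xi N \<xi>)"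
    then have m: "rot_loop k 1 (polygon N k s r) \<in> Lambda_xi N \<xi>" by simp
    show "\<xi> = pol_sign N k s"
    proof
      fix j
      show "\<xi> j = pol_sign N k s j"
      proof (cases "1 \<le> j \<and> j \<le> N - 1")
        case True
        then have "\<xi> j * (- s * r * sin (real k * (real j * pi / real N))) \<ge> 0"
          using Lambda_xi_sign[OF m, of j] unfolding rot_loop_polygon by simp
        moreover have "sin (real k * (real j * pi / real N)) \<noteq> 0" using sin_coprime_ne_0[OF k] True by simp
        moreover have "\<xi> j \<in> {-1, 1}" using \<xi> True by (simp add: Xi_def)
        ultimately show ?thesis using s r(1) True
          by (auto simp: pol_sign_def sgn_if zero_le_mult_iff mult_le_0_iff)
      next
        case False
        then show ?thesis using \<xi> by (auto simp: Xi_def pol_sign_def)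
      qed
    qed
  qed
qed

section \<open>Every class contains a loop of mean height 0\<close>

text \<open>Newton's scheme: a new node is accommodated by adding a multiple of the polynomial
  vanishing at the old nodes.\<close>

lemma poly_interpolation:
  fixes x y :: "'i \<Rightarrow> real"
  assumes "finite J" "inj_on x J"
  obtains P where "\<And>j. j \<in> J \<Longrightarrow> poly P (x j) = y j"
proof -
  have "\<exists>P. \<forall>j\<in>J. poly P (x j) = y j"
    using assms
  proof (induction J rule: finite_induct)
    case (insert a J)
    then obtain P where P: "\<forall>j\<in>J. poly P (x j) = y j" by auto
    define Q where "Q = (\<Prod>j\<in>J. [:- x j, 1:])"
    have Q0: "poly Q (x j) = 0" if "j \<in> J" for j
      using that insert.hyps(1) by (auto simp: Q_def poly_prod)
    have "poly Q (x a) \<noteq> 0"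
      using insert.hyps insert.prems by (auto simp: Q_def poly_prod inj_on_def)
    then have "\<forall>j\<in>insert a J. poly (P + smult ((y a - poly P (x a)) / poly Q (x a)) Q) (x j) = y j"
      using P Q0 by auto
    then show ?case by blast
  qed simp
  then show ?thesis using that by blast
qed

text \<open>Reduction modulo \<open>2 * N\<close> and reflection at \<open>N\<close>. It shows that
  the possible collision abscissae of the loop built next are interpolation nodes.\<close>

lemma cos_multiple_pi_div:
  assumes N: "N > 0" and l: "\<not> int N dvd l"
  obtains j where "1 \<le> j" "j \<le> N - 1" "cos (of_int l * pi / real N) = cos (real j * pi / real N)"
proof -
  define m where "m = l mod (2 * int N)"
  have m: "0 \<le> m" "m < 2 * int N" using N by (auto simp: m_def)
  have nd: "\<not> int N dvd m" using l unfolding m_def by (simp add: dvd_mod_iff)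
  have "l = m + 2 * int N * (l div (2 * int N))" by (simp add: m_def)
  then have "real_of_int l = real_of_int (m + 2 * int N * (l div (2 * int N)))" by (rule arg_cong)
  then have "real_of_int l = of_int m + 2 * real N * of_int (l div (2 * int N))" by simp
  then have "of_int l * pi / real N = of_int m * pi / real N + 2 * pi * of_int (l div (2 * int N))"
    using N by (simp add: field_simps)
  then have c: "cos (of_int l * pi / real N) = cos (of_int m * pi / real N)"
    by (simp add: cos_add sin_int_2pin cos_int_2pin)
  have "m \<noteq> 0" "m \<noteq> int N" using nd by auto
  show ?thesis
  proof (cases "m < int N")
    case True
    then show ?thesis using that[of "nat m"] c m \<open>m \<noteq> 0\<close> by auto
  next
    case False
    have "of_int m * pi / real N = 2 * pi - real (nat (2 * int N - m)) * pi / real N"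
      using N m by (simp add: field_simps)
    then have "cos (of_int m * pi / real N) = cos (real (nat (2 * int N - m)) * pi / real N)"
      by (simp only: cos_2pi_minus)
    then show ?thesis using that[of "nat (2 * int N - m)"] c m False \<open>m \<noteq> int N\<close> by auto
  qed
qed

text \<open>The planar curve with coordinates \<open>cos t\<close> and
  \<open>sin t * poly P (cos t)\<close>, where \<open>P\<close> takes the value
  \<open>\<xi> j\<close> at \<open>cos (j * pi / N)\<close>. Two masses with equal abscissa sit at
  opposite times modulo \<open>2*pi\<close>, hence have opposite ordinates; the time is then a
  multiple of \<open>pi / N\<close> where the ordinate is not 0, so they do not collide.\<close>

lemma Lambda_xi_nonempty:
  assumes N: "N \<ge> 2" and \<xi>: "\<xi> \<in> Xi N"
  obtains q where "q \<in> Lambda_xi N \<xi>" "mean_z0 q = 0"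
proof -
  have N0: "N > 0" using N by simp
  have lt: "real j * pi / real N < pi" if "j \<in> {1..N-1}" for j
  proof -
    have "j < N" using that N0 by auto
    then show ?thesis by (simp add: field_simps)
  qed
  have "inj_on (\<lambda>j. cos (real j * pi / real N)) {1..N-1}"
  proof (rule inj_onI)
    fix i j assume ij: "i \<in> {1..N-1}" "j \<in> {1..N-1}" "cos (real i * pi / real N) = cos (real j * pi / real N)"
    have "real i * pi / real N = real j * pi / real N"
      by (rule cos_inj_pi) (use ij lt[of i] lt[of j] in \<open>auto intro: less_imp_le\<close>)
    then show "i = j" using N0 by simp
  qed
  then obtain P where P: "\<And>j. j \<in> {1..N-1} \<Longrightarrow> poly P (cos (real j * pi / real N)) = \<xi> j"
    by (rule poly_interpolation[OF finite_atLeastAtMost, where y = \<xi>]) blast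
  define f where "f = (\<lambda>t. (complex_of_real (cos t) + \<i> * complex_of_real (sin t * poly P (cos t)), 0::real))"
  define f' where "f' = (\<lambda>t. (complex_of_real (- sin t) + \<i> * complex_of_real (cos t * poly P (cos t) + sin t * (poly (pderiv P) (cos t) * (- sin t))), 0::real))"
  define q where "q = (\<lambda>(i::nat) t. f (t + 2*pi * real i / real N))"
  have nz: "\<xi> j \<noteq> 0" if "j \<in> {1..N-1}" for j using \<xi> that by (force simp: Xi_def)
  have "q \<in> Lambda_xi N \<xi>"
  proof (rule Lambda_xiI)
    show "q \<in> Lambda_DN N"
      unfolding q_def
    proof (rule C1_loop_in_Lambda_DN)
      fix t
      have 1: "(cos has_real_derivative (- sin t)) (at t)"
        by (auto intro!: derivative_eq_intros)
      have "((\<lambda>t. poly P (cos t)) has_real_derivative poly (pderiv P) (cos t) * (- sin t)) (at t)"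
        by (rule DERIV_chain2[OF poly_DERIV]) (auto intro!: derivative_eq_intros)
      then have 2: "((\<lambda>t. sin t * poly P (cos t)) has_real_derivative (cos t * poly P (cos t) + sin t * (poly (pderiv P) (cos t) * (- sin t)))) (at t)"
        by (auto intro!: derivative_eq_intros)
      show "(f has_vector_derivative f' t) (at t)"
        unfolding f_def f'_def
        by (intro has_vector_derivative_Pair has_vector_derivative_add has_vector_derivative_mult_right
            has_vector_derivative_of_real has_vector_derivative_const 1 2)
      show "f (t + 2*pi) = f t" by (simp add: f_def)
      show "f (2*pi - t) = Rxz (f t)" by (simp add: f_def Rxz_def cos_diff sin_diff)
    next
      show "continuous_on UNIV f'" unfolding f'_def by (intro continuous_intros)
    qed
    show "collision_free N q"
      unfolding collision_free_def
    proof (intro allI impI notI)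
      fix t i j assume ij: "i < N" "j < N" "i \<noteq> j" and eq: "q i t = q j t"
      define a b where "a = t + 2*pi * real i / real N" and "b = t + 2*pi * real j / real N"
      have ab: "a - b = 2 * pi * (real i - real j) / real N" by (simp add: a_def b_def diff_divide_distrib algebra_simps)
      have ca: "cos a = cos b" and sa: "sin a * poly P (cos a) = sin b * poly P (cos b)"
        using eq by (auto simp: q_def f_def a_def b_def complex_eq_iff)
      have nd: "\<not> int N dvd int i - int j" using int_dvd_diff_imp_eq[of N i j] ij by auto
      from ca obtain n where n: "n \<in> \<int>" "a = b + 2 * n * pi \<or> a = - b + 2 * n * pi" unfolding cos_eq by blast
      then obtain m :: int where m: "n = of_int m" by (auto elim: Ints_cases)
      from n(2) show False
      proof
        assume "a = b + 2 * n * pi"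
        then have "2 * pi * (real i - real j) = 2 * pi * (of_int m * real N)" using ab N0 m by (simp add: field_simps)
        then have "real i - real j = of_int m * real N" by simp
        then have "real_of_int (int i - int j) = real_of_int (m * int N)" by simp
        then have "int i - int j = m * int N" by (simp only: of_int_eq_iff)
        then show False using nd by simp
      next
        \<comment> \<open>Adding \<open>a + b = 2 * n * pi\<close> and the known difference
          \<open>a - b\<close> places \<open>a\<close> on the grid of multiples of
          \<open>pi / N\<close>, off the multiples of \<open>pi\<close> because \<open>i\<close> and
          \<open>j\<close> differ.\<close>
        assume *: "a = - b + 2 * n * pi"
        define l where "l = m * int N + (int i - int j)"
        have "b = 2 * pi * of_int m - a" using * m by simp
        then have "sin b = - sin a" by (simp add: sin_diff sin_int_2pin cos_int_2pin)
        then have z: "sin a = 0 \<or> poly P (cos a) = 0" using sa ca by auto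
        have "2 * a = 2 * n * pi + (a - b)" using * by simp
        then have al: "a = of_int l * pi / real N" unfolding ab using N0 m by (simp add: l_def field_simps)
        have nl: "\<not> int N dvd l" using nd by (simp add: l_def)
        have "sin a \<noteq> 0" unfolding al by (rule sin_multiple_pi_div_ne_0[OF nl N0])
        moreover obtain j' where "1 \<le> j'" "j' \<le> N - 1" "cos a = cos (real j' * pi / real N)"
          unfolding al using cos_multiple_pi_div[OF N0 nl] .
        then have "poly P (cos a) \<noteq> 0" using P[of j'] nz[of j'] by simp
        ultimately show False using z by simp
      qed
    qed
    show "sign_vec N q = \<xi>"
    proof
      fix j
      show "sign_vec N q j = \<xi> j"
      proof (cases "1 \<le> j \<and> j \<le> N - 1")
        case True
        then have "sin (real j * pi / real N) > 0"
          using lt[of j] N0 by (intro sin_gt_zero) auto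
        moreover have "\<xi> j \<in> {-1, 1}" using \<xi> True by (simp add: Xi_def)
        ultimately show ?thesis using True P[of j]
          by (auto simp: sign_vec_def q_def f_def sgn_mult)
      next
        case False
        then show ?thesis using \<xi> by (auto simp: sign_vec_def Xi_def)
      qed
    qed
  qed
  moreover have "mean_z0 q = 0" by (simp add: mean_z0_def q_def f_def)
  ultimately show ?thesis by (rule that)
qed

section \<open>The action\<close>

text \<open>In \<open>ennreal\<close> the inverse of 0 is \<open>top\<close>, so collisions need no
  case distinction, and continuity of the inverse makes the potential converge along every
  convergent sequence of configurations.\<close>

definition potential :: "nat \<Rightarrow> config \<Rightarrow> ennreal" where
  "potential N c = (\<Sum>i<N. \<Sum>j\<in>{i<..<N}. inverse (ennreal (norm (c i - c j))))"

lemma potential_eq: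
  "potential N c = (if \<exists>i<N. \<exists>j<N. i \<noteq> j \<and> c i = c j then top
     else ennreal (\<Sum>i<N. \<Sum>j\<in>{i<..<N}. 1 / norm (c i - c j)))"
proof (cases "\<exists>i<N. \<exists>j<N. i \<noteq> j \<and> c i = c j")
  case True
  then obtain i j where ij: "i < j" "j < N" "c i = c j" by (metis linorder_neqE_nat)
  have "inverse (ennreal (norm (c i - c j))) \<le> (\<Sum>j\<in>{i<..<N}. inverse (ennreal (norm (c i - c j))))"
    using ij by (intro member_le_sum) auto
  also have "\<dots> \<le> potential N c"
    unfolding potential_def using ij by (intro member_le_sum[of i]) auto
  finally have "potential N c = top" using ij(3) by (simp add: top_unique)
  then show ?thesis unfolding if_P[OF True] .
next
  case False
  have pos: "norm (c i - c j) > 0" if "i < N" "j \<in> {i<..<N}" for i j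
  proof -
    have "i \<noteq> j" "i < N" "j < N" using that by auto
    then have "c i \<noteq> c j" using False by blast
    then show ?thesis by simp
  qed
  have "potential N c = (\<Sum>i<N. \<Sum>j\<in>{i<..<N}. ennreal (1 / norm (c i - c j)))"
    unfolding potential_def by (intro sum.cong refl) (subst inverse_ennreal, rule pos, auto simp: inverse_eq_divide)
  also have "\<dots> = ennreal (\<Sum>i<N. \<Sum>j\<in>{i<..<N}. 1 / norm (c i - c j))"
    by (simp add: sum_nonneg)
  finally show ?thesis unfolding if_not_P[OF False] .
qed

lemma action_eq:
  "action N \<omega> q (2*pi) = (\<integral>\<^sup>+ t.
      ennreal ((1/2) * (\<Sum>i<N. (cmod (fst (vector_derivative (q i) (at t))
                                   + \<i> * complex_of_real \<omega> * fst (q i t)))\<^sup>2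
                              + (snd (vector_derivative (q i) (at t)))\<^sup>2))
      + potential N (\<lambda>i. q i t) \<partial>per_measure)"
  unfolding action_def potential_eq by (subst nn_integral_restrict_space) auto

lemma potential_tendsto:
  assumes "\<And>i. i < N \<Longrightarrow> (\<lambda>n. c n i) \<longlonglongrightarrow> d i"
  shows "(\<lambda>n. potential N (c n)) \<longlonglongrightarrow> potential N d"
  unfolding potential_def
proof (intro tendsto_sum)
  fix i j assume ij: "i \<in> {..<N}" "j \<in> {i<..<N}"
  have "(\<lambda>n. ennreal (norm (c n i - c n j))) \<longlonglongrightarrow> ennreal (norm (d i - d j))"
    by (intro tendsto_ennrealI tendsto_intros assms) (use ij in auto)
  moreover have "continuous_on UNIV (inverse :: ennreal \<Rightarrow> ennreal)"
    by (intro continuous_intros)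
  ultimately show "(\<lambda>n. inverse (ennreal (norm (c n i - c n j)))) \<longlonglongrightarrow> inverse (ennreal (norm (d i - d j)))"
    by (intro continuous_on_tendsto_compose[of UNIV inverse]) auto
qed

lemma potential_measurable:
  assumes "\<And>i. i < N \<Longrightarrow> q i \<in> borel_measurable M"
  shows "(\<lambda>t. potential N (\<lambda>i. q i t)) \<in> borel_measurable M"
  unfolding potential_def
proof (intro borel_measurable_sum)
  fix i j assume "i \<in> {..<N}" "j \<in> {i<..<N}"
  then have [measurable]: "q i \<in> borel_measurable M" "q j \<in> borel_measurable M" using assms by auto
  show "(\<lambda>t. inverse (ennreal (norm (q i t - q j t)))) \<in> borel_measurable M" by measurable
qed

section \<open>Passage to the rotating frame\<close>

definition twist :: "real \<Rightarrow> (real \<Rightarrow> complex \<times> real) \<Rightarrow> real \<Rightarrow> complex \<times> real" where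
  "twist c F t = (cis (c * t) * fst (F t), snd (F t))"

lemma twist_twist: "twist (- c) (twist c F) = F"
  by (rule ext) (simp add: twist_def cis_mult flip: mult.assoc)

lemma norm_twist: "norm (twist c F t) = norm (F t)"
  by (simp add: twist_def norm_prod_def norm_mult)

text \<open>Presents \<open>twist\<close> as a componentwise product with
  \<open>(cis (c * t), 1)\<close>, to which the product rule applies.\<close>

lemma bounded_bilinear_pair_mult:
  "bounded_bilinear (\<lambda>(a::complex \<times> real) b. (fst a * fst b, snd a * snd b))"
proof
  show "\<exists>K. \<forall>a b. norm (fst a * fst b, snd a * snd b) \<le> norm (a::complex \<times> real) * norm (b::complex \<times> real) * K"
  proof (intro exI allI)
    fix a b :: "complex \<times> real"
    have "norm (fst a * fst b, snd a * snd b) \<le> norm (fst a * fst b) + norm (snd a * snd b)" by (rule norm_Pair_le)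
    also have "\<dots> \<le> norm a * norm b + norm a * norm b"
      unfolding norm_mult
      using norm_fst_le[of "fst a" "snd a"] norm_fst_le[of "fst b" "snd b"]
        norm_snd_le[of "snd a" "fst a"] norm_snd_le[of "snd b" "fst b"]
      by (intro add_mono mult_mono) simp_all
    finally show "norm (fst a * fst b, snd a * snd b) \<le> norm a * norm b * 2" by simp
  qed
qed (auto simp: algebra_simps)

text \<open>Transfers energy bounds between the two frames at the cost of a sup bound
  \<open>B\<close>. The constants come from \<open>(x + y)^2 \<le> 2 * x^2 + 2 * y^2\<close>,
  integrated over a period of length \<open>2*pi\<close>.\<close>

lemma L2_deriv_twist:
  assumes F: "L2_deriv 0 (2*pi) F v" and B: "\<And>t. t \<in> {0..2*pi} \<Longrightarrow> norm (F t) \<le> B"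
  obtains w where "L2_deriv 0 (2*pi) (twist c F) w"
    "energy w \<le> 2 * energy v + 4 * pi * (c * B)\<^sup>2"
proof -
  have cd: "((\<lambda>t. cis (c * t)) has_vector_derivative (c *\<^sub>R (\<i> * cis (c * t)))) (at t)" for t
    by (auto intro!: derivative_eq_intros simp: has_vector_derivative_def)
  define g where "g = (\<lambda>t. (cis (c * t), 1::real))"
  define g' where "g' = (\<lambda>t. (c *\<^sub>R (\<i> * cis (c * t)), 0::real))"
  have g: "(g has_vector_derivative g' t) (at t)" for t
    unfolding g_def g'_def by (intro has_vector_derivative_Pair cd has_vector_derivative_const)
  have g': "continuous_on UNIV g'" unfolding g'_def by (intro continuous_intros)
  define w where "w = (\<lambda>t. (fst (g' t) * fst (F t), snd (g' t) * snd (F t)) + (fst (g t) * fst (v t), snd (g t) * snd (v t)))"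
  have w: "L2_deriv 0 (2*pi) (twist c F) w"
    using L2_deriv_bilinear[OF bounded_bilinear_pair_mult g g' F] by (simp add: twist_def[abs_def] g_def w_def)
  have "(norm (w t))\<^sup>2 \<le> 2 * (norm (v t))\<^sup>2 + 2 * (c * B)\<^sup>2" if t: "t \<in> {0..2*pi}" for t
  proof -
    have "norm (w t) \<le> norm (fst (g' t) * fst (F t), snd (g' t) * snd (F t)) + norm (fst (g t) * fst (v t), snd (g t) * snd (v t))"
      unfolding w_def by (rule norm_triangle_ineq)
    also have "norm (fst (g t) * fst (v t), snd (g t) * snd (v t)) = norm (v t)"
      by (simp add: g_def norm_prod_def norm_mult)
    also have "norm (fst (g' t) * fst (F t), snd (g' t) * snd (F t)) = \<bar>c\<bar> * norm (fst (F t))"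
      by (simp add: g'_def norm_Pair norm_mult)
    also have "\<bar>c\<bar> * norm (fst (F t)) \<le> \<bar>c\<bar> * B"
      using B[OF t] norm_fst_le[of "fst (F t)" "snd (F t)"] by (intro mult_left_mono) auto
    finally have "norm (w t) \<le> \<bar>c\<bar> * B + norm (v t)" by simp
    then have "(norm (w t))\<^sup>2 \<le> (\<bar>c\<bar> * B + norm (v t))\<^sup>2" by (intro power_mono) auto
    also have "\<dots> \<le> 2 * (norm (v t))\<^sup>2 + 2 * (c * B)\<^sup>2"
      using sum_squares_bound[of "\<bar>c\<bar> * B" "norm (v t)"] by (simp add: power2_sum power_mult_distrib algebra_simps)
    finally show ?thesis .
  qed
  then have "energy w \<le> (\<integral>t. 2 * (norm (v t))\<^sup>2 + 2 * (c * B)\<^sup>2 \<partial>per_measure)"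
    using sq_integrable_norm2[OF L2_deriv_sq_integrable[OF w]] sq_integrable_norm2[OF L2_deriv_sq_integrable[OF F]]
    by (intro integral_mono) (auto simp: space_restrict_space)
  also have "\<dots> = 2 * energy v + 4 * pi * (c * B)\<^sup>2"
    using sq_integrable_norm2[OF L2_deriv_sq_integrable[OF F]] measure_lebesgue_on_Icc[of 0 "2*pi"] by simp
  finally show ?thesis using w that by blast
qed

lemma L2_deriv_twist_measurable:
  assumes "L2_deriv 0 (2*pi) (twist k F) w"
  shows "F \<in> borel_measurable per_measure"
proof -
  have "continuous_on {0..2*pi} (twist (- k) (twist k F))"
    unfolding twist_def[of "- k", abs_def] using L2_deriv_continuous_on[OF assms] by (intro continuous_intros)
  then show ?thesis unfolding twist_twist by (rule continuous_imp_measurable_on_sets_lebesgue) simp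
qed

text \<open>The derivative of \<open>cis (k * t) * \<zeta>\<close> is \<open>cis (k * t)\<close>
  times \<open>\<zeta>' + \<i> * k * \<zeta>\<close>, and the unimodular factor does not change the
  norm. The proof differentiates the untwisted loop, since differentiability is assumed for the
  twisted one.\<close>

lemma kinetic_twist_eq:
  assumes "(twist k F has_vector_derivative w) (at t)"
  shows "(cmod (fst (vector_derivative F (at t)) + \<i> * complex_of_real k * fst (F t)))\<^sup>2
     + (snd (vector_derivative F (at t)))\<^sup>2 = (norm w)\<^sup>2"
proof -
  have fU: "((\<lambda>t. fst (twist k F t)) has_vector_derivative fst w) (at t)"
    using bounded_linear.has_vector_derivative[OF bounded_linear_fst assms] .
  have sU: "((\<lambda>t. snd (twist k F t)) has_vector_derivative snd w) (at t)"
    using bounded_linear.has_vector_derivative[OF bounded_linear_snd assms] .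
  have cd: "((\<lambda>t. cis (- k * t)) has_vector_derivative ((- k) *\<^sub>R (\<i> * cis (- k * t)))) (at t)"
    by (auto intro!: derivative_eq_intros simp: has_vector_derivative_def)
  have "(twist (- k) (twist k F) has_vector_derivative
      (cis (- k * t) * fst w + ((- k) *\<^sub>R (\<i> * cis (- k * t))) * fst (twist k F t), snd w)) (at t)"
    unfolding twist_def[of "- k", abs_def]
    by (intro has_vector_derivative_Pair has_vector_derivative_mult cd fU sU)
  then have vd: "vector_derivative F (at t) =
      (cis (- k * t) * fst w + ((- k) *\<^sub>R (\<i> * cis (- k * t))) * fst (twist k F t), snd w)"
    unfolding twist_twist by (rule vector_derivative_at)
  have "cis (- k * t) * fst (twist k F t) = fst (F t)"
    by (simp add: twist_def cis_mult flip: mult.assoc)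
  then have "((- k) *\<^sub>R (\<i> * cis (- k * t))) * fst (twist k F t) = - (\<i> * complex_of_real k * fst (F t))"
    by (simp add: scaleR_conv_of_real mult_ac)
  then show ?thesis unfolding vd by (simp add: norm_mult norm_prod_def)
qed

lemma action_twist_eq:
  assumes W: "\<And>i. i < N \<Longrightarrow> L2_deriv 0 (2*pi) (twist k (q i)) (W i)"
  shows "action N k q (2*pi) = ennreal ((1/2) * (\<Sum>i<N. energy (W i)))
     + (\<integral>\<^sup>+ t. potential N (\<lambda>i. q i t) \<partial>per_measure)"
proof -
  have ae: "AE t in per_measure. \<forall>i\<in>{..<N}. (twist k (q i) has_vector_derivative W i t) (at t)"
    using L2_deriv_has_vector_derivative_AE[OF W] by (simp add: AE_ball_countable)
  have qm: "q i \<in> borel_measurable per_measure" if "i < N" for i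
    by (rule L2_deriv_twist_measurable[OF W[OF that]])
  note int = sq_integrable_norm2[OF L2_deriv_sq_integrable[OF W]]
  have "action N k q (2*pi) = (\<integral>\<^sup>+ t. ennreal ((1/2) * (\<Sum>i<N. (norm (W i t))\<^sup>2)) + potential N (\<lambda>i. q i t) \<partial>per_measure)"
    unfolding action_eq
  proof (rule nn_integral_cong_AE, use ae in eventually_elim)
    case (elim t)
    have "(\<Sum>i<N. (cmod (fst (vector_derivative (q i) (at t)) + \<i> * complex_of_real k * fst (q i t)))\<^sup>2
        + (snd (vector_derivative (q i) (at t)))\<^sup>2) = (\<Sum>i<N. (norm (W i t))\<^sup>2)"
      using elim by (intro sum.cong refl kinetic_twist_eq) auto
    then show ?case by simp
  qed
  also have "\<dots> = (\<integral>\<^sup>+ t. ennreal ((1/2) * (\<Sum>i<N. (norm (W i t))\<^sup>2)) \<partial>per_measure) + (\<integral>\<^sup>+ t. potential N (\<lambda>i. q i t) \<partial>per_measure)"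
  proof (rule nn_integral_add)
    have "integrable per_measure (\<lambda>t. (1/2) * (\<Sum>i<N. (norm (W i t))\<^sup>2))"
      using int by (intro integrable_mult_right Bochner_Integration.integrable_sum) auto
    then show "(\<lambda>t. ennreal ((1/2) * (\<Sum>i<N. (norm (W i t))\<^sup>2))) \<in> borel_measurable per_measure"
      by (intro measurable_compose[OF _ measurable_ennreal] borel_measurable_integrable)
  qed (rule potential_measurable[OF qm])
  also have "(\<integral>\<^sup>+ t. ennreal ((1/2) * (\<Sum>i<N. (norm (W i t))\<^sup>2)) \<partial>per_measure) = ennreal (\<integral>t. (1/2) * (\<Sum>i<N. (norm (W i t))\<^sup>2) \<partial>per_measure)"
    using int by (intro nn_integral_eq_integral integrable_mult_right Bochner_Integration.integrable_sum)
      (auto simp: sum_nonneg)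
  also have "(\<integral>t. (1/2) * (\<Sum>i<N. (norm (W i t))\<^sup>2) \<partial>per_measure) = (1/2) * (\<Sum>i<N. energy (W i))"
    using int by (subst integral_mult_right_zero, subst Bochner_Integration.integral_sum) auto
  finally show ?thesis .
qed

text \<open>The kinetic part is convex, hence bounded below by its linearization at the limit, where
  weak convergence applies; the potential part is handled by pointwise convergence and Fatou's
  lemma.\<close>

lemma action_lower_semicontinuous:
  assumes W: "\<And>n i. i < N \<Longrightarrow> L2_deriv 0 (2*pi) (twist k (qn n i)) (W n i)"
    and w: "\<And>i. i < N \<Longrightarrow> L2_deriv 0 (2*pi) (twist k (q i)) (w i)"
    and lim: "\<And>i t. i < N \<Longrightarrow> t \<in> {0..2*pi} \<Longrightarrow> (\<lambda>n. qn n i t) \<longlonglongrightarrow> q i t"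
    and weak: "\<And>i p. i < N \<Longrightarrow> sq_integrable per_measure p \<Longrightarrow>
      (\<lambda>n. L2_inner (W n i) p) \<longlonglongrightarrow> L2_inner (w i) p"
    and m: "(\<lambda>n. action N k (qn n) (2*pi)) \<longlonglongrightarrow> m"
  shows "action N k q (2*pi) \<le> m"
proof (rule ennreal_le_epsilon)
  fix e :: real assume e: "e > 0"
  define kin where "kin = (\<lambda>W :: nat \<Rightarrow> real \<Rightarrow> complex \<times> real. (1/2) * (\<Sum>i<N. energy (W i)))"
  have kin0: "kin W \<ge> 0" for W unfolding kin_def by (intro mult_nonneg_nonneg sum_nonneg integral_nonneg_AE) auto
  define P where "P = (\<lambda>q. \<integral>\<^sup>+ t. potential N (\<lambda>i. q i t) \<partial>per_measure)"
  have actn: "action N k (qn n) (2*pi) = ennreal (kin (W n)) + P (qn n)" for n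
    unfolding kin_def P_def by (rule action_twist_eq[OF W])
  have act: "action N k q (2*pi) = ennreal (kin w) + P q"
    unfolding kin_def P_def by (rule action_twist_eq[OF w])
  define d where "d = (\<lambda>n. (\<Sum>i<N. L2_inner (W n i) (w i) - L2_inner (w i) (w i)))"
  have kin_ge: "kin w + d n \<le> kin (W n)" for n
  proof -
    have "L2_inner (W n i) (w i) - L2_inner (w i) (w i)
        \<le> (1/2) * energy (W n i) - (1/2) * energy (w i)" if i: "i < N" for i
    proof -
      note a = L2_deriv_sq_integrable[OF W[OF i, of n]] and b = L2_deriv_sq_integrable[OF w[OF i]]
      have "0 \<le> (\<integral>t. (norm (W n i t + (-1) *\<^sub>R w i t))\<^sup>2 \<partial>per_measure)" by (rule integral_nonneg_AE) simp
      also have "\<dots> = energy (W n i) - 2 * L2_inner (W n i) (w i) + energy (w i)"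
        by (subst integral_norm_add_squared[OF a sq_integrable_scaleR[OF b]]) simp
      finally show ?thesis by (simp add: power2_norm_eq_inner)
    qed
    then have "d n \<le> (\<Sum>i<N. (1/2) * energy (W n i) - (1/2) * energy (w i))"
      unfolding d_def by (intro sum_mono) auto
    also have "\<dots> = kin (W n) - kin w" unfolding kin_def by (simp add: sum_subtractf sum_distrib_left)
    finally show ?thesis by simp
  qed
  have "d \<longlonglongrightarrow> (\<Sum>i<N. L2_inner (w i) (w i) - L2_inner (w i) (w i))"
    unfolding d_def by (intro tendsto_intros weak L2_deriv_sq_integrable[OF w]) auto
  then have "d \<longlonglongrightarrow> 0" by simp
  then have ev: "\<forall>\<^sub>F n in sequentially. d n > - e" using e by (intro order_tendstoD) auto
  have qm: "qn n i \<in> borel_measurable per_measure" if "i < N" for i n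
    by (rule L2_deriv_twist_measurable[OF W[OF that]])
  \<comment> \<open>The limiting kinetic energy is spread evenly over the period, so that one
    application of Fatou treats the sum and nothing has to be subtracted in
    \<open>ennreal\<close>.\<close>
  define c where "c = ennreal (kin w / (2*pi))"
  have cint: "(\<integral>\<^sup>+ t. c \<partial>per_measure) = ennreal (kin w)"
    using kin0[of w] by (simp add: c_def emeasure_restrict_space space_restrict_space flip: ennreal_mult)
  have add: "(\<integral>\<^sup>+ t. c + potential N (\<lambda>i. qn n i t) \<partial>per_measure) = ennreal (kin w) + P (qn n)" for n
    unfolding P_def cint[symmetric] by (rule nn_integral_add) (auto intro: potential_measurable qm)
  have "ennreal (kin w) + P q \<le> (\<integral>\<^sup>+ t. c + potential N (\<lambda>i. q i t) \<partial>per_measure)"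
  proof -
    have "q i \<in> borel_measurable per_measure" if "i < N" for i
      by (rule L2_deriv_twist_measurable[OF w[OF that]])
    then show ?thesis unfolding P_def cint[symmetric]
      by (intro eq_refl nn_integral_add[symmetric]) (auto intro: potential_measurable)
  qed
  also have "\<dots> = (\<integral>\<^sup>+ t. liminf (\<lambda>n. c + potential N (\<lambda>i. qn n i t)) \<partial>per_measure)"
  proof (rule nn_integral_cong)
    fix t assume t: "t \<in> space per_measure"
    have "(\<lambda>n. c + potential N (\<lambda>i. qn n i t)) \<longlonglongrightarrow> c + potential N (\<lambda>i. q i t)"
      using t lim by (intro tendsto_intros potential_tendsto) (auto simp: space_restrict_space)
    then show "c + potential N (\<lambda>i. q i t) = liminf (\<lambda>n. c + potential N (\<lambda>i. qn n i t))"
      by (rule lim_imp_Liminf[OF trivial_limit_sequentially, symmetric])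
  qed
  also have "\<dots> \<le> liminf (\<lambda>n. \<integral>\<^sup>+ t. c + potential N (\<lambda>i. qn n i t) \<partial>per_measure)"
    by (intro nn_integral_liminf borel_measurable_add measurable_const potential_measurable qm) auto
  also have "\<dots> \<le> liminf (\<lambda>n. action N k (qn n) (2*pi) + ennreal e)"
  proof (rule Liminf_mono, use ev in eventually_elim)
    case (elim n)
    have "ennreal (kin w) \<le> ennreal (kin (W n) + e)" using kin_ge[of n] elim by (intro ennreal_leI) simp
    also have "\<dots> = ennreal (kin (W n)) + ennreal e" using kin0 e by (intro ennreal_plus) auto
    finally show ?case unfolding add actn by (simp add: add_mono add.assoc add.commute add.left_commute)
  qed
  also have "\<dots> = m + ennreal e"
    by (intro lim_imp_Liminf trivial_limit_sequentially tendsto_intros m)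
  finally show "action N k q (2*pi) \<le> m + ennreal e" unfolding act .
qed

text \<open>The pair of masses 0 and 1 is at distance at most \<open>2 * M\<close>; its contribution
  \<open>1 / (2 * M)\<close> over a period of length \<open>2*pi\<close> gives
  \<open>pi / M\<close>.\<close>

lemma action_lower_bound:
  assumes N: "N \<ge> 2" and M: "M > 0" and q: "\<And>i t. i < N \<Longrightarrow> norm (q i t) \<le> M"
  shows "action N \<omega> q (2*pi) \<ge> ennreal (pi / M)"
proof -
  have "ennreal (1 / (2 * M)) \<le> potential N (\<lambda>i. q i t)" for t
  proof -
    have "norm (q 0 t - q 1 t) \<le> 2 * M"
      using norm_triangle_ineq4[of "q 0 t" "q 1 t"] q[of 0 t] q[of 1 t] N by simp
    then have "ennreal (inverse (2 * M)) \<le> inverse (ennreal (norm (q 0 t - q 1 t)))"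
      using M le_imp_inverse_le[of "norm (q 0 t - q 1 t)" "2 * M"]
      by (cases "norm (q 0 t - q 1 t) = 0") (auto simp: inverse_ennreal simp del: inverse_mult_distrib intro!: ennreal_leI)
    also have "\<dots> \<le> (\<Sum>j\<in>{0<..<N}. inverse (ennreal (norm (q 0 t - q j t))))"
      using N by (intro member_le_sum) auto
    also have "\<dots> \<le> potential N (\<lambda>i. q i t)"
      unfolding potential_def using N by (intro member_le_sum[of 0]) auto
    finally show ?thesis by (simp add: inverse_eq_divide)
  qed
  then have "(\<integral>\<^sup>+ t. ennreal (1 / (2 * M)) \<partial>per_measure) \<le> action N \<omega> q (2*pi)"
    unfolding action_eq by (intro nn_integral_mono) (simp add: add_increasing)
  moreover have "(\<integral>\<^sup>+ t. ennreal (1 / (2 * M)) \<partial>per_measure) = ennreal (pi / M)"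
    using M by (simp add: emeasure_restrict_space space_restrict_space flip: ennreal_mult)
  ultimately show ?thesis by simp
qed

section \<open>Loops of bounded action\<close>

lemma periodic_int_shift:
  fixes f :: "real \<Rightarrow> 'a"
  assumes "\<And>t. f (t + 2*pi) = f t"
  shows "f (t + 2*pi * of_int m) = f t"
proof (induction m rule: int_induct[where k=0])
  case (step1 i)
  then show ?case using assms[of "t + 2*pi * of_int i"] by (simp add: algebra_simps)
next
  case (step2 i)
  then show ?case using assms[of "t + 2*pi * of_int (i - 1)"] by (simp add: algebra_simps)
qed simp

lemma period_reduction:
  obtains s m where "s \<in> {0..2*pi}" "t = s + 2*pi * of_int m"
proof (rule that[of "t - 2*pi * of_int \<lfloor>t / (2*pi)\<rfloor>" "\<lfloor>t / (2*pi)\<rfloor>"])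
  show "t - 2*pi * of_int \<lfloor>t / (2*pi)\<rfloor> \<in> {0..2*pi}"
    using floor_divide_lower[of "2*pi" t] floor_divide_upper[of "2*pi" t] by (simp add: algebra_simps)
qed simp

lemma Lambda_DN_periodic: "q \<in> Lambda_DN N \<Longrightarrow> N > 0 \<Longrightarrow> q 0 (t + 2*pi) = q 0 t"
  unfolding Lambda_DN_def H1_loop_def by blast

lemma Lambda_DN_shift: "q \<in> Lambda_DN N \<Longrightarrow> i < N \<Longrightarrow> q i t = q 0 (t + 2*pi * real i / real N)"
  unfolding Lambda_DN_def by blast

lemma Lambda_DN_bounded:
  assumes q: "q \<in> Lambda_DN N" and N: "N > 0"
  obtains B where "B > 0" "\<And>i t. i < N \<Longrightarrow> norm (q i t) \<le> B"
proof -
  obtain v where v: "L2_deriv 0 (2*pi) (q 0) v"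
    using Lambda_DN_H1_loop[OF q] N unfolding H1_loop_iff by blast
  have "bounded (q 0 ` {0..2*pi})"
    by (intro compact_imp_bounded compact_continuous_image L2_deriv_continuous_on[OF v]) simp
  then obtain B where B: "B > 0" "\<And>t. t \<in> {0..2*pi} \<Longrightarrow> norm (q 0 t) \<le> B" by (metis bounded_pos image_eqI)
  have "norm (q 0 t) \<le> B" for t
  proof -
    obtain s m where s: "s \<in> {0..2*pi}" "t = s + 2*pi * of_int m" by (rule period_reduction)
    have "q 0 t = q 0 s" unfolding s(2) by (rule periodic_int_shift[of "q 0", OF Lambda_DN_periodic[OF q N]])
    then show ?thesis using B(2)[OF s(1)] by simp
  qed
  then show ?thesis using that[OF B(1)] Lambda_DN_shift[OF q] by metis
qed

lemma Lambda_DN_twist_deriv: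
  assumes q: "q \<in> Lambda_DN N" and N: "N > 0" and A: "action N k q (2*pi) \<le> ennreal A" "A \<ge> 0"
  obtains W where "\<And>i. i < N \<Longrightarrow> L2_deriv 0 (2*pi) (twist k (q i)) (W i)"
    "\<And>i. i < N \<Longrightarrow> energy (W i) \<le> 2 * A"
proof -
  obtain B where B: "\<And>i t. i < N \<Longrightarrow> norm (q i t) \<le> B" using Lambda_DN_bounded[OF q N] by metis
  have "\<exists>w. L2_deriv 0 (2*pi) (twist k (q i)) w" if i: "i < N" for i
  proof -
    obtain v where "L2_deriv 0 (2*pi) (q i) v" using Lambda_DN_H1_loop[OF q] i unfolding H1_loop_iff by blast
    from L2_deriv_twist[OF this B[OF i]] show ?thesis by blast
  qed
  then obtain W where W: "\<And>i. i < N \<Longrightarrow> L2_deriv 0 (2*pi) (twist k (q i)) (W i)" by metis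
  have nonneg: "0 \<le> energy (W i)" for i by (rule integral_nonneg_AE) simp
  have "ennreal ((1/2) * (\<Sum>i<N. energy (W i))) \<le> action N k q (2*pi)"
    by (subst action_twist_eq[OF W]) auto
  also note A(1)
  finally have "(\<Sum>i<N. energy (W i)) \<le> 2 * A" using A(2) by (simp add: ennreal_le_iff)
  moreover have "energy (W i) \<le> (\<Sum>i<N. energy (W i))" if "i < N" for i
    using that nonneg by (intro member_le_sum) auto
  ultimately show ?thesis using that[OF W] by (meson order_trans)
qed

text \<open>The constant is \<open>2 * \<eta>\<close>: one \<open>\<eta>\<close> for the planar
  part, one for the height. Periodicity and reflection make \<open>fst (q 0 0)\<close> equal to its
  conjugate, which is why the planar reference curve has a real amplitude.\<close>

lemma loop_deviation:
  fixes k :: nat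
  assumes q: "q \<in> Lambda_DN N" and N: "N > 0" and mean: "mean_z0 q = 0"
    and A: "action N (real k) q (2*pi) \<le> ennreal A" "A \<ge> 0"
  obtains a :: real where
    "\<And>t. norm (q 0 t - (complex_of_real a * cis (- real k * t), 0)) \<le> 4 * sqrt (pi * A)"
proof -
  obtain W where W: "\<And>i. i < N \<Longrightarrow> L2_deriv 0 (2*pi) (twist (real k) (q i)) (W i)"
    "\<And>i. i < N \<Longrightarrow> energy (W i) \<le> 2 * A"
    using Lambda_DN_twist_deriv[OF q N A] by blast
  \<comment> \<open>The Hoelder bound for times at distance at most \<open>2*pi\<close> and energy
    at most \<open>2 * A\<close>.\<close>
  define \<eta> where "\<eta> = 2 * sqrt (pi * A)"
  define U where "U = twist (real k) (q 0)"
  have dev: "norm (U t - U s) \<le> \<eta>" if "s \<in> {0..2*pi}" "t \<in> {0..2*pi}" for s t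
  proof -
    have "norm (U t - U s) \<le> sqrt (\<bar>t - s\<bar> * energy (W 0))"
      unfolding U_def by (rule L2_deriv_Holder[OF W(1)[OF N] that])
    also have "\<dots> \<le> sqrt ((2 * pi) * (2 * A))"
      using that W(2)[OF N] by (intro real_sqrt_le_mono mult_mono) (auto simp: abs_le_iff intro: integral_nonneg_AE)
    also have "(2 * pi) * (2 * A) = 2\<^sup>2 * (pi * A)" by simp
    also have "sqrt (2\<^sup>2 * (pi * A)) = \<eta>" unfolding \<eta>_def real_sqrt_mult by simp
    finally show ?thesis .
  qed
  define a where "a = Re (fst (q 0 0))"
  have "q 0 (2*pi - 0) = Rxz (q 0 0)" using q unfolding Lambda_DN_def by blast
  moreover have "q 0 (0 + 2*pi) = q 0 0" by (rule Lambda_DN_periodic[OF q N])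
  ultimately have "q 0 0 = Rxz (q 0 0)" by simp
  then have "fst (q 0 0) = cnj (fst (q 0 0))" by (metis Rxz_def fst_conv)
  then have a: "fst (q 0 0) = complex_of_real a" unfolding a_def by (simp add: complex_eq_iff)
  have z: "\<bar>snd (q 0 t)\<bar> \<le> \<eta>" if t: "t \<in> {0..2*pi}" for t
  proof -
    have zd: "norm (snd (q 0 t) - snd (q 0 s)) \<le> \<eta>" if s: "s \<in> {0..2*pi}" for s
    proof -
      have "norm (snd (U t - U s)) \<le> norm (U t - U s)" by (metis norm_snd_le prod.collapse)
      then show ?thesis using dev[OF s t] by (simp add: U_def twist_def)
    qed
    have "continuous_on {0..2*pi} (\<lambda>s. snd (U s))"
      unfolding U_def by (intro continuous_intros L2_deriv_continuous_on[OF W(1)[OF N]])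
    then have "(\<lambda>s. snd (q 0 s)) integrable_on {0..2*pi}"
      by (simp add: U_def twist_def integrable_continuous_real)
    moreover have "integral {0..2*pi} (\<lambda>s. snd (q 0 s)) = 0" using mean by (simp add: mean_z0_def)
    ultimately have "((\<lambda>s. snd (q 0 s)) has_integral 0) {0..2*pi}" by (metis integrable_integral)
    \<comment> \<open>As the mean height is 0, the height at \<open>t\<close> is the average over
      \<open>s\<close> of its differences to the heights at \<open>s\<close>.\<close>
    from has_integral_diff[OF has_integral_const_real[of "snd (q 0 t)" 0 "2*pi"] this]
    have "((\<lambda>s. snd (q 0 t) - snd (q 0 s)) has_integral (2 * pi * snd (q 0 t))) {0..2*pi}" by simp
    then have "norm (2 * pi * snd (q 0 t)) \<le> \<eta> * measure lborel {0..2*pi}"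
      using zd A by (intro has_integral_bound_real[where S="{}"]) (auto simp: \<eta>_def)
    then show ?thesis by (simp add: abs_mult)
  qed
  have main: "norm (q 0 t - (complex_of_real a * cis (- real k * t), 0)) \<le> 4 * sqrt (pi * A)"
    if t: "t \<in> {0..2*pi}" for t
  proof -
    have "cis (- real k * t) * fst (U t) = fst (q 0 t)"
      by (simp add: U_def twist_def cis_mult flip: mult.assoc)
    then have "fst (q 0 t) - complex_of_real a * cis (- real k * t) = cis (- real k * t) * fst (U t - U 0)"
      using a by (simp add: U_def twist_def algebra_simps)
    then have "norm (fst (q 0 t) - complex_of_real a * cis (- real k * t)) = norm (fst (U t - U 0))" by (simp add: norm_mult)
    also have "\<dots> \<le> norm (U t - U 0)" by (metis norm_fst_le prod.collapse)
    also have "\<dots> \<le> \<eta>" using t by (intro dev) auto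
    finally have 1: "norm (fst (q 0 t) - complex_of_real a * cis (- real k * t)) \<le> \<eta>" .
    have "q 0 t - (complex_of_real a * cis (- real k * t), 0) = (fst (q 0 t) - complex_of_real a * cis (- real k * t), snd (q 0 t))"
      by (simp add: prod_eq_iff)
    then have "norm (q 0 t - (complex_of_real a * cis (- real k * t), 0)) \<le> norm (fst (q 0 t) - complex_of_real a * cis (- real k * t)) + norm (snd (q 0 t))"
      by (metis norm_Pair_le)
    then show ?thesis using 1 z[OF t] by (simp add: \<eta>_def)
  qed
  show ?thesis
  proof (rule that)
    fix t
    obtain s m where s: "s \<in> {0..2*pi}" "t = s + 2*pi * of_int m" by (rule period_reduction)
    have "q 0 t = q 0 s" unfolding s(2) by (rule periodic_int_shift[of "q 0", OF Lambda_DN_periodic[OF q N]])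
    moreover have "cis (- real k * t) = cis (- real k * s)"
    proof -
      have "cis (- real k * t) = cis (- real k * s) * cis (2 * pi * real_of_int (- int k * m))"
        unfolding cis_mult by (rule arg_cong[of _ _ cis]) (simp add: s(2) algebra_simps)
      also have "cis (2 * pi * real_of_int (- int k * m)) = 1" by (rule cis_multiple_2pi) simp
      finally show ?thesis by simp
    qed
    ultimately show "norm (q 0 t - (complex_of_real a * cis (- real k * t), 0)) \<le> 4 * sqrt (pi * A)"
      using main[OF s(1)] by simp
  qed
qed

text \<open>At each sign time the reference curve has ordinate
  \<open>- a * sin (k * \<tau>)\<close>, of modulus above \<delta>. The loop itself then has the
  same strict sign there, and the closed inequality of its class fixes
  \<open>\<xi> j\<close>.\<close>

lemma far_loop_sign:
  assumes k: "coprime k N" and \<xi>: "\<xi> \<in> Xi N" and q: "q \<in> Lambda_xi N \<xi>"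
    and dev: "\<And>t. norm (q 0 t - (complex_of_real a * cis (- real k * t), 0)) \<le> \<delta>"
    and far: "\<And>j. j \<in> {1..N-1} \<Longrightarrow> \<delta> < \<bar>a\<bar> * \<bar>sin (real k * (real j * pi / real N))\<bar>"
  shows "\<xi> = pol_sign N k (sgn a)"
proof
  fix j
  show "\<xi> j = pol_sign N k (sgn a) j"
  proof (cases "1 \<le> j \<and> j \<le> N - 1")
    case True
    define \<tau> where "\<tau> = real j * pi / real N"
    define S where "S = sin (real k * \<tau>)"
    define y where "y = Im (fst (q 0 \<tau>))"
    have "\<bar>Im (fst (q 0 \<tau> - (complex_of_real a * cis (- real k * \<tau>), 0)))\<bar> \<le> norm (fst (q 0 \<tau> - (complex_of_real a * cis (- real k * \<tau>), 0)))"
      by (rule abs_Im_le_cmod)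
    also have "\<dots> \<le> norm (q 0 \<tau> - (complex_of_real a * cis (- real k * \<tau>), 0))" by (metis norm_fst_le prod.collapse)
    also have "\<dots> \<le> \<delta>" by (rule dev)
    also have "\<delta> < \<bar>a\<bar> * \<bar>S\<bar>" using far[of j] True by (simp add: \<tau>_def S_def)
    finally have 1: "\<bar>y + a * S\<bar> < \<bar>a * S\<bar>" by (simp add: y_def S_def abs_mult)
    have 2: "\<xi> j * y \<ge> 0" using Lambda_xi_sign[OF q] True by (simp add: y_def \<tau>_def)
    have 3: "\<xi> j \<in> {-1, 1}" using \<xi> True by (simp add: Xi_def)
    have "\<xi> j = - sgn (a * S)"
    proof -
      define p where "p = a * S"
      show ?thesis using 1 2 3 unfolding p_def[symmetric] by (auto simp: sgn_if abs_if split: if_splits)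
    qed
    then show ?thesis using True by (simp add: pol_sign_def S_def \<tau>_def sgn_mult)
  next
    case False
    then show ?thesis using \<xi> by (auto simp: Xi_def pol_sign_def)
  qed
qed

lemma sin_coprime_bounded_below:
  assumes k: "coprime k N"
  obtains \<mu> where "\<mu> > 0" "\<And>j. j \<in> {1..N-1} \<Longrightarrow> \<mu> \<le> \<bar>sin (real k * (real j * pi / real N))\<bar>"
proof (rule that)
  \<comment> \<open>The element 1 keeps the finite set nonempty for every \<open>N\<close>.\<close>
  let ?S = "insert 1 ((\<lambda>j. \<bar>sin (real k * (real j * pi / real N))\<bar>) ` {1..N-1})"
  show "Min ?S > 0" using sin_coprime_ne_0[OF k] by (subst Min_gr_iff) auto
  show "Min ?S \<le> \<bar>sin (real k * (real j * pi / real N))\<bar>" if "j \<in> {1..N-1}" for j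
    using that by (intro Min_le) auto
qed

lemma pol_sign_distinct:
  assumes N: "N \<ge> 2" and k: "coprime k N" and s: "s \<in> {1, -1}" "s' \<in> {1, -1}" and eq: "pol_sign N k s = pol_sign N k s'"
  shows "s = s'"
proof -
  have "1 \<le> N - 1" using N by simp
  then have "s * sgn (sin (real k * (real 1 * pi / real N))) = s' * sgn (sin (real k * (real 1 * pi / real N)))"
    using fun_cong[OF eq, of 1] by (simp add: pol_sign_def)
  moreover have "sin (real k * (real 1 * pi / real N)) \<noteq> 0" using sin_coprime_ne_0[OF k, of 1] N by simp
  ultimately show ?thesis by (simp add: sgn_if split: if_splits)
qed

text \<open>The constants: action at most \<open>pi / (R + 17)\<close> makes the deviation at most
  8, by the crude bound \<open>pi < 4\<close>. The loop then has size at most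
  \<open>\<bar>a\<bar> + 9\<close>, so \<open>action_lower_bound\<close> gives
  \<open>\<bar>a\<bar> + 9 \<ge> R + 17\<close>, that is
  \<open>\<bar>a\<bar> \<ge> R + 8\<close>.\<close>

lemma small_action_far_loop:
  assumes N: "N \<ge> 2" and q: "q \<in> Lambda_DN N" and mean: "mean_z0 q = 0" and R: "R \<ge> 0"
    and A: "action N (real k) q (2*pi) \<le> ennreal (pi / (R + 17))"
  obtains a where "\<bar>a\<bar> \<ge> R + 8"
    "\<And>t. norm (q 0 t - (complex_of_real a * cis (- real k * t), 0)) \<le> 8"
proof -
  have N0: "N > 0" using N by simp
  obtain a where a: "\<And>t. norm (q 0 t - (complex_of_real a * cis (- real k * t), 0)) \<le> 4 * sqrt (pi * (pi / (R + 17)))"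
    using loop_deviation[OF q N0 mean A] R by auto
  have "pi * (pi / (R + 17)) \<le> 4 * 4 / 4"
    unfolding times_divide_eq_right using pi_less_4 pi_gt_zero R by (intro frac_le mult_mono) auto
  then have "sqrt (pi * (pi / (R + 17))) \<le> sqrt (2\<^sup>2)" by (intro real_sqrt_le_mono) simp
  then have "4 * sqrt (pi * (pi / (R + 17))) \<le> 8" by simp
  then have dev: "norm (q 0 t - (complex_of_real a * cis (- real k * t), 0)) \<le> 8" for t
    using a[of t] by linarith
  have b0: "norm (q 0 t) \<le> \<bar>a\<bar> + 9" for t
  proof -
    have "norm (q 0 t) \<le> norm (q 0 t - (complex_of_real a * cis (- real k * t), 0)) + norm (complex_of_real a * cis (- real k * t), 0::real)"
      by (rule order_trans[OF _ norm_triangle_ineq]) simp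
    then show ?thesis using dev[of t] by (simp add: norm_Pair norm_mult)
  qed
  have "norm (q i t) \<le> \<bar>a\<bar> + 9" if "i < N" for i t
    unfolding Lambda_DN_shift[OF q that] by (rule b0)
  then have "ennreal (pi / (\<bar>a\<bar> + 9)) \<le> ennreal (pi / (R + 17))"
    using action_lower_bound[OF N, of "\<bar>a\<bar> + 9" q "real k"] A abs_ge_zero[of a]
    by (meson add_nonneg_pos order_trans zero_less_numeral)
  then have "pi / (\<bar>a\<bar> + 9) \<le> pi / (R + 17)" using R by (subst (asm) ennreal_le_iff) auto
  have "R + 8 \<le> \<bar>a\<bar>"
  proof (rule ccontr)
    assume "\<not> R + 8 \<le> \<bar>a\<bar>"
    then have "pi / (R + 17) < pi / (\<bar>a\<bar> + 9)" using R by (intro divide_strict_left_mono) auto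
    with \<open>pi / (\<bar>a\<bar> + 9) \<le> pi / (R + 17)\<close> show False by simp
  qed
  then show ?thesis using that dev by blast
qed

section \<open>Normalised configurations and dilated polygons\<close>

lemma cfg_norm_L2_set: "cfg_norm N c = L2_set (\<lambda>i. norm (c i)) {..<N}"
  by (simp add: cfg_norm_def L2_set_def)

lemma cfg_norm_le_sum: "cfg_norm N c \<le> (\<Sum>i<N. norm (c i))"
  unfolding cfg_norm_L2_set by (rule L2_set_le_sum) auto

text \<open>With \<open>X\<close> and \<open>D\<close> the norms of \<open>x\<close> and
  \<open>c\<close>, write \<open>x/X - c/D = (x - c)/D + ((D - X)/(X * D)) * x\<close>. Since each
  component of \<open>x\<close> is at most \<open>X\<close>, the factor \<open>X\<close> cancels and
  only the known large norm \<open>D\<close> remains in the denominator.\<close>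

lemma cfg_norm_normalize_diff_le:
  assumes \<delta>: "\<And>i. i < N \<Longrightarrow> norm (x i - c i) \<le> \<delta>"
    and X: "cfg_norm N x > 0" and D: "cfg_norm N c > 0"
  shows "cfg_norm N (\<lambda>i. (1 / cfg_norm N x) *\<^sub>R x i - (1 / cfg_norm N c) *\<^sub>R c i) \<le> real N * ((1 + real N) * \<delta> / cfg_norm N c)"
proof -
  define X' D' where "X' = cfg_norm N x" and "D' = cfg_norm N c"
  have X': "X' > 0" and D': "D' > 0" using X D by (simp_all add: X'_def D'_def)
  have tri: "cfg_norm N f \<le> cfg_norm N g + real N * \<delta>" if "\<And>i. i < N \<Longrightarrow> norm (f i - g i) \<le> \<delta>" for f g
  proof -
    have "cfg_norm N f \<le> L2_set (\<lambda>i. norm (g i) + norm (f i - g i)) {..<N}"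
      unfolding cfg_norm_L2_set by (rule L2_set_mono) (auto intro: norm_triangle_sub)
    also have "\<dots> \<le> cfg_norm N g + cfg_norm N (\<lambda>i. f i - g i)"
      unfolding cfg_norm_L2_set by (rule L2_set_triangle_ineq)
    also have "cfg_norm N (\<lambda>i. f i - g i) \<le> (\<Sum>i<N. norm (f i - g i))" by (rule cfg_norm_le_sum)
    also have "\<dots> \<le> (\<Sum>i<N. \<delta>)" using that by (intro sum_mono) auto
    finally show ?thesis by simp
  qed
  have XD: "\<bar>D' - X'\<bar> \<le> real N * \<delta>"
    using tri[of x c] tri[of c x] \<delta> by (auto simp: X'_def D'_def abs_le_iff norm_minus_commute)
  have xi: "norm (x i) \<le> X'" if "i < N" for i
    unfolding X'_def cfg_norm_L2_set using that by (intro member_le_L2_set[of _ i "\<lambda>i. norm (x i)"]) auto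
  have "norm ((1 / X') *\<^sub>R x i - (1 / D') *\<^sub>R c i) \<le> (1 + real N) * \<delta> / D'" if i: "i < N" for i
  proof -
    have "(1 / X') *\<^sub>R x i - (1 / D') *\<^sub>R c i = (1 / D') *\<^sub>R (x i - c i) + ((D' - X') / (X' * D')) *\<^sub>R x i"
    proof -
      have "1 / X' = 1 / D' + (D' - X') / (X' * D')" using X' D' by (simp add: field_simps)
      then have "(1 / X') *\<^sub>R x i = (1 / D') *\<^sub>R x i + ((D' - X') / (X' * D')) *\<^sub>R x i" by (metis scaleR_left_distrib)
      then show ?thesis by (simp add: scaleR_right_diff_distrib)
    qed
    also have "norm \<dots> \<le> (1 / D') * norm (x i - c i) + (\<bar>D' - X'\<bar> / (X' * D')) * norm (x i)"
      using X' D' by (intro order_trans[OF norm_triangle_ineq]) simp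
    also have "\<dots> \<le> (1 / D') * \<delta> + ((real N * \<delta>) / (X' * D')) * X'"
      using X' D' xi[OF i] XD \<delta>[OF i] by (intro add_mono mult_left_mono mult_mono divide_right_mono) auto
    also have "\<dots> = (1 + real N) * \<delta> / D'" using X' D' by (simp add: field_simps)
    finally show ?thesis .
  qed
  then have "(\<Sum>i<N. norm ((1 / X') *\<^sub>R x i - (1 / D') *\<^sub>R c i)) \<le> (\<Sum>i<N. (1 + real N) * \<delta> / D')"
    by (intro sum_mono) auto
  with cfg_norm_le_sum[of N "\<lambda>i. (1 / X') *\<^sub>R x i - (1 / D') *\<^sub>R c i"] show ?thesis
    by (simp add: X'_def D'_def)
qed

text \<open>Each twisted component is constant in time, and the potential is homogeneous of degree
  -1.\<close>

lemma action_rot_loop: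
  assumes k: "coprime k N" and s: "s \<in> {1, -1}" and lam: "lam > 0" and r: "r > 0"
  shows "action N (real k) (rot_loop k lam (polygon N k s r)) (2*pi) =
     ennreal (2 * pi * (\<Sum>i<N. \<Sum>j\<in>{i<..<N}. 1 / norm (polygon N k s r i - polygon N k s r j)) / lam)"
proof -
  define q where "q = rot_loop k lam (polygon N k s r)"
  define C where "C = (\<Sum>i<N. \<Sum>j\<in>{i<..<N}. 1 / norm (polygon N k s r i - polygon N k s r j))"
  have C0: "C \<ge> 0" unfolding C_def by (intro sum_nonneg) auto
  have tw: "twist (real k) (q i) = (\<lambda>_. (complex_of_real (lam * s * r) * cis (- real k * (2*pi * real i / real N)), 0))" for i
  proof
    fix t
    have "cis (real k * t) * cis (- real k * (t + 2*pi * real i / real N)) = cis (- real k * (2*pi * real i / real N))"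
      unfolding cis_mult by (rule arg_cong[of _ _ cis]) (simp add: algebra_simps)
    then show "twist (real k) (q i) t = (complex_of_real (lam * s * r) * cis (- real k * (2*pi * real i / real N)), 0)"
      unfolding q_def rot_loop_polygon twist_def by (simp add: mult_ac)
  qed
  have "L2_deriv 0 (2*pi) (twist (real k) (q i)) (\<lambda>_. 0)" for i
    unfolding tw by (simp add: L2_deriv_def sq_integrable_def)
  then have "action N (real k) q (2*pi) = (\<integral>\<^sup>+ t. potential N (\<lambda>i. q i t) \<partial>per_measure)"
    by (subst action_twist_eq[of N "real k" q "\<lambda>_ _. 0"]) auto
  also have "\<dots> = (\<integral>\<^sup>+ t. ennreal (C / lam) \<partial>per_measure)"
  proof (rule nn_integral_cong)
    fix t
    have "collision_free N q"
      unfolding q_def rot_loop_polygon by (rule polygon_collision_free[OF k]) (use s lam r in auto)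
    then have cf: "\<not> (\<exists>i<N. \<exists>j<N. i \<noteq> j \<and> q i t = q j t)" unfolding collision_free_def by blast
    have nrm: "norm (q i t - q j t) = lam * norm (polygon N k s r i - polygon N k s r j)" for i j
    proof -
      have "q i t - q j t = lam *\<^sub>R (cis (- real k * t) * fst (polygon N k s r i - polygon N k s r j), snd (polygon N k s r i - polygon N k s r j))"
        by (simp add: q_def rot_loop_def rot_def prod_eq_iff algebra_simps)
      moreover have "norm (cis (- real k * t) * fst d, snd d) = norm d" for d :: "complex \<times> real"
        by (simp add: norm_prod_def norm_mult)
      ultimately show ?thesis using lam by (simp only: norm_scaleR abs_of_pos)
    qed
    show "potential N (\<lambda>i. q i t) = ennreal (C / lam)"
      unfolding potential_eq if_not_P[OF cf] nrm C_def sum_divide_distrib by (simp add: mult.commute)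
  qed
  also have "\<dots> = ennreal (2 * pi * C / lam)"
    using lam C0 by (simp add: emeasure_restrict_space space_restrict_space mult_ac flip: ennreal_mult)
  finally show ?thesis by (simp add: q_def C_def)
qed

lemma rot_loop_mean: "mean_z0 (rot_loop k lam (polygon N k s r)) = 0"
  unfolding rot_loop_polygon by (simp add: mean_z0_def)

section \<open>Minimizers and minimizing sequences\<close>

lemma rot_loop_in_constraint:
  assumes "N \<ge> 2" "coprime k N" "s \<in> {1, -1}" "lam > 0" "r > 0"
  shows "rot_loop k lam (polygon N k s r) \<in> {q \<in> Lambda_xi N (pol_sign N k s). mean_z0 q = 0}"
  using rot_loop_polygon_in_Lambda_xi[OF assms] rot_loop_mean by simp

text \<open>The value 0 is approached by dilation but never attained: a loop is bounded, so
  \<open>action_lower_bound\<close> makes its action positive.\<close>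

lemma no_minimizer_polygon_class:
  assumes N: "N \<ge> 2" and k: "coprime k N" and s: "s \<in> {1, -1}"
  defines "X \<equiv> {q \<in> Lambda_xi N (pol_sign N k s). mean_z0 q = 0}"
  shows "\<not> (\<exists>q\<in>X. \<forall>p\<in>X. action N (real k) q (2*pi) \<le> action N (real k) p (2*pi))"
    and "(INF q\<in>X. action N (real k) q (2*pi)) = 0"
proof -
  define C where "C = 2 * pi * (\<Sum>i<N. \<Sum>j\<in>{i<..<N}. 1 / norm (polygon N k s 1 i - polygon N k s 1 j))"
  define p where "p = (\<lambda>n. rot_loop k (real (Suc n)) (polygon N k s 1))"
  have pX: "p n \<in> X" for n
    unfolding p_def X_def by (rule rot_loop_in_constraint[OF N k s]) auto
  have pact: "action N (real k) (p n) (2*pi) = ennreal (C / real (Suc n))" for n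
    unfolding p_def C_def by (rule action_rot_loop[OF k s]) auto
  have "(\<lambda>n. C * inverse (real (Suc n))) \<longlonglongrightarrow> C * 0"
    by (intro tendsto_mult tendsto_const LIMSEQ_inverse_real_of_nat)
  then have "(\<lambda>n. ennreal (C / real (Suc n))) \<longlonglongrightarrow> ennreal 0"
    by (intro tendsto_ennrealI) (simp add: divide_inverse)
  then have lim: "(\<lambda>n. action N (real k) (p n) (2*pi)) \<longlonglongrightarrow> 0" unfolding pact by simp
  have le0: "y \<le> 0" if "\<And>n. y \<le> action N (real k) (p n) (2*pi)" for y
    by (rule LIMSEQ_le_const[OF lim]) (use that in auto)
  show "(INF q\<in>X. action N (real k) q (2*pi)) = 0"
    using le0[of "INF q\<in>X. action N (real k) q (2*pi)"] INF_lower[OF pX, of "\<lambda>q. action N (real k) q (2*pi)"] by simp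
  show "\<not> (\<exists>q\<in>X. \<forall>p\<in>X. action N (real k) q (2*pi) \<le> action N (real k) p (2*pi))"
  proof
    assume "\<exists>q\<in>X. \<forall>p\<in>X. action N (real k) q (2*pi) \<le> action N (real k) p (2*pi)"
    then obtain q where q: "q \<in> X" "\<And>p. p \<in> X \<Longrightarrow> action N (real k) q (2*pi) \<le> action N (real k) p (2*pi)" by blast
    have "q \<in> Lambda_DN N" using q(1) by (auto simp: X_def dest: Lambda_xi_subset)
    then obtain B where B: "B > 0" "\<And>i t. i < N \<Longrightarrow> norm (q i t) \<le> B"
      using N by (auto elim: Lambda_DN_bounded)
    have "ennreal (pi / B) \<le> action N (real k) q (2*pi)" by (rule action_lower_bound[OF N B])
    also have "\<dots> \<le> 0" by (rule le0) (rule q(2)[OF pX])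
    finally have "pi / B \<le> 0" by (simp only: le_zero_eq ennreal_eq_0_iff)
    moreover have "pi / B > 0" using B(1) by simp
    ultimately show False by linarith
  qed
qed

lemma cfg_norm_rotating_polygon:
  assumes N: "N > 0"
  shows "cfg_norm N (\<lambda>i. (complex_of_real a * cis (\<theta> i), 0)) = sqrt (real N) * \<bar>a\<bar>"
  by (simp add: cfg_norm_def norm_Pair norm_mult real_sqrt_mult)

text \<open>The absolute deviation from the rotating polygon stays below 8 per mass while the
  amplitude grows, so the relative deviation tends to 0. The amplitude may change with
  \<open>n\<close>, but its sign is eventually \<open>s\<close>, because the two polygon classes
  have different sign vectors.\<close>

lemma minimizing_sequence_escapes:
  assumes N: "N \<ge> 2" and k: "coprime k N" and s: "s \<in> {1, -1}"
    and qn: "\<And>n. qn n \<in> Lambda_xi N (pol_sign N k s)" "\<And>n. mean_z0 (qn n) = 0"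
    and lim: "(\<lambda>n. action N (real k) (qn n) (2*pi)) \<longlonglongrightarrow> 0"
  shows "i < N \<Longrightarrow> \<exists>n0. \<forall>n\<ge>n0. \<forall>t. norm (qn n i t) \<ge> M"
    and "\<epsilon> > 0 \<Longrightarrow> \<exists>n0. \<forall>n\<ge>n0. \<forall>t.
      cfg_norm N (\<lambda>i. (1 / cfg_norm N (\<lambda>j. qn n j t)) *\<^sub>R qn n i t
        - (1 / cfg_norm N (Ngon N k s)) *\<^sub>R rot (- real k * t) (Ngon N k s) i) < \<epsilon>"
proof -
  have N0: "N > 0" using N by simp
  note DN = Lambda_xi_subset[OF qn(1)]
  have ev: "\<exists>n0. \<forall>n\<ge>n0. \<exists>a. \<bar>a\<bar> \<ge> R + 8 \<and> (\<forall>t. norm (qn n 0 t - (complex_of_real a * cis (- real k * t), 0)) \<le> 8)"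
    if R: "R \<ge> 0" for R
  proof -
    have "\<forall>\<^sub>F n in sequentially. action N (real k) (qn n) (2*pi) < ennreal (pi / (R + 17))"
      using R by (intro order_tendstoD(2)[OF lim]) (simp add: ennreal_less_zero_iff)
    then obtain n0 where n0: "\<And>n. n \<ge> n0 \<Longrightarrow> action N (real k) (qn n) (2*pi) < ennreal (pi / (R + 17))"
      by (auto simp: eventually_sequentially)
    have "\<exists>a. \<bar>a\<bar> \<ge> R + 8 \<and> (\<forall>t. norm (qn n 0 t - (complex_of_real a * cis (- real k * t), 0)) \<le> 8)" if "n \<ge> n0" for n
      using small_action_far_loop[OF N DN qn(2) R less_imp_le[OF n0[OF that]]] by metis
    then show ?thesis by blast
  qed
  have large: "norm (qn n 0 t) \<ge> \<bar>a\<bar> - 8"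
    if "\<And>t. norm (qn n 0 t - (complex_of_real a * cis (- real k * t), 0)) \<le> 8" for n t a
  proof -
    have "\<bar>a\<bar> = norm (complex_of_real a * cis (- real k * t), 0::real)" by (simp add: norm_Pair norm_mult)
    also have "\<dots> \<le> norm (qn n 0 t) + norm (qn n 0 t - (complex_of_real a * cis (- real k * t), 0))"
      by (metis norm_minus_commute norm_triangle_sub)
    finally show ?thesis using that[of t] by simp
  qed
  show "\<exists>n0. \<forall>n\<ge>n0. \<forall>t. norm (qn n i t) \<ge> M" if i: "i < N"
  proof -
    obtain n0 where n0: "\<And>n. n \<ge> n0 \<Longrightarrow> \<exists>a. \<bar>a\<bar> \<ge> \<bar>M\<bar> + 8 \<and> (\<forall>t. norm (qn n 0 t - (complex_of_real a * cis (- real k * t), 0)) \<le> 8)"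
      using ev[of "\<bar>M\<bar>"] by auto
    have "norm (qn n i t) \<ge> M" if n: "n \<ge> n0" for n t
    proof -
      obtain a where a: "\<bar>a\<bar> \<ge> \<bar>M\<bar> + 8" and dev: "\<And>t. norm (qn n 0 t - (complex_of_real a * cis (- real k * t), 0)) \<le> 8"
        using n0[OF n] by blast
      show ?thesis
        using large[OF dev, of "t + 2*pi * real i / real N"] a unfolding Lambda_DN_shift[OF DN i] by linarith
    qed
    then show ?thesis by blast
  qed
  show "\<exists>n0. \<forall>n\<ge>n0. \<forall>t.
      cfg_norm N (\<lambda>i. (1 / cfg_norm N (\<lambda>j. qn n j t)) *\<^sub>R qn n i t
        - (1 / cfg_norm N (Ngon N k s)) *\<^sub>R rot (- real k * t) (Ngon N k s) i) < \<epsilon>" if \<epsilon>: "\<epsilon> > 0"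
  proof -
    obtain \<mu> where \<mu>: "\<mu> > 0" "\<And>j. j \<in> {1..N-1} \<Longrightarrow> \<mu> \<le> \<bar>sin (real k * (real j * pi / real N))\<bar>"
      using sin_coprime_bounded_below[OF k] by blast
    obtain r where r: "r > 0" "Ngon N k s = polygon N k s r" using Ngon_eq_polygon[OF N k s] .
    define E where "E = real N * ((1 + real N) * 8)"
    have E0: "E \<ge> 0" by (simp add: E_def)
    \<comment> \<open>The first summand makes \<open>\<bar>a\<bar> * \<mu>\<close> exceed the
      deviation 8, as \<open>far_loop_sign\<close> requires; the second makes the normalization
      error \<open>E / \<bar>a\<bar>\<close> smaller than \<epsilon>.\<close>
    define R where "R = 8 / \<mu> + E / \<epsilon>"
    have R0: "R \<ge> 0" using \<mu> \<epsilon> E0 by (simp add: R_def)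
    obtain n0 where n0: "\<And>n. n \<ge> n0 \<Longrightarrow> \<exists>a. \<bar>a\<bar> \<ge> R + 8 \<and> (\<forall>t. norm (qn n 0 t - (complex_of_real a * cis (- real k * t), 0)) \<le> 8)"
      using ev[OF R0] by auto
    have "cfg_norm N (\<lambda>i. (1 / cfg_norm N (\<lambda>j. qn n j t)) *\<^sub>R qn n i t
        - (1 / cfg_norm N (Ngon N k s)) *\<^sub>R rot (- real k * t) (Ngon N k s) i) < \<epsilon>" if n: "n \<ge> n0" for n t
    proof -
      obtain a where a: "\<bar>a\<bar> \<ge> R + 8" and dev: "\<And>t. norm (qn n 0 t - (complex_of_real a * cis (- real k * t), 0)) \<le> 8"
        using n0[OF n] by blast
      have a0: "a \<noteq> 0" using a R0 by auto
      have aR: "\<bar>a\<bar> > 8 / \<mu>" "\<bar>a\<bar> > E / \<epsilon>"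
        using a \<mu>(1) \<epsilon> E0 divide_nonneg_pos[OF E0 \<epsilon>] divide_pos_pos[of 8 \<mu>] unfolding R_def by linarith+
      have "pol_sign N k s = pol_sign N k (sgn a)"
      proof (rule far_loop_sign[OF k pol_sign_in_Xi[OF k s] qn(1) dev])
        fix j assume j: "j \<in> {1..N-1}"
        have "8 < \<bar>a\<bar> * \<mu>" using aR(1) \<mu>(1) by (simp add: field_simps)
        also have "\<dots> \<le> \<bar>a\<bar> * \<bar>sin (real k * (real j * pi / real N))\<bar>" by (intro mult_left_mono \<mu>(2)[OF j]) simp
        finally show "8 < \<bar>a\<bar> * \<bar>sin (real k * (real j * pi / real N))\<bar>" .
      qed
      moreover have "sgn a \<in> {1, -1}" using a0 by (auto simp: sgn_if)
      ultimately have sa: "s = sgn a" using pol_sign_distinct[OF N k s] by blast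
      define c where "c = (\<lambda>i. (complex_of_real a * cis (- real k * (t + 2*pi * real i / real N)), 0::real))"
      have cN: "cfg_norm N c = sqrt (real N) * \<bar>a\<bar>" unfolding c_def by (rule cfg_norm_rotating_polygon[OF N0])
      have "1 \<le> sqrt (real N)" using N by simp
      then have cge: "\<bar>a\<bar> \<le> cfg_norm N c" unfolding cN using mult_right_mono[of 1 "sqrt (real N)" "\<bar>a\<bar>"] by simp
      \<comment> \<open>Normalization removes both the circumradius and
        \<open>\<bar>a\<bar>\<close>; only the signs remain, and they agree by
        \<open>s = sgn a\<close>.\<close>
      have target: "(1 / cfg_norm N (Ngon N k s)) *\<^sub>R rot (- real k * t) (Ngon N k s) i = (1 / cfg_norm N c) *\<^sub>R c i" for i
      proof -
        have "cfg_norm N (Ngon N k s) = sqrt (real N) * \<bar>s * r\<bar>"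
          unfolding r(2) polygon_def by (rule cfg_norm_rotating_polygon[OF N0])
        also have "\<bar>s * r\<bar> = r" using s r(1) by auto
        finally have nN: "cfg_norm N (Ngon N k s) = sqrt (real N) * r" .
        have "cis (- real k * t) * cis (- 2 * pi * real k * real i / real N) = cis (- real k * (t + 2*pi * real i / real N))"
          unfolding cis_mult by (rule arg_cong[of _ _ cis]) (simp add: field_simps)
        then have "rot (- real k * t) (Ngon N k s) i = (complex_of_real (s * r) * cis (- real k * (t + 2*pi * real i / real N)), 0)"
          by (simp add: r(2) rot_def polygon_def mult_ac)
        moreover have "(1 / (sqrt (real N) * r)) * (s * r) = (1 / (sqrt (real N) * \<bar>a\<bar>)) * a"
          using r(1) a0 by (simp add: sa sgn_if)
        then have "complex_of_real (1 / (sqrt (real N) * r)) * complex_of_real (s * r) = complex_of_real (1 / (sqrt (real N) * \<bar>a\<bar>)) * complex_of_real a"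
          by (metis of_real_mult)
        ultimately show ?thesis unfolding nN cN
          by (simp add: c_def scaleR_conv_of_real flip: mult.assoc)
      qed
      have xc: "norm (qn n i t - c i) \<le> 8" if "i < N" for i
        unfolding Lambda_DN_shift[OF DN that] c_def by (rule dev)
      have "norm (qn n 0 t) \<le> cfg_norm N (\<lambda>j. qn n j t)"
        unfolding cfg_norm_L2_set using N0 by (intro member_le_L2_set[of _ 0 "\<lambda>j. norm (qn n j t)"]) auto
      then have X: "cfg_norm N (\<lambda>j. qn n j t) > 0"
        using large[of n a t, OF dev] a aR(1) R0 E0 \<mu>(1) \<epsilon> divide_pos_pos[of 8 \<mu>] divide_nonneg_pos[OF E0 \<epsilon>]
        unfolding R_def by linarith
      have D: "cfg_norm N c > 0" using cge a0 by linarith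
      have "cfg_norm N (\<lambda>i. (1 / cfg_norm N (\<lambda>j. qn n j t)) *\<^sub>R qn n i t - (1 / cfg_norm N c) *\<^sub>R c i) \<le> real N * ((1 + real N) * 8 / cfg_norm N c)"
        by (rule cfg_norm_normalize_diff_le[OF xc X D])
      also have "\<dots> = E / cfg_norm N c" by (simp add: E_def)
      also have "\<dots> \<le> E / \<bar>a\<bar>" using cge E0 a0 by (intro divide_left_mono) (auto simp: D)
      also have "\<dots> < \<epsilon>" using aR(2) \<epsilon> a0 by (simp add: field_simps)
      finally show ?thesis unfolding target .
    qed
    then show ?thesis by blast
  qed
qed

lemma minimizer_exists:
  assumes N: "N \<ge> 2" and k: "coprime k N" and \<xi>: "\<xi> \<in> Xi N"
    and ne: "\<xi> \<noteq> pol_sign N k 1" "\<xi> \<noteq> pol_sign N k (-1)"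
  defines "X \<equiv> {q \<in> Lambda_xi N \<xi>. mean_z0 q = 0}"
  shows "\<exists>q\<in>X. \<forall>p\<in>X. action N (real k) q (2*pi) \<le> action N (real k) p (2*pi)"
proof -
  have N0: "N > 0" using N by simp
  define act where "act = (\<lambda>q. action N (real k) q (2*pi))"
  obtain q0 where q0: "q0 \<in> X" using Lambda_xi_nonempty[OF N \<xi>] unfolding X_def by blast
  define m where "m = (INF q\<in>X. act q)"
  have m_le: "m \<le> act q" if "q \<in> X" for q unfolding m_def by (rule INF_lower[OF that])
  show ?thesis
  proof (cases "m = top")
    \<comment> \<open>With no loop of finite action every loop of the class is a minimizer, and the
      class is not empty.\<close>
    case True
    then have "act p = top" if "p \<in> X" for p using m_le[OF that] by (simp add: top_unique)
    then show ?thesis using q0 unfolding act_def by (intro bexI[of _ q0]) auto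
  next
    case False
    then obtain m' where m': "m = ennreal m'" "m' \<ge> 0" by (cases m rule: ennreal_cases) auto
    have "\<exists>q\<in>X. act q < m + ennreal (1 / real (Suc n))" for n
    proof -
      have "m < m + ennreal (1 / real (Suc n))"
        using m' by (simp add: ennreal_less_iff flip: ennreal_plus)
      then show ?thesis unfolding m_def INF_less_iff .
    qed
    then obtain q where qX: "\<And>n. q n \<in> X" and qlt: "\<And>n. act (q n) < m + ennreal (1 / real (Suc n))" by metis
    have actlim: "(\<lambda>n. act (q n)) \<longlonglongrightarrow> m"
    proof (rule tendsto_sandwich[where f = "\<lambda>_. m" and h = "\<lambda>n. m + ennreal (1 / real (Suc n))"])
      have "(\<lambda>n. m + ennreal (1 / real (Suc n))) \<longlonglongrightarrow> m + ennreal 0"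
        using LIMSEQ_inverse_real_of_nat by (intro tendsto_intros tendsto_ennrealI) (simp add: inverse_eq_divide)
      then show "(\<lambda>n. m + ennreal (1 / real (Suc n))) \<longlonglongrightarrow> m" by simp
      show "\<forall>\<^sub>F n in sequentially. m \<le> act (q n)" using m_le[OF qX] by simp
      show "\<forall>\<^sub>F n in sequentially. act (q n) \<le> m + ennreal (1 / real (Suc n))" using qlt by (simp add: less_imp_le)
    qed simp
    define K where "K = m' + 1"
    have K0: "K \<ge> 0" using m' by (simp add: K_def)
    have actK: "action N (real k) (q n) (2*pi) \<le> ennreal K" for n
    proof -
      have "act (q n) \<le> m + ennreal (1 / real (Suc n))" using qlt by (rule less_imp_le)
      also have "\<dots> = ennreal (m' + 1 / real (Suc n))" using m' by (simp add: ennreal_plus)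
      also have "\<dots> \<le> ennreal K" unfolding K_def by (intro ennreal_leI) simp
      finally show ?thesis by (simp add: act_def)
    qed
    have qxi: "q n \<in> Lambda_xi N \<xi>" and qmean: "mean_z0 (q n) = 0" for n using qX by (auto simp: X_def)
    note DN = Lambda_xi_subset[OF qxi]
    obtain \<mu> where \<mu>: "\<mu> > 0" "\<And>j. j \<in> {1..N-1} \<Longrightarrow> \<mu> \<le> \<bar>sin (real k * (real j * pi / real N))\<bar>"
      using sin_coprime_bounded_below[OF k] by blast
    define \<delta> where "\<delta> = 4 * sqrt (pi * K)"
    have \<delta>0: "\<delta> \<ge> 0" using K0 by (simp add: \<delta>_def)
    \<comment> \<open>The amplitude is at most \<open>\<delta> / \<mu>\<close>, since a larger one
      would put \<xi> among the polygon classes; the remaining \<delta> is the deviation.\<close>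
    define B where "B = \<delta> / \<mu> + \<delta>"
    have bound0: "norm (q n 0 t) \<le> B" for n t
    proof -
      obtain a where a: "\<And>t. norm (q n 0 t - (complex_of_real a * cis (- real k * t), 0)) \<le> \<delta>"
        using loop_deviation[OF DN N0 qmean actK K0] unfolding \<delta>_def by blast
      have "\<bar>a\<bar> * \<mu> \<le> \<delta>"
      proof (rule ccontr)
        assume "\<not> \<bar>a\<bar> * \<mu> \<le> \<delta>"
        then have lt: "\<delta> < \<bar>a\<bar> * \<mu>" by simp
        have "\<xi> = pol_sign N k (sgn a)"
        proof (rule far_loop_sign[OF k \<xi> qxi a])
          fix j assume j: "j \<in> {1..N-1}"
          show "\<delta> < \<bar>a\<bar> * \<bar>sin (real k * (real j * pi / real N))\<bar>"
            using lt mult_left_mono[OF \<mu>(2)[OF j], of "\<bar>a\<bar>"] by simp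
        qed
        moreover have "a \<noteq> 0" using lt \<delta>0 by auto
        ultimately show False using ne by (auto simp: sgn_if split: if_splits)
      qed
      then have "\<bar>a\<bar> \<le> \<delta> / \<mu>" using \<mu>(1) by (simp add: field_simps)
      moreover have "norm (q n 0 t) \<le> norm (q n 0 t - (complex_of_real a * cis (- real k * t), 0)) + norm (complex_of_real a * cis (- real k * t), 0::real)"
        by (rule order_trans[OF _ norm_triangle_ineq]) simp
      ultimately show ?thesis using a[of t] by (simp add: B_def norm_Pair norm_mult)
    qed
    have bound: "norm (q n i t) \<le> B" if "i < N" for n i t
      unfolding Lambda_DN_shift[OF DN that] by (rule bound0)
    have "\<exists>W. \<forall>i<N. L2_deriv 0 (2*pi) (twist (real k) (q n i)) (W i) \<and> energy (W i) \<le> 2 * K" for n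
      using Lambda_DN_twist_deriv[OF DN N0 actK K0] by metis
    then obtain W where W: "\<And>n i. i < N \<Longrightarrow> L2_deriv 0 (2*pi) (twist (real k) (q n i)) (W n i)"
      and WK: "\<And>n i. i < N \<Longrightarrow> energy (W n i) \<le> 2 * K" by metis
    obtain g r where r: "strict_mono (r :: nat \<Rightarrow> nat)"
      and g: "\<And>e. 0 < e \<Longrightarrow> \<exists>M. \<forall>n x. n \<ge> M \<and> x \<in> {0..2*pi} \<longrightarrow> norm (twist (real k) (q (r n) 0) x - g x) < e"
    proof (rule Arzela_Ascoli[of "{0..2*pi}" "\<lambda>n. twist (real k) (q n 0)" B])
      show "norm (twist (real k) (q n 0) x) \<le> B" for n x unfolding norm_twist by (rule bound0)
      show "\<exists>d. 0 < d \<and> (\<forall>n y. y \<in> {0..2*pi} \<and> norm (x - y) < d \<longrightarrow>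
          norm (twist (real k) (q n 0) x - twist (real k) (q n 0) y) < e)" if x: "x \<in> {0..2*pi}" and e: "0 < e" for x e
      \<comment> \<open>The common Hoelder constant of the twisted loops is at most
        \<open>sqrt (2 * K)\<close>; adding 1 makes the quotient defined also when \<open>K\<close>
        is 0.\<close>
      proof (intro exI[of _ "e\<^sup>2 / (2 * K + 1)"] conjI allI impI)
        show "0 < e\<^sup>2 / (2 * K + 1)" using e K0 by simp
        fix n y assume y: "y \<in> {0..2*pi} \<and> norm (x - y) < e\<^sup>2 / (2 * K + 1)"
        have "norm (twist (real k) (q n 0) x - twist (real k) (q n 0) y) \<le> sqrt (\<bar>x - y\<bar> * energy (W n 0))"
          by (rule L2_deriv_Holder[OF W[OF N0]]) (use x y in auto)
        also have "\<dots> \<le> sqrt (\<bar>x - y\<bar> * (2 * K + 1))"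
          using WK[OF N0, of n] by (intro real_sqrt_le_mono mult_left_mono) auto
        also have "\<dots> < sqrt (e\<^sup>2)"
          using y K0 by (intro real_sqrt_less_mono) (simp add: field_simps)
        finally show "norm (twist (real k) (q n 0) x - twist (real k) (q n 0) y) < e" using e by simp
      qed
    qed auto
    have conv0: "(\<lambda>n. q (r n) 0 t) \<longlonglongrightarrow> twist (- real k) g t" if t: "t \<in> {0..2*pi}" for t
    proof -
      have "(\<lambda>n. twist (real k) (q (r n) 0) t) \<longlonglongrightarrow> g t"
        unfolding LIMSEQ_iff using g t by blast
      then have "(\<lambda>n. twist (- real k) (twist (real k) (q (r n) 0)) t) \<longlonglongrightarrow> twist (- real k) g t"
        unfolding twist_def[of "- real k"] by (intro tendsto_intros)
      then show ?thesis unfolding twist_twist .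
    qed
    have conv: "convergent (\<lambda>n. q (r n) 0 t)" for t
    proof -
      obtain s j where s: "s \<in> {0..2*pi}" "t = s + 2*pi * of_int j" by (rule period_reduction)
      have "q (r n) 0 t = q (r n) 0 s" for n
        unfolding s(2) by (rule periodic_int_shift[of "q (r n) 0", OF Lambda_DN_periodic[OF DN N0]])
      then have "(\<lambda>n. q (r n) 0 t) \<longlonglongrightarrow> twist (- real k) g s" using conv0[OF s(1)] by simp
      then show ?thesis by (rule convergentI)
    qed
    \<comment> \<open>Only mass 0 is extracted from the compactness argument; the other masses are
      defined as its shifts, so the choreography symmetry of the limit holds by
      construction.\<close>
    define Q where "Q = (\<lambda>(i::nat) t. lim (\<lambda>n. q (r n) 0 (t + 2*pi * real i / real N)))"
    have limQ0: "(\<lambda>n. q (r n) 0 t) \<longlonglongrightarrow> Q 0 t" for t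
      using conv[of t] by (simp add: Q_def convergent_LIMSEQ_iff)
    have Qshift: "Q i t = Q 0 (t + 2*pi * real i / real N)" for i t by (simp add: Q_def)
    have limQ: "(\<lambda>n. q (r n) i t) \<longlonglongrightarrow> Q i t" if "i < N" for i t
      unfolding Lambda_DN_shift[OF DN that] unfolding Qshift[of i] by (rule limQ0)
    have Qper: "Q 0 (t + 2*pi) = Q 0 t" for t
    proof (rule LIMSEQ_unique)
      show "(\<lambda>n. q (r n) 0 (t + 2*pi)) \<longlonglongrightarrow> Q 0 (t + 2*pi)" by (rule limQ0)
      show "(\<lambda>n. q (r n) 0 (t + 2*pi)) \<longlonglongrightarrow> Q 0 t" unfolding Lambda_DN_periodic[OF DN N0] by (rule limQ0)
    qed
    have Qrefl: "Q 0 (2*pi - t) = Rxz (Q 0 t)" for t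
    proof (rule LIMSEQ_unique)
      show "(\<lambda>n. q (r n) 0 (2*pi - t)) \<longlonglongrightarrow> Q 0 (2*pi - t)" by (rule limQ0)
      have "q (r n) 0 (2*pi - t) = Rxz (q (r n) 0 t)" for n using DN[of "r n"] unfolding Lambda_DN_def by blast
      moreover have "(\<lambda>n. Rxz (q (r n) 0 t)) \<longlonglongrightarrow> Rxz (Q 0 t)"
        unfolding Rxz_def by (intro tendsto_intros limQ0)
      ultimately show "(\<lambda>n. q (r n) 0 (2*pi - t)) \<longlonglongrightarrow> Rxz (Q 0 t)" by simp
    qed
    have Qbound: "norm (Q i t) \<le> B" if "i < N" for i t
      by (rule Lim_bounded[OF tendsto_norm[OF limQ[OF that]], of 0]) (use bound[OF that] in auto)
    text \<open>Weak limits in the rotating frame give lower semicontinuity, those in the inertial frame weak closedness.\<close>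
    define PW where "PW = (\<lambda>i w. L2_deriv 0 (2*pi) (twist (real k) (Q i)) w \<and> (\<forall>p. sq_integrable per_measure p \<longrightarrow>
        (\<lambda>n. L2_inner (W (r n) i) p) \<longlonglongrightarrow> L2_inner w p))"
    have "\<exists>w. PW i w" if i: "i < N" for i
    proof -
      have tl: "(\<lambda>n. twist (real k) (q (r n) i) t) \<longlonglongrightarrow> twist (real k) (Q i) t" for t
        unfolding twist_def by (intro tendsto_intros limQ[OF i])
      show ?thesis
        unfolding PW_def by (rule L2_deriv_weak_limit[OF W[OF i] WK[OF i] tl]) blast
    qed
    then obtain w where "\<And>i. i < N \<Longrightarrow> PW i (w i)" by metis
    then have w: "\<And>i. i < N \<Longrightarrow> L2_deriv 0 (2*pi) (twist (real k) (Q i)) (w i)"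
      and wweak: "\<And>i p. i < N \<Longrightarrow> sq_integrable per_measure p \<Longrightarrow>
        (\<lambda>n. L2_inner (W (r n) i) p) \<longlonglongrightarrow> L2_inner (w i) p"
      unfolding PW_def by blast+
    \<comment> \<open>The bound of \<open>L2_deriv_twist\<close> for untwisting with
      \<open>- k\<close>, with energy at most \<open>2 * K\<close> and sup norm at most
      \<open>B\<close>.\<close>
    define K' where "K' = 2 * (2 * K) + 4 * pi * (- real k * B)\<^sup>2"
    define PV where "PV = (\<lambda>n i v. L2_deriv 0 (2*pi) (q n i) v \<and> energy v \<le> K')"
    have exPV: "\<exists>v. PV n i v" if i: "i < N" for n i
    proof -
      have b: "norm (twist (real k) (q n i) t) \<le> B" for t unfolding norm_twist by (rule bound[OF i])
      obtain v where v: "L2_deriv 0 (2*pi) (twist (- real k) (twist (real k) (q n i))) v"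
        "energy v \<le> 2 * energy (W n i) + 4 * pi * (- real k * B)\<^sup>2"
        by (rule L2_deriv_twist[OF W[OF i] b, where c = "- real k"]) blast
      then show ?thesis using WK[OF i, of n] unfolding twist_twist K'_def PV_def by (intro exI[of _ v]) auto
    qed
    define v where "v = (\<lambda>n i. SOME v. PV n i v)"
    have "PV n i (v n i)" if "i < N" for n i
      unfolding v_def using exPV[OF that] by (rule someI_ex)
    then have v: "\<And>n i. i < N \<Longrightarrow> L2_deriv 0 (2*pi) (q n i) (v n i)"
      and vK: "\<And>n i. i < N \<Longrightarrow> energy (v n i) \<le> K'"
      unfolding PV_def by blast+
    define PU where "PU = (\<lambda>i u. L2_deriv 0 (2*pi) (Q i) u \<and> (\<forall>p. sq_integrable per_measure p \<longrightarrow>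
        (\<lambda>n. L2_inner (v (r n) i) p) \<longlonglongrightarrow> L2_inner u p))"
    have "\<exists>u. PU i u" if i: "i < N" for i
      unfolding PU_def by (rule L2_deriv_weak_limit[OF v[OF i] vK[OF i] limQ[OF i]]) blast
    then obtain u where "\<And>i. i < N \<Longrightarrow> PU i (u i)" by metis
    then have u: "\<And>i. i < N \<Longrightarrow> L2_deriv 0 (2*pi) (Q i) (u i)"
      and uweak: "\<And>i p. i < N \<Longrightarrow> sq_integrable per_measure p \<Longrightarrow>
        (\<lambda>n. L2_inner (v (r n) i) p) \<longlonglongrightarrow> L2_inner (u i) p"
      unfolding PU_def by blast+
    have "Q i (t + 2*pi) = Q i t" for i t
      unfolding Qshift[of i] using Qper[of "t + 2*pi * real i / real N"] by (simp add: algebra_simps)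
    then have QH1: "H1_loop N Q" unfolding H1_loop_iff using u by blast
    then have QDN: "Q \<in> Lambda_DN N"
      unfolding Lambda_DN_def mem_Collect_eq using Qshift Qrefl by blast
    have "Q \<in> Lambda_xi N \<xi>"
    proof (rule Lambda_xi_weak_limit[of "\<lambda>n. q (r n)", OF qxi QDN])
      fix p assume p: "H1_loop N p"
      show "(\<lambda>n. H1_inner N (\<lambda>i t. q (r n) i t - Q i t) p) \<longlonglongrightarrow> 0"
      proof (rule H1_inner_tendsto_0[OF v u limQ _ uweak p])
        show "norm (q (r n) i t - Q i t) \<le> B + B" if "i < N" for n i t
          using bound[OF that, of "r n" t] Qbound[OF that, of t] norm_triangle_ineq4[of "q (r n) i t" "Q i t"] by linarith
      qed
    qed
    moreover have "mean_z0 Q = 0"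
    proof -
      have "((\<lambda>n. integral {0..2*pi} (\<lambda>t. snd (q (r n) 0 t))) \<longlonglongrightarrow> integral {0..2*pi} (\<lambda>t. snd (Q 0 t)))"
      proof (rule dominated_convergence(2))
        show "(\<lambda>t. snd (q (r n) 0 t)) integrable_on {0..2*pi}" for n
          by (intro integrable_continuous_real continuous_intros L2_deriv_continuous_on[OF v[OF N0]])
        show "(\<lambda>t. B) integrable_on {0..2*pi}" by (rule integrable_const_ivl)
        show "norm (snd (q (r n) 0 t)) \<le> B" for n t
          using bound0[of "r n" t] norm_snd_le[of "snd (q (r n) 0 t)" "fst (q (r n) 0 t)"] by simp
        show "(\<lambda>n. snd (q (r n) 0 t)) \<longlonglongrightarrow> snd (Q 0 t)" for t by (intro tendsto_intros limQ0)
      qed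
      moreover have "integral {0..2*pi} (\<lambda>t. snd (q (r n) 0 t)) = 0" for n using qmean[of "r n"] by (simp add: mean_z0_def)
      ultimately have "integral {0..2*pi} (\<lambda>t. snd (Q 0 t)) = 0" by (simp add: LIMSEQ_const_iff)
      then show ?thesis by (simp add: mean_z0_def)
    qed
    ultimately have QX: "Q \<in> X" by (simp add: X_def)
    have "action N (real k) Q (2*pi) \<le> m"
    proof (rule action_lower_semicontinuous[of N "real k" "\<lambda>n. q (r n)" "\<lambda>n. W (r n)" Q w])
      show "(\<lambda>n. action N (real k) (q (r n)) (2*pi)) \<longlonglongrightarrow> m"
        using LIMSEQ_subseq_LIMSEQ[OF actlim r] by (simp add: act_def o_def)
    qed (use W w limQ wweak in auto)
    then show ?thesis using QX m_le unfolding act_def by (intro bexI[of _ Q]) (auto intro: order_trans)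
  qed
qed

theorem mainTheorem4:
  fixes N k :: nat and \<xi> :: "nat \<Rightarrow> real"
  assumes N: "N \<ge> 2"
    and \<xi>: "\<xi> \<in> Xi N"
    and k: "1 \<le> k" "k \<le> N - 1" "coprime k N"
  shows
    "(\<xi> \<notin> {xi_Ngon N k 1, xi_Ngon N k (-1)} \<longrightarrow>
        (\<exists>q\<in>{q \<in> Lambda_xi N \<xi>. mean_z0 q = 0}.
           \<forall>p\<in>{q \<in> Lambda_xi N \<xi>. mean_z0 q = 0}. action N (real k) q (2*pi) \<le> action N (real k) p (2*pi)))
   \<and> (\<xi> \<in> {xi_Ngon N k 1, xi_Ngon N k (-1)} \<longrightarrow>
        \<not> (\<exists>q\<in>{q \<in> Lambda_xi N \<xi>. mean_z0 q = 0}.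
           \<forall>p\<in>{q \<in> Lambda_xi N \<xi>. mean_z0 q = 0}. action N (real k) q (2*pi) \<le> action N (real k) p (2*pi))
        \<and> (INF q\<in>{q \<in> Lambda_xi N \<xi>. mean_z0 q = 0}. action N (real k) q (2*pi)) = 0)
   \<and> (\<forall>s\<in>{1, -1::real}. \<forall>qn :: nat \<Rightarrow> loop.
        \<xi> = xi_Ngon N k s \<longrightarrow>
        (\<forall>n. qn n \<in> Lambda_xi N \<xi> \<and> mean_z0 (qn n) = 0) \<longrightarrow>
        (\<lambda>n. action N (real k) (qn n) (2*pi)) \<longlonglongrightarrow> 0 \<longrightarrow>
        (\<forall>i<N. \<forall>M. \<exists>n0. \<forall>n\<ge>n0. \<forall>t. norm (qn n i t) \<ge> M)
        \<and> (\<exists>r :: nat \<Rightarrow> nat. strict_mono r \<and>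
             (\<forall>\<epsilon>>0. \<exists>n0. \<forall>n\<ge>n0. \<forall>t.
                cfg_norm N (\<lambda>i. (1 / cfg_norm N (\<lambda>j. qn (r n) j t)) *\<^sub>R qn (r n) i t
                   - (1 / cfg_norm N (Ngon N k s)) *\<^sub>R rot (- real k * t) (Ngon N k s) i) < \<epsilon>)))"
proof -
  have X1: "xi_Ngon N k s = pol_sign N k s" if "s \<in> {1, -1}" for s
    by (rule xi_Ngon_eq[OF N k(3) that])
  have eqs: "xi_Ngon N k 1 = pol_sign N k 1" "xi_Ngon N k (-1) = pol_sign N k (-1)"
    using X1 by auto
  have a: "\<exists>q\<in>{q \<in> Lambda_xi N \<xi>. mean_z0 q = 0}.
      \<forall>p\<in>{q \<in> Lambda_xi N \<xi>. mean_z0 q = 0}. action N (real k) q (2*pi) \<le> action N (real k) p (2*pi)"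
    if "\<xi> \<notin> {xi_Ngon N k 1, xi_Ngon N k (-1)}"
    using minimizer_exists[OF N k(3) \<xi>] that unfolding eqs by blast
  have b: "\<not> (\<exists>q\<in>{q \<in> Lambda_xi N \<xi>. mean_z0 q = 0}.
      \<forall>p\<in>{q \<in> Lambda_xi N \<xi>. mean_z0 q = 0}. action N (real k) q (2*pi) \<le> action N (real k) p (2*pi))
      \<and> (INF q\<in>{q \<in> Lambda_xi N \<xi>. mean_z0 q = 0}. action N (real k) q (2*pi)) = 0"
    if \<xi>N: "\<xi> \<in> {xi_Ngon N k 1, xi_Ngon N k (-1)}"
  proof -
    obtain s where s: "s \<in> {1, -1}" "\<xi> = pol_sign N k s" using \<xi>N unfolding eqs by blast
    show ?thesis unfolding s(2) using no_minimizer_polygon_class[OF N k(3) s(1)] by blast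
  qed
  have c: "(\<forall>i<N. \<forall>M. \<exists>n0. \<forall>n\<ge>n0. \<forall>t. norm (qn n i t) \<ge> M)
        \<and> (\<exists>r :: nat \<Rightarrow> nat. strict_mono r \<and>
             (\<forall>\<epsilon>>0. \<exists>n0. \<forall>n\<ge>n0. \<forall>t.
                cfg_norm N (\<lambda>i. (1 / cfg_norm N (\<lambda>j. qn (r n) j t)) *\<^sub>R qn (r n) i t
                   - (1 / cfg_norm N (Ngon N k s)) *\<^sub>R rot (- real k * t) (Ngon N k s) i) < \<epsilon>))"
    if s: "s \<in> {1, -1}" and \<xi>s: "\<xi> = xi_Ngon N k s"
      and qn: "\<forall>n. qn n \<in> Lambda_xi N \<xi> \<and> mean_z0 (qn n) = 0"
      and lim: "(\<lambda>n. action N (real k) (qn n) (2*pi)) \<longlonglongrightarrow> 0" for s :: real and qn :: "nat \<Rightarrow> loop"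
  proof -
    have q1: "qn n \<in> Lambda_xi N (pol_sign N k s)" and q2: "mean_z0 (qn n) = 0" for n
      using qn unfolding \<xi>s X1[OF s] by auto
    note esc = minimizing_sequence_escapes[OF N k(3) s q1 q2 lim]
    \<comment> \<open>The whole sequence already converges after normalization, so the identity
      serves as the subsequence.\<close>
    show ?thesis
      using esc(1) esc(2) by (intro conjI exI[of _ id]) (auto simp: strict_mono_id)
  qed
  show ?thesis using a b c by blast
qed


end
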